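(* Let $\lambda,\nu$ be $\sigma$-finite measures on a measurable space $(\mathbb X,\mathcal X)$, let $\rho$ be a $\sigma$-finite measure on $\mathbb X$ with $\lambda+\nu\ll\rho$, and let $h_\lambda:=\mathrm d\lambda/\mathrm d\rho$, $h_\nu:=\mathrm d\nu/\mathrm d\rho$. Assume that $$\int(1-h_\lambda)^2\,\mathrm d\rho+\int(1-h_\nu)^2\,\mathrm d\rho<\infty.$$ Let $f:\mathbf N\to\mathbb R$ be a measurable function such that $\mathbb E_\rho f(\Phi)^2<\infty$. Then $$\sum_{n=0}^\infty\frac1{n!}\int\big|\mathbb E_\lambda D^n_{x_1,\ldots,x_n}f(\Phi)\big|\,|h_\nu-h_\lambda|^{\otimes n}(x_1,\ldots,x_n)\,\rho^n(\mathrm d(x_1,\ldots,x_n))<\infty$$ and $$\mathbb E_\nu f(\Phi)=\mathbb E_\lambda f(\Phi)+\sum_{n=1}^\infty\frac1{n!}\int\big(\mathbb E_\lambda D^n_{x_1,\ldots,x_n}f(\Phi)\big)\,(\nu-\lambda)^n(\mathrm d(x_1,\ldots,x_n)).$$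
   Context: $\mathbf N$ is the space of $\sigma$-finite measures $\varphi$ on $\mathbb X$ with values in $\{0,1,2,\ldots\}\cup\{\infty\}$, equipped with the smallest $\sigma$-field making all maps $\varphi\mapsto\varphi(B)$, $B\in\mathcal X$, measurable. For a $\sigma$-finite measure $\lambda$ on $\mathbb X$, $\Pi_\lambda$ denotes the distribution (on $\mathbf N$) of a Poisson process with intensity measure $\lambda$. $\Phi:\Omega\to\mathbf N$ is a fixed measurable map on a measurable space $\Omega$, and for every such $\lambda$, $\mathbb P_\lambda$ is a probability measure on $\Omega$ with $\mathbb P_\lambda(\Phi\in\cdot)=\Pi_\lambda$; $\mathbb E_\lambda$ is the corresponding expectation. For $f:\mathbf N\to\mathbb R$ measurable, $n\in\mathbb N$ and $x_1,\ldots,x_n\in\mathbb X$, $$D^n_{x_1,\ldots,x_n}f(\varphi)=\sum_{J\subset\{1,\ldots,n\}}(-1)^{n-|J|}f\Big(\varphi+\sum_{j\in J}\delta_{x_j}\Big),$$ with $D^0f=f$, $D_x=D^1_x$. Functions $(x_1,\ldots,x_n)\mapsto\mathbb E_\lambda D^n_{x_1,\ldots,x_n}f(\Phi)$ are understood almost everywhere with respect to the (total variation of the) measure against which they are integrated. The $n=0$ summand in the first series is $|\mathbb E_\lambda f(\Phi)|$. For $h:\mathbb X\to\mathbb R$, $h^{\otimes n}(x_1,\ldots,x_n):=\prod_{j=1}^n h(x_j)$. Integration with respect to $(\nu-\lambda)^n$ is defined by $\int g\,\mathrm d(\nu-\lambda)^n:=\int g\,(h_\nu-h_\lambda)^{\otimes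 n}\,\mathrm d\rho^n$ (this does not depend on the choice of the dominating $\sigma$-finite measure $\rho$). *)

theory Defs
  imports "HOL-Probability.Probability"
begin

text \<open>
  A measurable space is represented by a measure of which only the space and the
  sigma-algebra matter.
\<close>

definition config_set :: "'a measure \<Rightarrow> 'a measure set" where
  "config_set X = {\<phi>. sets \<phi> = sets X \<and> sigma_finite_measure \<phi> \<and>
     (\<forall>B\<in>sets X. emeasure \<phi> B \<in> insert \<infinity> (range of_nat))}"

text \<open>
  The supremum below is the smallest sigma-algebra making all evaluations
  \<open>\<phi> \<mapsto> \<phi>(B)\<close> measurable (same construction as \<^const>\<open>subprob_algebra\<close>).
\<close>

definition config_space :: "'a measure \<Rightarrow> 'a measure measure" where
  "config_space X =
     (SUP B\<in>sets X. vimage_algebra (config_set X) (\<lambda>\<phi>. emeasure \<phi> B) borel)"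

lemma space_config_space: "space (config_space X) = config_set X"
  by (auto simp add: config_space_def space_Sup_eq_UN)

lemma measurable_emeasure_config_space [measurable]:
  "B \<in> sets X \<Longrightarrow> (\<lambda>\<phi>. emeasure \<phi> B) \<in> borel_measurable (config_space X)"
  by (auto intro!: measurable_Sup1 measurable_vimage_algebra1 simp: config_space_def)

lemma measurable_config_spaceI:
  assumes "\<And>w. w \<in> space W \<Longrightarrow> K w \<in> config_set X"
    and "\<And>B. B \<in> sets X \<Longrightarrow> (\<lambda>w. emeasure (K w) B) \<in> borel_measurable W"
  shows "K \<in> measurable W (config_space X)"
  using assms by (auto intro!: measurable_Sup2 measurable_vimage_algebra2 simp: config_space_def)

text \<open>
  The Poisson distribution on \<open>{0,1,2,\<dots>} \<union> {\<infinity>}\<close> with parameter in \<open>[0,\<infinity>]\<close>;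
  the library's \<^const>\<open>poisson_pmf\<close> is only specified for a positive finite parameter.
\<close>

definition poisson_dist :: "ennreal \<Rightarrow> ennreal measure" where
  "poisson_dist c =
     (if c = 0 then return borel 0
      else if c = \<infinity> then return borel \<infinity>
      else distr (measure_pmf (poisson_pmf (enn2real c))) borel of_nat)"

text \<open>
  \<open>is_poisson_law X \<lambda> Q\<close>: the probability measure \<open>Q\<close> on the configuration space is
  \<open>\<Pi>\<^sub>\<lambda>\<close>, the law of a Poisson process with intensity measure \<open>\<lambda>\<close>.
\<close>

definition is_poisson_law :: "'a measure \<Rightarrow> 'a measure \<Rightarrow> 'a measure measure \<Rightarrow> bool" where
  "is_poisson_law X lam Q \<longleftrightarrow>
     prob_space Q \<and> sets Q = sets (config_space X) \<and>
     (\<forall>B\<in>sets X. distr Q borel (\<lambda>\<phi>. emeasure \<phi> B) = poisson_dist (emeasure lam B)) \<and>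
     (\<forall>(m::nat) B. (\<forall>i\<in>{1..m}. B i \<in> sets X) \<and> disjoint_family_on B {1..m} \<longrightarrow>
        prob_space.indep_vars Q (\<lambda>_. borel) (\<lambda>i \<phi>. emeasure \<phi> (B i)) {1..m})"

definition add_measure :: "'a measure \<Rightarrow> 'a measure \<Rightarrow> 'a measure" where
  "add_measure \<mu> \<nu> = measure_of (space \<mu>) (sets \<mu>) (\<lambda>B. emeasure \<mu> B + emeasure \<nu> B)"

lemma sets_add_measure [simp]: "sets (add_measure \<mu> \<nu>) = sets \<mu>"
  by (simp add: add_measure_def)

lemma emeasure_add_measure:
  assumes "sets \<nu> = sets \<mu>" "B \<in> sets \<mu>"
  shows "emeasure (add_measure \<mu> \<nu>) B = emeasure \<mu> B + emeasure \<nu> B"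
  unfolding add_measure_def
proof (rule emeasure_measure_of_sigma)
  show "sigma_algebra (space \<mu>) (sets \<mu>)" ..
  show "positive (sets \<mu>) (\<lambda>B. emeasure \<mu> B + emeasure \<nu> B)"
    by (simp add: positive_def)
  show "countably_additive (sets \<mu>) (\<lambda>B. emeasure \<mu> B + emeasure \<nu> B)"
    using assms(1)
    by (auto simp: countably_additive_def suminf_add[symmetric] suminf_emeasure)
qed fact

text \<open>\<open>add_points \<phi> J x\<close> is \<open>\<phi> + (\<Sum>j\<in>J. \<delta>\<^bsub>x j\<^esub>)\<close>; \<^const>\<open>return\<close> is the Dirac measure.\<close>

definition add_points :: "'a measure \<Rightarrow> nat set \<Rightarrow> (nat \<Rightarrow> 'a) \<Rightarrow> 'a measure" where
  "add_points \<phi> J x =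
     measure_of (space \<phi>) (sets \<phi>) (\<lambda>B. emeasure \<phi> B + (\<Sum>j\<in>J. emeasure (return \<phi> (x j)) B))"

lemma sets_add_points [simp]: "sets (add_points \<phi> J x) = sets \<phi>"
  by (simp add: add_points_def)

lemma emeasure_add_points:
  assumes "B \<in> sets \<phi>"
  shows "emeasure (add_points \<phi> J x) B = emeasure \<phi> B + (\<Sum>j\<in>J. indicator B (x j))"
proof -
  have "emeasure (add_points \<phi> J x) B = emeasure \<phi> B + (\<Sum>j\<in>J. emeasure (return \<phi> (x j)) B)"
    unfolding add_points_def
  proof (rule emeasure_measure_of_sigma)
    show "sigma_algebra (space \<phi>) (sets \<phi>)" ..
    show "positive (sets \<phi>) (\<lambda>B. emeasure \<phi> B + (\<Sum>j\<in>J. emeasure (return \<phi> (x j)) B))"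
      by (simp add: positive_def)
    have *: "(\<Sum>i. \<Sum>j\<in>J. emeasure (return \<phi> (x j)) (A i)) = (\<Sum>j\<in>J. emeasure (return \<phi> (x j)) (\<Union>i. A i))"
      if "range A \<subseteq> sets \<phi>" "disjoint_family A" for A :: "nat \<Rightarrow> 'a set"
      using that by (subst suminf_sum) (auto intro!: sum.cong suminf_emeasure simp del: emeasure_return)
    show "countably_additive (sets \<phi>) (\<lambda>B. emeasure \<phi> B + (\<Sum>j\<in>J. emeasure (return \<phi> (x j)) B))"
      unfolding countably_additive_def
      by (intro allI impI, subst suminf_add[symmetric]) (simp_all add: suminf_emeasure * del: emeasure_return)
  qed fact
  with assms show ?thesis by simp
qed

definition diff_op :: "nat \<Rightarrow> (nat \<Rightarrow> 'a) \<Rightarrow> ('a measure \<Rightarrow> real) \<Rightarrow> 'a measure \<Rightarrow> real" where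
  "diff_op n x f \<phi> = (\<Sum>J\<in>Pow {1..n}. (-1) ^ (n - card J) * f (add_points \<phi> J x))"

text \<open>
  A real-valued version of the density; the library's \<^const>\<open>RN_deriv\<close> has values in
  \<open>[0,\<infinity>]\<close> and is almost everywhere finite for sigma-finite measures.
\<close>

definition rn_density :: "'a measure \<Rightarrow> 'a measure \<Rightarrow> 'a \<Rightarrow> real" where
  "rn_density rho mu x = enn2real (RN_deriv rho mu x)"

definition tensor_power :: "nat \<Rightarrow> ('a \<Rightarrow> real) \<Rightarrow> (nat \<Rightarrow> 'a) \<Rightarrow> real" where
  "tensor_power n h x = (\<Prod>j\<in>{1..n}. h (x j))"

text \<open>
  For \<open>n = 0\<close> this is the unit point mass on the space whose only element is the empty tuple.
\<close>

definition measure_power :: "'a measure \<Rightarrow> nat \<Rightarrow> (nat \<Rightarrow> 'a) measure" where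
  "measure_power rho n = PiM {1..n} (\<lambda>_. rho)"

text \<open>
  The integral with respect to \<open>(\<nu> - \<lambda>)\<^sup>n\<close>, computed with the dominating measure \<open>rho\<close>.
\<close>

definition signed_power_integral ::
  "'a measure \<Rightarrow> 'a measure \<Rightarrow> 'a measure \<Rightarrow> nat \<Rightarrow> ((nat \<Rightarrow> 'a) \<Rightarrow> real) \<Rightarrow> real" where
  "signed_power_integral rho nu lam n g =
     (\<integral>x. g x * tensor_power n (\<lambda>y. rn_density rho nu y - rn_density rho lam y) x
        \<partial>measure_power rho n)"

end

theory Submission
  imports Defs
begin

text \<open>
  All series \<open>\<Sum>n. 1/n! \<integral>\<dots> d\<rho>\<^sup>n\<close> are written as one integral over finite sequences with respect to the
  Lebesgue--Poisson measure, where \<open>v\<^sup>x\<close> denotes the product of \<open>v\<close> over the entries of \<open>x\<close>. Summing a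
  function over all ways to split a sequence into two corresponds to a double integral. By the Mecke
  equation, a Poisson process is, on a set \<open>A\<close> of finite intensity, a Lebesgue--Poisson sequence
  added to the process conditioned to be empty on \<open>A\<close>. On \<open>A\<close> the kernels \<open>T f(x) = E\<^sub>\<rho> D\<^sub>x f\<close> are
  therefore obtained from \<open>f\<close> by an explicit invertible operator, and moving this operator to the other factor
  yields both \<open>\<integral>(T f)\<^sup>2 \<le> E\<^sub>\<rho> f\<^sup>2\<close> and \<open>E\<^sub>\<lambda> f = \<integral>T f(x) (h\<^sub>\<lambda> - 1)\<^sup>x dx\<close> when \<open>\<lambda>\<close> differs from \<open>\<rho>\<close> only
  on \<open>A\<close>. The Bessel inequality allows \<open>A\<close> to exhaust the space. Applied to \<open>D\<^sub>x f\<close> this gives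
  \<open>E\<^sub>\<lambda> D\<^sub>x f = \<integral>T f(x, y) (h\<^sub>\<lambda> - 1)\<^sup>y dy\<close>, and integrating against \<open>(h\<^sub>\<nu> - h\<^sub>\<lambda>)\<^sup>x\<close> produces
  \<open>\<integral>T f(z) (h\<^sub>\<nu> - 1)\<^sup>z dz = E\<^sub>\<nu> f\<close> by the binomial formula; Cauchy--Schwarz and Bessel bound the
  same integral with absolute values.
\<close>

section \<open>Spaces of finite sequences\<close>

text \<open>The hypothesis on \<open>(1 - h)^2\<close> is a norm condition: the product of
  \<open>(h - 1)^2\<close> over the entries of a sequence has Lebesgue-Poisson integral
  \<open>exp (\<integral>(h - 1)^2 d\<rho>)\<close>, so products of \<open>h - 1\<close> can be
  paired with square-integrable kernels. No density of the law for \<lambda> relative to the law for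
  \<rho> is formed. Both sides of the formula for the expectation under \<lambda> are compared as
  functions of an event. If the event prescribes the masses on a finite partition, the left side is
  a finite product of Poisson weights and converges as the set of modification grows; the right side
  is continuous in L2. Complements, disjoint unions and monotone limits then reach every
  square-integrable f. The recurring obstacle is that such an f has integrable shifts only for
  almost every choice of the added points. Identities are therefore proved for truncations and
  carried over by Fatou's lemma. Under \<rho> the number \<open>2^n\<close> of splittings enters the
  integrability bound, which is harmless on sets of finite intensity. Under \<lambda> integrability
  is claimed only where the product of \<open>h\<^sub>\<nu> - h\<^sub>\<lambda>\<close> is
  nonzero.\<close>

definition list_space :: "'a measure \<Rightarrow> 'a list measure" where
  "list_space M = sigma (lists (space M)) (listset ` lists (sets M))"

lemma listset_iff: "xs \<in> listset As \<longleftrightarrow> list_all2 (\<in>) xs As"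
  by (induction As arbitrary: xs) (auto simp: set_Cons_def list_all2_Cons2)

lemma listset_in_lists: "As \<in> lists (sets M) \<Longrightarrow> listset As \<subseteq> lists (space M)"
proof (induction As)
  case (Cons A As)
  then have "A \<subseteq> space M" by (auto dest: sets.sets_into_space)
  moreover have "listset As \<subseteq> lists (space M)" using Cons by simp
  ultimately show ?case
    by (auto simp: set_Cons_def in_lists_conv_set dest!: subsetD[of A] subsetD[of "listset As"])
qed auto

lemma listset_Pow: "listset ` lists (sets M) \<subseteq> Pow (lists (space M))"
  using listset_in_lists by blast

lemma space_list_space: "space (list_space M) = lists (space M)"
  unfolding list_space_def by (rule space_measure_of) (rule listset_Pow)

lemma listset_in_sets: "As \<in> lists (sets M) \<Longrightarrow> listset As \<in> sets (list_space M)"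
  unfolding list_space_def using listset_Pow by (auto intro!: in_measure_of)

lemma measurable_list_spaceI:
  assumes "\<And>w. w \<in> space W \<Longrightarrow> f w \<in> lists (space M)"
    and "\<And>As. As \<in> lists (sets M) \<Longrightarrow> f -` listset As \<inter> space W \<in> sets W"
  shows "f \<in> measurable W (list_space M)"
  unfolding list_space_def
  by (rule measurable_measure_of[OF listset_Pow]) (use assms in auto)

lemma measurable_Cons [measurable (raw)]:
  assumes [measurable]: "f \<in> measurable W M" "g \<in> measurable W (list_space M)"
  shows "(\<lambda>w. f w # g w) \<in> measurable W (list_space M)"
proof (rule measurable_list_spaceI)
  fix w assume "w \<in> space W"
  then show "f w # g w \<in> lists (space M)"
    using measurable_space[OF assms(1)] measurable_space[OF assms(2)] by (auto simp: space_list_space)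
next
  fix As assume As: "As \<in> lists (sets M)"
  show "(\<lambda>w. f w # g w) -` listset As \<inter> space W \<in> sets W"
  proof (cases As)
    case Nil
    then have "(\<lambda>w. f w # g w) -` listset As \<inter> space W = {}" by auto
    then show ?thesis by simp
  next
    case (Cons A Bs)
    then have [measurable]: "A \<in> sets M" "listset Bs \<in> sets (list_space M)"
      using As by (auto intro: listset_in_sets)
    have "(\<lambda>w. f w # g w) -` listset As \<inter> space W
        = {w \<in> space W. f w \<in> A \<and> g w \<in> listset Bs}"
      by (auto simp: Cons set_Cons_def)
    then show ?thesis by simp
  qed
qed

lemma measurable_append [measurable (raw)]:
  assumes [measurable]: "f \<in> measurable W (list_space M)" "g \<in> measurable W (list_space M)"
  shows "(\<lambda>w. f w @ g w) \<in> measurable W (list_space M)"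
proof (rule measurable_list_spaceI)
  fix w assume "w \<in> space W"
  then show "f w @ g w \<in> lists (space M)"
    using measurable_space[OF assms(1)] measurable_space[OF assms(2)] by (auto simp: space_list_space)
next
  fix As assume As: "As \<in> lists (sets M)"
  have [measurable]: "listset (take k As) \<in> sets (list_space M)"
    "listset (drop k As) \<in> sets (list_space M)" for k
    using As by (auto intro!: listset_in_sets dest: in_set_takeD in_set_dropD)
  \<comment> \<open>The length of the first list is not known in advance, so the box is cut at every
    possible position; the preimage becomes a finite union over the cuts.\<close>
  have "xs @ ys \<in> listset As \<longleftrightarrow>
      (\<exists>k\<le>length As. xs \<in> listset (take k As) \<and> ys \<in> listset (drop k As))" for xs ys :: "'b list"
  proof
    assume "xs @ ys \<in> listset As"
    then obtain us vs where "As = us @ vs" "list_all2 (\<in>) xs us" "list_all2 (\<in>) ys vs"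
      by (auto simp: listset_iff list_all2_append1)
    then show "\<exists>k\<le>length As. xs \<in> listset (take k As) \<and> ys \<in> listset (drop k As)"
      by (intro exI[of _ "length us"]) (auto simp: listset_iff)
  next
    assume "\<exists>k\<le>length As. xs \<in> listset (take k As) \<and> ys \<in> listset (drop k As)"
    then show "xs @ ys \<in> listset As"
      unfolding listset_iff by (metis append_take_drop_id list_all2_appendI)
  qed
  then have "(\<lambda>w. f w @ g w) -` listset As \<inter> space W
      = (\<Union>k\<in>{..length As}. {w \<in> space W. f w \<in> listset (take k As) \<and> g w \<in> listset (drop k As)})"
    by auto
  then show "(\<lambda>w. f w @ g w) -` listset As \<inter> space W \<in> sets W" by simp
qed

lemma Nil_in_list_space [simp]: "[] \<in> space (list_space M)"
  by (simp add: space_list_space)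

text \<open>Tuples are read off backwards, so that the recursion on \<open>n\<close> conses the last coordinate.\<close>

primrec tup :: "nat \<Rightarrow> (nat \<Rightarrow> 'a) \<Rightarrow> 'a list" where
  "tup 0 x = []"
| "tup (Suc n) x = x (Suc n) # tup n x"

lemma length_tup [simp]: "length (tup n x) = n"
  by (induction n) auto

lemma tup_upd [simp]: "n < i \<Longrightarrow> tup n (x(i := y)) = tup n x"
  by (induction n) auto

lemma set_tup: "set (tup n x) = x ` {1..n}"
  by (induction n) (auto simp: atLeastAtMostSuc_conv)

lemma measurable_tup:
  "{1..n} \<subseteq> I \<Longrightarrow> tup n \<in> measurable (PiM I (\<lambda>_. M)) (list_space M)"
proof (induction n)
  case 0
  have "tup 0 = (\<lambda>_. [])" by auto
  then show ?case by (simp add: measurable_const)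
next
  case (Suc n)
  have "{1..n} \<subseteq> I" and [simp]: "Suc n \<in> I" using Suc.prems by auto
  then have [measurable]: "tup n \<in> measurable (PiM I (\<lambda>_. M)) (list_space M)"
    using Suc.IH by blast
  show ?case by simp
qed

lemma measurable_tup' [measurable]:
  "tup n \<in> measurable (PiM {1..n} (\<lambda>_. M)) (list_space M)"
  "tup n \<in> measurable (PiM {Suc 0..n} (\<lambda>_. M)) (list_space M)"
  using measurable_tup[of n "{1..n}"] by auto

lemma inj_on_tup: "inj_on (tup n) (extensional {1..n})"
proof (rule inj_onI)
  fix x y :: "nat \<Rightarrow> 'a"
  assume ext: "x \<in> extensional {1..n}" "y \<in> extensional {1..n}" and eq: "tup n x = tup n y"
  have "tup m x = tup m y \<Longrightarrow> i \<in> {1..m} \<Longrightarrow> x i = y i" for m i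
    by (induction m) (auto simp: atLeastAtMostSuc_conv)
  from this[OF eq] show "x = y" using ext by (intro extensionalityI[of x "{1..n}" y]) auto
qed

text \<open>Boxes go to boxes, and injectivity of \<open>tup n\<close> on extensional functions lets
  images commute with complements. Together with measurability of \<open>tup n\<close> this
  identifies the lists of length \<open>n\<close> with the product space as measurable
  spaces.\<close>

lemma tup_image_sets:
  assumes "S \<in> sets (PiM {1..n} (\<lambda>_. M))"
  shows "tup n ` S \<in> sets (list_space M)"
proof -
  let ?U = "\<Pi>\<^sub>E i\<in>{1..n}. space M"
  have inj: "inj_on (tup n) ?U"
    by (rule inj_on_subset[OF inj_on_tup]) (auto simp: PiE_def)
  have box: "tup m ` (\<Pi>\<^sub>E i\<in>{1..m}. A i) = listset (tup m A)" for m and A :: "nat \<Rightarrow> 'a set"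
  proof (induction m)
    case (Suc m)
    have "tup (Suc m) ` (\<Pi>\<^sub>E i\<in>{1..Suc m}. A i) = set_Cons (A (Suc m)) (tup m ` (\<Pi>\<^sub>E i\<in>{1..m}. A i))"
    proof (intro equalityI subsetI)
      fix xs assume "xs \<in> tup (Suc m) ` (\<Pi>\<^sub>E i\<in>{1..Suc m}. A i)"
      then obtain x where x: "x \<in> (\<Pi>\<^sub>E i\<in>{1..Suc m}. A i)" "xs = x (Suc m) # tup m x" by auto
      have "tup m x = tup m (restrict x {1..m})"
      proof -
        have "k \<le> m \<Longrightarrow> tup k x = tup k (restrict x {1..m})" for k
          by (induction k) auto
        then show ?thesis by simp
      qed
      moreover have "restrict x {1..m} \<in> (\<Pi>\<^sub>E i\<in>{1..m}. A i)" "x (Suc m) \<in> A (Suc m)"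
        using x(1) by (auto simp: PiE_iff)
      ultimately show "xs \<in> set_Cons (A (Suc m)) (tup m ` (\<Pi>\<^sub>E i\<in>{1..m}. A i))"
        using x(2) by (auto simp: set_Cons_def)
    next
      fix xs assume "xs \<in> set_Cons (A (Suc m)) (tup m ` (\<Pi>\<^sub>E i\<in>{1..m}. A i))"
      then obtain y x where x: "y \<in> A (Suc m)" "x \<in> (\<Pi>\<^sub>E i\<in>{1..m}. A i)" "xs = y # tup m x"
        by (auto simp: set_Cons_def)
      then show "xs \<in> tup (Suc m) ` (\<Pi>\<^sub>E i\<in>{1..Suc m}. A i)"
        by (intro image_eqI[of _ _ "x(Suc m := y)"]) (auto simp: PiE_iff extensional_def)
    qed
    with Suc show ?case by simp
  qed (auto simp: PiE_def)
  have "S \<in> sigma_sets ?U {(\<Pi>\<^sub>E i\<in>{1..n}. A i) |A. A \<in> ({1..n} \<rightarrow> sets M)}"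
    using assms unfolding sets_PiM by (simp add: prod_algebra_eq_finite)
  then have "S \<subseteq> ?U \<and> tup n ` S \<in> sets (list_space M)"
  proof induction
    case (Basic S)
    then obtain A where A: "S = (\<Pi>\<^sub>E i\<in>{1..n}. A i)" "A \<in> ({1..n} \<rightarrow> sets M)" by auto
    then have "tup n A \<in> lists (sets M)" by (auto simp: set_tup)
    then have "tup n ` S \<in> sets (list_space M)"
      unfolding A(1) box by (rule listset_in_sets)
    moreover have "S \<subseteq> ?U"
      unfolding A(1) by (rule PiE_mono) (use A(2) in \<open>auto dest!: PiE_mem sets.sets_into_space simp: Pi_iff\<close>)
    ultimately show ?case by blast
  next
    case (Compl S)
    have "tup n ` (?U - S) = tup n ` ?U - tup n ` S"
      using inj Compl by (intro inj_on_image_set_diff) auto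
    moreover have "tup n ` ?U \<in> sets (list_space M)"
      unfolding box by (rule listset_in_sets) (auto simp: set_tup)
    ultimately show ?case using Compl by auto
  next
    case (Union S)
    then show ?case by (auto simp: image_UN)
  qed auto
  then show ?thesis by blast
qed

lemma tup_surj:
  assumes "xs \<in> lists A"
  shows "\<exists>x \<in> (\<Pi>\<^sub>E i\<in>{1..length xs}. A). xs = tup (length xs) x"
  using assms
proof (induction xs)
  case (Cons y xs)
  then obtain x where x: "x \<in> (\<Pi>\<^sub>E i\<in>{1..length xs}. A)" "xs = tup (length xs) x" by auto
  have "y # xs = tup (length (y # xs)) (x(Suc (length xs) := y))"
    using x(2) by simp
  moreover have "x(Suc (length xs) := y) \<in> (\<Pi>\<^sub>E i\<in>{1..length (y # xs)}. A)"
    using x(1) Cons by (auto simp: PiE_iff extensional_def)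
  ultimately show ?case by blast
qed auto

text \<open>The list space is a countable union of layers of fixed length, each a copy of a product
  space, so measurability may be tested layer by layer. This turns recursion over lists into
  recursion over the number of coordinates.\<close>

lemma measurable_list_space_tup:
  assumes "\<And>n. (\<lambda>x. F (tup n x)) \<in> measurable (PiM {1..n} (\<lambda>_. M)) N"
  shows "F \<in> measurable (list_space M) N"
proof (rule measurableI)
  fix xs assume "xs \<in> space (list_space M)"
  then have "xs \<in> lists (space M)" by (simp add: space_list_space)
  from tup_surj[OF this] obtain x where x: "x \<in> (\<Pi>\<^sub>E i\<in>{1..length xs}. space M)" "xs = tup (length xs) x" ..
  then show "F xs \<in> space N"
    using measurable_space[OF assms, of x "length xs"] by (simp add: space_PiM)
next
  fix S assume S: "S \<in> sets N"
  have "F -` S \<inter> space (list_space M)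
      = (\<Union>n. tup n ` ((\<lambda>x. F (tup n x)) -` S \<inter> space (PiM {1..n} (\<lambda>_. M))))"
  proof (intro equalityI subsetI)
    fix xs assume xs: "xs \<in> F -` S \<inter> space (list_space M)"
    then have "xs \<in> lists (space M)" by (simp add: space_list_space)
    from tup_surj[OF this] obtain x where "x \<in> (\<Pi>\<^sub>E i\<in>{1..length xs}. space M)" "xs = tup (length xs) x" ..
    with xs show "xs \<in> (\<Union>n. tup n ` ((\<lambda>x. F (tup n x)) -` S \<inter> space (PiM {1..n} (\<lambda>_. M))))"
      by (auto simp: space_PiM intro!: exI[of _ "length xs"])
  qed (use measurable_space[OF measurable_tup'(1)] in auto)
  also have "\<dots> \<in> sets (list_space M)"
    using measurable_sets[OF assms S] by (auto intro!: tup_image_sets)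
  finally show "F -` S \<inter> space (list_space M) \<in> sets (list_space M)" .
qed

lemma measurable_length [measurable]: "length \<in> measurable (list_space M) (count_space UNIV)"
  by (rule measurable_list_space_tup) simp

section \<open>Products and sums over the entries of a list\<close>

abbreviation pl :: "('a \<Rightarrow> 'b::monoid_mult) \<Rightarrow> 'a list \<Rightarrow> 'b" where
  "pl v xs \<equiv> prod_list (map v xs)"

lemma pl_measurable_ennreal [measurable]:
  fixes v :: "'a \<Rightarrow> ennreal"
  assumes [measurable]: "v \<in> borel_measurable M"
  shows "pl v \<in> borel_measurable (list_space M)"
proof (rule measurable_list_space_tup)
  fix n :: nat
  have "m \<le> n \<Longrightarrow> (\<lambda>x. pl v (tup m x)) \<in> borel_measurable (PiM {1..n} (\<lambda>_. M))" for m
    by (induction m) auto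
  then show "(\<lambda>x. pl v (tup n x)) \<in> borel_measurable (PiM {1..n} (\<lambda>_. M))" by simp
qed

lemma pl_measurable_real [measurable]:
  fixes v :: "'a \<Rightarrow> real"
  assumes [measurable]: "v \<in> borel_measurable M"
  shows "pl v \<in> borel_measurable (list_space M)"
proof (rule measurable_list_space_tup)
  fix n :: nat
  have "m \<le> n \<Longrightarrow> (\<lambda>x. pl v (tup m x)) \<in> borel_measurable (PiM {1..n} (\<lambda>_. M))" for m
    by (induction m) auto
  then show "(\<lambda>x. pl v (tup n x)) \<in> borel_measurable (PiM {1..n} (\<lambda>_. M))" by simp
qed

lemma sum_list_measurable [measurable]:
  fixes v :: "'a \<Rightarrow> ennreal"
  assumes [measurable]: "v \<in> borel_measurable M"
  shows "(\<lambda>xs. sum_list (map v xs)) \<in> borel_measurable (list_space M)"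
proof (rule measurable_list_space_tup)
  fix n :: nat
  have "m \<le> n \<Longrightarrow> (\<lambda>x. sum_list (map v (tup m x))) \<in> borel_measurable (PiM {1..n} (\<lambda>_. M))" for m
    by (induction m) auto
  then show "(\<lambda>x. sum_list (map v (tup n x))) \<in> borel_measurable (PiM {1..n} (\<lambda>_. M))" by simp
qed

lemma pl_tup: "pl v (tup n x) = (\<Prod>i\<in>{1..n}. v (x i))"
  for v :: "'a \<Rightarrow> 'b::comm_monoid_mult"
  by (induction n) (simp_all add: mult.commute)

lemma abs_pl: "\<bar>pl u xs\<bar> = pl (\<lambda>x. \<bar>u x\<bar>) xs" for u :: "'a \<Rightarrow> real"
  by (induction xs) (auto simp: abs_mult)

lemma ennreal_pl: "(\<And>x. 0 \<le> v x) \<Longrightarrow> ennreal (pl v xs) = pl (\<lambda>x. ennreal (v x)) xs"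
  by (induction xs) (auto simp: ennreal_mult')

lemma pl_nonneg: "(\<And>x. 0 \<le> v x) \<Longrightarrow> 0 \<le> pl v xs" for v :: "'a \<Rightarrow> real"
  by (induction xs) auto

lemma pl_indicator: "pl (indicator A) xs = (indicator (lists A) xs :: 'b::comm_semiring_1)"
  by (induction xs) (auto simp: indicator_def)

lemma pl_square: "(pl v x)\<^sup>2 = pl (\<lambda>y. (v y)\<^sup>2) x" for v :: "'a \<Rightarrow> real"
  by (induction x) (auto simp: power_mult_distrib)

text \<open>A list has finitely many entries, so one \<open>A i\<close> of an increasing sequence
  contains them all. Lists over sets of finite measure therefore exhaust the list space.\<close>

lemma lists_incseq_UN:
  fixes A :: "nat \<Rightarrow> 'a set"
  assumes "incseq A"
  shows "(\<Union>i. lists (A i)) = lists (\<Union>i. A i)"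
proof (intro equalityI subsetI)
  fix xs assume "xs \<in> lists (\<Union>i. A i)"
  then have "\<exists>i. xs \<in> lists (A i)"
  proof (induction xs)
    case (Cons x xs)
    then obtain i where i: "xs \<in> lists (A i)" by auto
    obtain j where j: "x \<in> A j" using Cons by blast
    have "A i \<subseteq> A (max i j)" "A j \<subseteq> A (max i j)" using assms by (auto simp: incseq_def)
    then have "x # xs \<in> lists (A (max i j))" using i j by auto
    then show ?case by blast
  qed auto
  then show "xs \<in> (\<Union>i. lists (A i))" by auto
qed auto

section \<open>Splittings of a finite sequence\<close>

text \<open>The list form of all decompositions of an index set into a subset and its complement:
  equal entries count as different positions, and both components keep the order of the
  list.\<close>

primrec splits :: "'a list \<Rightarrow> ('a list \<times> 'a list) list" where
  "splits [] = [([], [])]"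
| "splits (x # xs) = map (\<lambda>(a, b). (x # a, b)) (splits xs) @ map (\<lambda>(a, b). (a, x # b)) (splits xs)"

abbreviation sum_splits :: "('a list \<Rightarrow> 'a list \<Rightarrow> 'b::comm_monoid_add) \<Rightarrow> 'a list \<Rightarrow> 'b" where
  "sum_splits H xs \<equiv> (\<Sum>(a, b)\<leftarrow>splits xs. H a b)"

lemma sum_splits_Cons [simp]:
  "sum_splits H (x # xs) = sum_splits (\<lambda>a. H (x # a)) xs + sum_splits (\<lambda>a b. H a (x # b)) xs"
  by (simp add: comp_def split_def)

declare splits.simps(2) [simp del]

lemma sum_splits_cong:
  "(\<And>a b. (a, b) \<in> set (splits xs) \<Longrightarrow> H a b = K a b) \<Longrightarrow> sum_splits H xs = sum_splits K xs"
  by (intro arg_cong[of _ _ sum_list] map_cong refl) auto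

lemma mset_splits: "(a, b) \<in> set (splits xs) \<Longrightarrow> mset a + mset b = mset xs"
  by (induction xs arbitrary: a b) (auto simp: splits.simps)

lemma length_splits: "(a, b) \<in> set (splits xs) \<Longrightarrow> length a + length b = length xs"
  by (metis mset_splits size_mset size_union)

lemma splits_in_lists:
  "(a, b) \<in> set (splits xs) \<Longrightarrow> xs \<in> lists A \<Longrightarrow> a \<in> lists A \<and> b \<in> lists A"
  by (metis (no_types, lifting) Un_iff in_lists_conv_set mset_splits set_mset_mset set_mset_union)

lemma sum_splits_append:
  "sum_splits H (xs @ ys) = sum_splits (\<lambda>a b. sum_splits (\<lambda>a' b'. H (a @ a') (b @ b')) ys) xs"
  for H :: "'a list \<Rightarrow> 'a list \<Rightarrow> 'b::comm_monoid_add"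
  by (induction xs arbitrary: H) simp_all

lemma sum_splits_add:
  "sum_splits (\<lambda>a b. H a b + K a b) xs = sum_splits H xs + sum_splits K xs"
  for H :: "'a list \<Rightarrow> 'a list \<Rightarrow> 'b::comm_monoid_add"
  by (induction xs arbitrary: H K) (simp_all add: ac_simps)

lemma sum_splits_mult:
  "sum_splits (\<lambda>a b. c * H a b) xs = c * sum_splits H xs"
  for H :: "'a list \<Rightarrow> 'a list \<Rightarrow> 'b::semiring_0"
  by (induction xs arbitrary: H) (simp_all add: algebra_simps)

lemma sum_splits_minus:
  "sum_splits (\<lambda>a b. - H a b) xs = - sum_splits H xs"
  for H :: "'a list \<Rightarrow> 'a list \<Rightarrow> 'b::ab_group_add"
  by (induction xs arbitrary: H) (simp_all add: algebra_simps)

lemma sum_splits_mono: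
  fixes H :: "'a list \<Rightarrow> 'a list \<Rightarrow> 'b::ordered_comm_monoid_add"
  assumes "\<And>a b. (a, b) \<in> set (splits xs) \<Longrightarrow> H a b \<le> K a b"
  shows "sum_splits H xs \<le> sum_splits K xs"
  by (rule sum_list_mono) (use assms in auto)

lemma abs_sum_splits_le: "\<bar>sum_splits H xs\<bar> \<le> sum_splits (\<lambda>a b. \<bar>H a b\<bar>) xs"
  for H :: "'a list \<Rightarrow> 'a list \<Rightarrow> real"
proof (induction xs arbitrary: H)
  case (Cons x xs)
  show ?case
    using Cons[of "\<lambda>a. H (x # a)"] Cons[of "\<lambda>a b. H a (x # b)"] by simp
qed simp

text \<open>The binomial formula: expanding the product of the \<open>v x + w x\<close> means
  choosing one of the two summands at every position.\<close>

lemma sum_splits_pl: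
  fixes v w :: "'a \<Rightarrow> 'b::comm_semiring_1"
  shows "sum_splits (\<lambda>a b. pl v a * pl w b) xs = pl (\<lambda>x. v x + w x) xs"
proof (induction xs)
  case (Cons x xs)
  have "sum_splits (\<lambda>a b. pl v a * pl w b) (x # xs)
      = sum_splits (\<lambda>a b. v x * (pl v a * pl w b)) xs + sum_splits (\<lambda>a b. w x * (pl v a * pl w b)) xs"
    by (simp add: ac_simps)
  also have "\<dots> = (v x + w x) * sum_splits (\<lambda>a b. pl v a * pl w b) xs"
    unfolding sum_splits_mult by (simp add: algebra_simps)
  finally show ?case using Cons by simp
qed simp

lemma pl_const: "pl (\<lambda>_. c) xs = c ^ length xs"
  by (induction xs) auto

lemma pl_append: "pl v (xs @ ys) = pl v xs * pl v ys"
  by simp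

text \<open>The binomial formula with \<open>-1\<close> and \<open>1\<close> produces a product of
  zeros, which equals 1 only when it is empty.\<close>

lemma sum_splits_alternating:
  "sum_splits (\<lambda>a b. (-1) ^ length a) xs = (if xs = [] then 1 else 0 :: real)"
  using sum_splits_pl[of "\<lambda>_. -1 :: real" "\<lambda>_. 1" xs] by (cases xs) (auto simp: pl_const)

lemma measurable_sum_splits:
  fixes H :: "'a list \<Rightarrow> 'a list \<Rightarrow> 'b::{second_countable_topology, topological_comm_monoid_add}"
  assumes H: "case_prod H \<in> borel_measurable (list_space M \<Otimes>\<^sub>M list_space M)"
  shows "sum_splits H \<in> borel_measurable (list_space M)"
proof (rule measurable_list_space_tup)
  fix n :: nat
  let ?P = "PiM {1..n} (\<lambda>_. M)"
  \<comment> \<open>Unfolding one coordinate puts that coordinate into the summand, which then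
    depends on the point. The prefixes \<open>A\<close> and \<open>B\<close> record the coordinates
    already distributed, so that \<open>H\<close> stays fixed during the induction.\<close>
  have "(\<lambda>x. sum_splits (\<lambda>a b. H (A x @ a) (B x @ b)) (tup m x)) \<in> borel_measurable ?P"
    if "m \<le> n" "A \<in> measurable ?P (list_space M)" "B \<in> measurable ?P (list_space M)" for m A B
    using that
  proof (induction m arbitrary: A B)
    case 0
    have [measurable]: "A \<in> measurable ?P (list_space M)" "B \<in> measurable ?P (list_space M)"
      using 0 by auto
    have "(\<lambda>x. case_prod H (A x, B x)) \<in> borel_measurable ?P"
      by (rule measurable_compose[OF _ H]) measurable
    then show ?case by simp
  next
    case (Suc m)
    note [measurable] = Suc.prems(2,3)
    have [measurable]: "(\<lambda>x. x (Suc m)) \<in> measurable ?P M" using Suc.prems by simp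
    have "(\<lambda>x. sum_splits (\<lambda>a b. H ((A x @ [x (Suc m)]) @ a) (B x @ b)) (tup m x)) \<in> borel_measurable ?P"
      by (rule Suc.IH) (use Suc.prems in auto)
    moreover have "(\<lambda>x. sum_splits (\<lambda>a b. H (A x @ a) ((B x @ [x (Suc m)]) @ b)) (tup m x)) \<in> borel_measurable ?P"
      by (rule Suc.IH) (use Suc.prems in auto)
    ultimately show ?case by simp
  qed
  note * = this
  have "(\<lambda>x. sum_splits (\<lambda>a b. H ([] @ a) ([] @ b)) (tup n x)) \<in> borel_measurable ?P"
    by (rule *) (simp_all add: measurable_const)
  then show "(\<lambda>x. sum_splits H (tup n x)) \<in> borel_measurable ?P"
    by (simp only: append_Nil)
qed

section \<open>The Lebesgue--Poisson measure\<close>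

lemma suminf_swap_ennreal: "(\<Sum>i. \<Sum>n. f i n) = (\<Sum>n. \<Sum>i. f i n)" for f :: "nat \<Rightarrow> nat \<Rightarrow> ennreal"
  using nn_integral_suminf[of "\<lambda>n i. f i n" "count_space UNIV"]
  by (simp add: nn_integral_count_space_nat)

definition list_power :: "'a measure \<Rightarrow> nat \<Rightarrow> 'a list measure" where
  "list_power M n = distr (PiM {1..n} (\<lambda>_. M)) (list_space M) (tup n)"

text \<open>The Lebesgue-Poisson measure. For finite \<open>M\<close> its mass is the exponential of
  the mass of \<open>M\<close>, and after normalisation it is the law of the points of a Poisson
  process listed in random order.\<close>

definition LP :: "'a measure \<Rightarrow> 'a list measure" where
  "LP M = measure_of (space (list_space M)) (sets (list_space M))
     (\<lambda>S. \<Sum>n. ennreal (1 / fact n) * emeasure (list_power M n) S)"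

lemma sets_list_power [simp, measurable_cong]: "sets (list_power M n) = sets (list_space M)"
  by (simp add: list_power_def)

lemma sets_LP [simp, measurable_cong]: "sets (LP M) = sets (list_space M)"
  by (simp add: LP_def)

lemma space_LP: "space (LP M) = lists (space M)"
  using sets_eq_imp_space_eq[OF sets_LP, of M] by (simp add: space_list_space)

lemma emeasure_LP:
  assumes "S \<in> sets (list_space M)"
  shows "emeasure (LP M) S = (\<Sum>n. ennreal (1 / fact n) * emeasure (list_power M n) S)"
  unfolding LP_def
proof (rule emeasure_measure_of_sigma)
  show "sigma_algebra (space (list_space M)) (sets (list_space M))" ..
  let ?m = "\<lambda>S. \<Sum>n. ennreal (1 / fact n) * emeasure (list_power M n) S"
  show "positive (sets (list_space M)) ?m" by (simp add: positive_def)
  show "countably_additive (sets (list_space M)) ?m"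
  proof (rule countably_additiveI)
    fix A :: "nat \<Rightarrow> 'a list set"
    assume A: "range A \<subseteq> sets (list_space M)" "disjoint_family A"
    have "(\<Sum>i. ?m (A i)) = (\<Sum>n. \<Sum>i. ennreal (1 / fact n) * emeasure (list_power M n) (A i))"
      by (rule suminf_swap_ennreal)
    also have "\<dots> = ?m (\<Union>i. A i)"
      using A by (intro suminf_cong) (simp add: suminf_emeasure)
    finally show "(\<Sum>i. ?m (A i)) = ?m (\<Union>i. A i)" .
  qed
qed fact

lemma suminf_triangle_ennreal:
  "(\<Sum>n. \<Sum>k\<le>n. g k (n - k)) = (\<Sum>k. \<Sum>m. g k m)" for g :: "nat \<Rightarrow> nat \<Rightarrow> ennreal"
proof -
  have "(\<Sum>n. \<Sum>k\<le>n. g k (n - k)) = (\<Sum>n. \<Sum>k. if k \<le> n then g k (n - k) else 0)"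
  proof (rule suminf_cong)
    fix n
    show "(\<Sum>k\<le>n. g k (n - k)) = (\<Sum>k. if k \<le> n then g k (n - k) else 0)"
      by (subst suminf_finite[of "{..n}"]) auto
  qed
  also have "\<dots> = (\<Sum>k. \<Sum>n. if k \<le> n then g k (n - k) else 0)"
    by (rule suminf_swap_ennreal)
  also have "\<dots> = (\<Sum>k. \<Sum>m. g k m)"
  proof (rule suminf_cong)
    fix k
    have "(\<Sum>n. if k \<le> n then g k (n - k) else 0)
        = (\<Sum>n. if k \<le> n + k then g k (n + k - k) else 0) + (\<Sum>n<k. if k \<le> n then g k (n - k) else 0)"
      by (rule suminf_offset) simp
    then show "(\<Sum>n. if k \<le> n then g k (n - k) else 0) = (\<Sum>m. g k m)" by simp
  qed
  finally show ?thesis .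
qed

lemma nn_integral_LP:
  assumes F [measurable]: "F \<in> borel_measurable (list_space M)"
  shows "(\<integral>\<^sup>+xs. F xs \<partial>LP M) = (\<Sum>n. ennreal (1 / fact n) * (\<integral>\<^sup>+xs. F xs \<partial>list_power M n))"
  using F
proof (induction rule: borel_measurable_induct)
  case (cong f g)
  have eq: "space (LP M) = space (list_space M)" "space (list_power M n) = space (list_space M)" for n
    by (rule sets_eq_imp_space_eq, simp)+
  have "(\<integral>\<^sup>+xs. f xs \<partial>LP M) = (\<integral>\<^sup>+xs. g xs \<partial>LP M)"
    "(\<integral>\<^sup>+xs. f xs \<partial>list_power M n) = (\<integral>\<^sup>+xs. g xs \<partial>list_power M n)" for n
    using cong(3) by (auto intro!: nn_integral_cong simp: eq)
  with cong show ?case by simp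
next
  case (set A)
  then show ?case by (simp add: emeasure_LP)
next
  case (mult u c)
  then show ?case
    by (simp add: nn_integral_cmult mult.left_commute[of _ c] ennreal_suminf_cmult)
next
  case (add u v)
  then show ?case
    by (simp add: nn_integral_add distrib_left suminf_add[symmetric])
next
  case (seq U)
  have inc: "incseq U" by fact
  have [measurable]: "U i \<in> borel_measurable (list_space M)" for i by fact
  have "(\<integral>\<^sup>+xs. (SUP i. U i) xs \<partial>LP M) = (SUP i. \<integral>\<^sup>+xs. U i xs \<partial>LP M)"
    unfolding SUP_apply by (rule nn_integral_monotone_convergence_SUP[OF inc]) measurable
  also have "\<dots> = (SUP i. \<Sum>n. ennreal (1 / fact n) * (\<integral>\<^sup>+xs. U i xs \<partial>list_power M n))"
    using seq by simp
  also have "\<dots> = (\<Sum>n. SUP i. ennreal (1 / fact n) * (\<integral>\<^sup>+xs. U i xs \<partial>list_power M n))"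
  proof (rule ennreal_suminf_SUP_eq[symmetric])
    show "incseq (\<lambda>i. ennreal (1 / fact n) * (\<integral>\<^sup>+xs. U i xs \<partial>list_power M n))" for n
      using inc by (auto simp: incseq_def le_fun_def intro!: mult_left_mono nn_integral_mono)
  qed
  also have "\<dots> = (\<Sum>n. ennreal (1 / fact n) * (\<integral>\<^sup>+xs. (SUP i. U i) xs \<partial>list_power M n))"
    unfolding SUP_apply
    by (intro suminf_cong, subst nn_integral_monotone_convergence_SUP[OF inc])
       (simp_all add: SUP_mult_left_ennreal)
  finally show ?case .
qed

lemma measurable_case_prod_compose:
  assumes H: "case_prod H \<in> borel_measurable (M \<Otimes>\<^sub>M N)"
    and "f \<in> measurable W M" "g \<in> measurable W N"
  shows "(\<lambda>w. H (f w) (g w)) \<in> borel_measurable W"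
proof -
  have "(\<lambda>w. case_prod H (f w, g w)) \<in> borel_measurable W"
    by (rule measurable_compose[OF _ H]) (use assms in measurable)
  then show ?thesis by simp
qed

section \<open>Integration over lists: products, densities and the splitting identity\<close>

context sigma_finite_measure
begin

lemma product_sf: "product_sigma_finite (\<lambda>_ :: nat. M)"
  by standard (rule sigma_finite_countable)

lemma nn_integral_list_power_0:
  assumes [measurable]: "F \<in> borel_measurable (list_space M)"
  shows "(\<integral>\<^sup>+xs. F xs \<partial>list_power M 0) = F []"
  by (simp add: list_power_def nn_integral_distr PiM_empty nn_integral_count_space_finite)

lemma nn_integral_list_power_Suc:
  assumes [measurable]: "F \<in> borel_measurable (list_space M)"
  shows "(\<integral>\<^sup>+xs. F xs \<partial>list_power M (Suc n)) = (\<integral>\<^sup>+x. \<integral>\<^sup>+xs. F (x # xs) \<partial>list_power M n \<partial>M)"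
proof -
  interpret product_sigma_finite "\<lambda>_ :: nat. M" by (rule product_sf)
  have ins: "{1..Suc n} = insert (Suc n) {1..n}" by auto
  have [measurable]: "tup (Suc n) \<in> measurable (PiM (insert (Suc n) {1..n}) (\<lambda>_. M)) (list_space M)"
    by (rule measurable_tup) auto
  have "(\<integral>\<^sup>+xs. F xs \<partial>list_power M (Suc n)) = (\<integral>\<^sup>+x. F (tup (Suc n) x) \<partial>PiM {1..Suc n} (\<lambda>_. M))"
    unfolding list_power_def by (rule nn_integral_distr) measurable
  also have "\<dots> = (\<integral>\<^sup>+y. \<integral>\<^sup>+x. F (tup (Suc n) (x(Suc n := y))) \<partial>PiM {1..n} (\<lambda>_. M) \<partial>M)"
    unfolding ins by (rule product_nn_integral_insert_rev) (simp, simp, measurable)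
  also have "\<dots> = (\<integral>\<^sup>+y. \<integral>\<^sup>+xs. F (y # xs) \<partial>list_power M n \<partial>M)"
    unfolding list_power_def by (intro nn_integral_cong) (simp add: nn_integral_distr)
  finally show ?thesis .
qed

lemma nn_integral_list_power_pl:
  fixes v :: "'a \<Rightarrow> ennreal"
  assumes [measurable]: "v \<in> borel_measurable M"
  shows "(\<integral>\<^sup>+xs. pl v xs \<partial>list_power M n) = (\<integral>\<^sup>+x. v x \<partial>M) ^ n"
  by (induction n)
     (simp_all add: nn_integral_list_power_0 nn_integral_list_power_Suc nn_integral_cmult nn_integral_multc)

lemma suminf_exp_ennreal:
  assumes "0 \<le> c" shows "(\<Sum>n. ennreal (1 / fact n) * ennreal c ^ n) = ennreal (exp c)"
proof -
  have "(\<lambda>n. ennreal (1 / fact n * c ^ n)) sums ennreal (exp c)"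
    using exp_converges[of c] assms by (subst sums_ennreal) (auto simp: field_simps)
  then have "(\<Sum>n. ennreal (1 / fact n * c ^ n)) = ennreal (exp c)" by (rule sums_unique[symmetric])
  moreover have "ennreal (1 / fact n * c ^ n) = ennreal (1 / fact n) * ennreal c ^ n" for n
    using assms by (simp add: ennreal_mult'[symmetric] ennreal_power)
  ultimately show ?thesis by simp
qed

lemma nn_integral_LP_pl:
  fixes v :: "'a \<Rightarrow> ennreal"
  assumes [measurable]: "v \<in> borel_measurable M" and "(\<integral>\<^sup>+x. v x \<partial>M) = ennreal c" "0 \<le> c"
  shows "(\<integral>\<^sup>+xs. pl v xs \<partial>LP M) = ennreal (exp c)"
  using assms by (simp add: nn_integral_LP nn_integral_list_power_pl suminf_exp_ennreal)

lemma lists_in_sets: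
  assumes [measurable]: "A \<in> sets M"
  shows "lists A \<in> sets (list_space M)"
proof -
  have "pl (indicator A :: 'a \<Rightarrow> real) xs = (if xs \<in> lists A then 1 else 0)" for xs
    by (induction xs) auto
  then have "lists A = {xs \<in> space (list_space M). pl (indicator A :: 'a \<Rightarrow> real) xs = 1}"
    using sets.sets_into_space[OF assms] by (auto simp: space_list_space split: if_splits)
  also have "\<dots> \<in> sets (list_space M)" by measurable
  finally show ?thesis .
qed

lemma list_sigma_finite_aux:
  assumes sets: "sets N = sets (list_space M)"
    and fin: "\<And>A. A \<in> sets M \<Longrightarrow> emeasure M A < \<infinity> \<Longrightarrow> emeasure N (lists A) < \<infinity>"
  shows "sigma_finite_measure N"
proof -
  obtain A :: "nat \<Rightarrow> 'a set" where A: "range A \<subseteq> sets M" "(\<Union>i. A i) = space M"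
    "\<And>i. emeasure M (A i) \<noteq> \<infinity>" "incseq A"
    using sigma_finite_incseq by blast
  have "space N = (\<Union>i. lists (A i))"
    unfolding lists_incseq_UN[OF A(4)] A(2) sets_eq_imp_space_eq[OF sets] space_list_space ..
  moreover have "range (\<lambda>i. lists (A i)) \<subseteq> sets N"
    using A(1) by (auto simp: sets intro!: lists_in_sets)
  ultimately show ?thesis
    using fin A(1,3) by (intro sigma_finite_measure.intro exI[of _ "range (\<lambda>i. lists (A i))"])
      (auto simp: less_top)
qed

lemma emeasure_list_power_lists:
  "A \<in> sets M \<Longrightarrow> emeasure (list_power M n) (lists A) = emeasure M A ^ n"
  using nn_integral_list_power_pl[of "indicator A" n]
  by (simp add: pl_indicator lists_in_sets)

lemma emeasure_LP_lists:
  "A \<in> sets M \<Longrightarrow> emeasure M A < \<infinity> \<Longrightarrow> emeasure (LP M) (lists A) = ennreal (exp (measure M A))"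
  using nn_integral_LP_pl[of "indicator A" "measure M A"]
  by (simp add: pl_indicator lists_in_sets emeasure_eq_ennreal_measure less_top)

lemma sigma_finite_list_power: "sigma_finite_measure (list_power M n)"
  by (rule list_sigma_finite_aux) (auto simp: emeasure_list_power_lists power_less_top_ennreal)

lemma sigma_finite_LP: "sigma_finite_measure (LP M)"
  by (rule list_sigma_finite_aux) (auto simp: emeasure_LP_lists)

lemma pair_sigma_finite_LP: "pair_sigma_finite (LP M) (LP M)"
  by (simp add: pair_sigma_finite_def sigma_finite_LP)

text \<open>Under a product measure only the number \<open>k\<close> of entries sent to the left
  matters, and \<open>n choose k\<close> splittings send \<open>k\<close> entries there. The
  induction is Pascal's rule: the first entry joins either the left or the right component.\<close>

lemma nn_integral_list_power_sum_splits:
  fixes H :: "'a list \<Rightarrow> 'a list \<Rightarrow> ennreal"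
  assumes "case_prod H \<in> borel_measurable (list_space M \<Otimes>\<^sub>M list_space M)"
  shows "(\<integral>\<^sup>+z. sum_splits H z \<partial>list_power M n)
    = (\<Sum>k\<le>n. of_nat (n choose k) * (\<integral>\<^sup>+a. \<integral>\<^sup>+b. H a b \<partial>list_power M (n - k) \<partial>list_power M k))"
  using assms
proof (induction n arbitrary: H)
  case 0
  note Hc [measurable (raw)] = measurable_case_prod_compose[OF 0]
  interpret P: sigma_finite_measure "list_power M 0" by (rule sigma_finite_list_power)
  have sp: "space (list_power M 0) = space (list_space M)" by (rule sets_eq_imp_space_eq) simp
  have "(\<integral>\<^sup>+a. \<integral>\<^sup>+b. H a b \<partial>list_power M 0 \<partial>list_power M 0) = (\<integral>\<^sup>+a. H a [] \<partial>list_power M 0)"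
    by (intro nn_integral_cong nn_integral_list_power_0) (simp add: sp)
  also have "\<dots> = H [] []"
    by (rule nn_integral_list_power_0) measurable
  finally show ?case
    using nn_integral_list_power_0[OF measurable_sum_splits[OF 0]] by simp
next
  case (Suc n)
  note H [measurable] = Suc.prems
  note [measurable] = measurable_sum_splits[OF H]
  note Hc [measurable (raw)] = measurable_case_prod_compose[OF H]
  interpret P: sigma_finite_measure "list_power M k" for k by (rule sigma_finite_list_power)
  interpret PS: pair_sigma_finite M "list_power M k" for k
    by (simp add: pair_sigma_finite_def sigma_finite_list_power sigma_finite_measure_axioms)
  define J where "J k m = (\<integral>\<^sup>+a. \<integral>\<^sup>+b. H a b \<partial>list_power M m \<partial>list_power M k)" for k m
  have ms: "(\<lambda>(a, b). H (x # a) b) \<in> borel_measurable (list_space M \<Otimes>\<^sub>M list_space M)"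
      "(\<lambda>(a, b). H a (x # b)) \<in> borel_measurable (list_space M \<Otimes>\<^sub>M list_space M)" if "x \<in> space M" for x
  proof -
    have [measurable]: "(\<lambda>_. x) \<in> measurable N M" for N :: "('a list \<times> 'a list) measure"
      using that by simp
    have "(\<lambda>p. case_prod H (x # fst p, snd p)) \<in> borel_measurable (list_space M \<Otimes>\<^sub>M list_space M)"
      "(\<lambda>p. case_prod H (fst p, x # snd p)) \<in> borel_measurable (list_space M \<Otimes>\<^sub>M list_space M)"
      by (rule measurable_compose[OF _ H], measurable)+
    then show "(\<lambda>(a, b). H (x # a) b) \<in> borel_measurable (list_space M \<Otimes>\<^sub>M list_space M)"
      "(\<lambda>(a, b). H a (x # b)) \<in> borel_measurable (list_space M \<Otimes>\<^sub>M list_space M)"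
      by (simp_all add: split_def)
  qed
  have "(\<integral>\<^sup>+z. sum_splits H z \<partial>list_power M (Suc n))
      = (\<integral>\<^sup>+x. \<integral>\<^sup>+z. sum_splits (\<lambda>a. H (x # a)) z + sum_splits (\<lambda>a b. H a (x # b)) z \<partial>list_power M n \<partial>M)"
    by (subst nn_integral_list_power_Suc) simp_all
  also have "\<dots> = (\<integral>\<^sup>+x. (\<integral>\<^sup>+z. sum_splits (\<lambda>a. H (x # a)) z \<partial>list_power M n)
      + (\<integral>\<^sup>+z. sum_splits (\<lambda>a b. H a (x # b)) z \<partial>list_power M n) \<partial>M)"
    by (intro nn_integral_cong nn_integral_add)
       (simp_all add: measurable_sum_splits[OF ms(1)] measurable_sum_splits[OF ms(2)]
          measurable_cong_sets[OF sets_list_power refl])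
  also have "\<dots> = (\<integral>\<^sup>+x. (\<Sum>k\<le>n. of_nat (n choose k) *
        (\<integral>\<^sup>+a. \<integral>\<^sup>+b. H (x # a) b \<partial>list_power M (n - k) \<partial>list_power M k))
      + (\<Sum>k\<le>n. of_nat (n choose k) *
        (\<integral>\<^sup>+a. \<integral>\<^sup>+b. H a (x # b) \<partial>list_power M (n - k) \<partial>list_power M k)) \<partial>M)"
    by (intro nn_integral_cong) (simp add: Suc.IH[OF ms(1)] Suc.IH[OF ms(2)])
  also have "\<dots> = (\<Sum>k\<le>n. of_nat (n choose k) *
        (\<integral>\<^sup>+x. \<integral>\<^sup>+a. \<integral>\<^sup>+b. H (x # a) b \<partial>list_power M (n - k) \<partial>list_power M k \<partial>M))
      + (\<Sum>k\<le>n. of_nat (n choose k) *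
        (\<integral>\<^sup>+x. \<integral>\<^sup>+a. \<integral>\<^sup>+b. H a (x # b) \<partial>list_power M (n - k) \<partial>list_power M k \<partial>M))"
    by (simp add: nn_integral_add nn_integral_sum nn_integral_cmult)
  also have "\<dots> = (\<Sum>k\<le>n. of_nat (n choose k) * J (Suc k) (n - k))
      + (\<Sum>k\<le>n. of_nat (n choose k) * J k (Suc (n - k)))"
  proof -
    have 1: "(\<integral>\<^sup>+x. \<integral>\<^sup>+a. \<integral>\<^sup>+b. H (x # a) b \<partial>list_power M m \<partial>list_power M k \<partial>M) = J (Suc k) m" for k m
      unfolding J_def by (subst nn_integral_list_power_Suc) simp_all
    have 2: "(\<integral>\<^sup>+x. \<integral>\<^sup>+a. \<integral>\<^sup>+b. H a (x # b) \<partial>list_power M m \<partial>list_power M k \<partial>M) = J k (Suc m)" for k m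
    proof -
      \<comment> \<open>Here the first entry joins the right component, but the integral over the
        left one stands in between; Tonelli's theorem moves the new variable inwards.\<close>
      have "(\<integral>\<^sup>+x. \<integral>\<^sup>+a. \<integral>\<^sup>+b. H a (x # b) \<partial>list_power M m \<partial>list_power M k \<partial>M)
          = (\<integral>\<^sup>+a. \<integral>\<^sup>+x. \<integral>\<^sup>+b. H a (x # b) \<partial>list_power M m \<partial>M \<partial>list_power M k)"
        by (rule PS.Fubini'[symmetric]) measurable
      also have "\<dots> = J k (Suc m)"
        unfolding J_def
        by (intro nn_integral_cong nn_integral_list_power_Suc[symmetric])
           (auto simp: sets_eq_imp_space_eq[OF sets_list_power])
      finally show ?thesis .
    qed
    show ?thesis unfolding 1 2 ..
  qed
  \<comment> \<open>Both sums are extended to \<open>Suc n\<close> so that Pascal's rule can be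
    applied termwise. The added term at \<open>k = 0\<close> here has coefficient 0 by the case
    distinction, and the added term of the other sum vanishes because \<open>n choose Suc n\<close>
    is 0.\<close>
  also have "(\<Sum>k\<le>n. of_nat (n choose k) * J (Suc k) (n - k))
      = (\<Sum>k\<le>Suc n. of_nat (case k of 0 \<Rightarrow> 0 | Suc j \<Rightarrow> n choose j) * J k (Suc n - k))"
    by (subst sum.atMost_Suc_shift) simp
  also have "(\<Sum>k\<le>n. of_nat (n choose k) * J k (Suc (n - k)))
      = (\<Sum>k\<le>Suc n. of_nat (n choose k) * J k (Suc n - k))"
    by (auto intro!: sum.cong simp: Suc_diff_le)
  also have "(\<Sum>k\<le>Suc n. of_nat (case k of 0 \<Rightarrow> 0 | Suc j \<Rightarrow> n choose j) * J k (Suc n - k)) + \<dots>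
      = (\<Sum>k\<le>Suc n. of_nat (Suc n choose k) * J k (Suc n - k))"
    unfolding sum.distrib[symmetric]
    by (intro sum.cong refl) (auto split: nat.split simp: distrib_right)
  finally show ?case unfolding J_def .
qed

text \<open>Every interchange of alternating sums with integrals over tuples below reduces to this identity.\<close>

lemma nn_integral_LP_sum_splits:
  fixes H :: "'a list \<Rightarrow> 'a list \<Rightarrow> ennreal"
  assumes H [measurable]: "case_prod H \<in> borel_measurable (list_space M \<Otimes>\<^sub>M list_space M)"
  shows "(\<integral>\<^sup>+z. sum_splits H z \<partial>LP M) = (\<integral>\<^sup>+a. \<integral>\<^sup>+b. H a b \<partial>LP M \<partial>LP M)"
proof -
  note [measurable] = measurable_sum_splits[OF H]
  interpret P: sigma_finite_measure "list_power M k" for k by (rule sigma_finite_list_power)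
  interpret L: sigma_finite_measure "LP M" by (rule sigma_finite_LP)
  define J where "J k m = (\<integral>\<^sup>+a. \<integral>\<^sup>+b. H a b \<partial>list_power M m \<partial>list_power M k)" for k m
  have "(\<integral>\<^sup>+z. sum_splits H z \<partial>LP M)
      = (\<Sum>n. \<Sum>k\<le>n. ennreal (1 / fact k) * (ennreal (1 / fact (n - k)) * J k (n - k)))"
    unfolding nn_integral_LP[OF measurable_sum_splits[OF H]] nn_integral_list_power_sum_splits[OF H] J_def[symmetric]
      sum_distrib_left
  proof (intro suminf_cong sum.cong refl)
    fix n k :: nat assume "k \<in> {..n}"
    \<comment> \<open>The weights of the Lebesgue-Poisson measure absorb the binomial coefficient,
      so the sum over \<open>n\<close> and \<open>k\<close> is a Cauchy product and factors into two
      independent sums.\<close>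
    then have "1 / fact n * real (n choose k) = 1 / fact k * (1 / fact (n - k))"
      by (simp add: binomial_fact field_simps)
    then have "ennreal (1 / fact n) * of_nat (n choose k) = ennreal (1 / fact k) * ennreal (1 / fact (n - k))"
      by (simp only: ennreal_of_nat_eq_real_of_nat ennreal_mult'[symmetric] of_nat_0_le_iff
          zero_le_divide_1_iff fact_ge_zero)
    then show "ennreal (1 / fact n) * (of_nat (n choose k) * J k (n - k))
        = ennreal (1 / fact k) * (ennreal (1 / fact (n - k)) * J k (n - k))"
      by (simp only: mult.assoc[symmetric])
  qed
  also have "\<dots> = (\<Sum>k. \<Sum>m. ennreal (1 / fact k) * (ennreal (1 / fact m) * J k m))"
    by (rule suminf_triangle_ennreal)
  also have "\<dots> = (\<Sum>k. ennreal (1 / fact k) * (\<Sum>m. ennreal (1 / fact m) * J k m))"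
    by simp
  also have "\<dots> = (\<Sum>k. ennreal (1 / fact k) * (\<integral>\<^sup>+a. \<integral>\<^sup>+b. H a b \<partial>LP M \<partial>list_power M k))"
  proof (intro suminf_cong arg_cong[where f = "\<lambda>x. _ * x"])
    fix k
    have "(\<Sum>m. ennreal (1 / fact m) * J k m)
        = (\<integral>\<^sup>+a. (\<Sum>m. ennreal (1 / fact m) * (\<integral>\<^sup>+b. H a b \<partial>list_power M m)) \<partial>list_power M k)"
      unfolding J_def by (simp add: nn_integral_suminf nn_integral_cmult)
    also have "\<dots> = (\<integral>\<^sup>+a. \<integral>\<^sup>+b. H a b \<partial>LP M \<partial>list_power M k)"
      by (intro nn_integral_cong, subst nn_integral_LP)
         (auto simp: sets_eq_imp_space_eq[OF sets_list_power])
    finally show "(\<Sum>m. ennreal (1 / fact m) * J k m) = (\<integral>\<^sup>+a. \<integral>\<^sup>+b. H a b \<partial>LP M \<partial>list_power M k)" .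
  qed
  also have "\<dots> = (\<integral>\<^sup>+a. \<integral>\<^sup>+b. H a b \<partial>LP M \<partial>LP M)"
    by (rule nn_integral_LP[symmetric]) measurable
  finally show ?thesis .
qed

lemma nn_integral_list_power_density:
  fixes v :: "'a \<Rightarrow> ennreal"
  assumes v [measurable]: "v \<in> borel_measurable M" and sf: "sigma_finite_measure (density M v)"
    and "F \<in> borel_measurable (list_space M)"
  shows "(\<integral>\<^sup>+xs. F xs \<partial>list_power (density M v) n) = (\<integral>\<^sup>+xs. pl v xs * F xs \<partial>list_power M n)"
  using assms(3)
proof (induction n arbitrary: F)
  case 0
  note [measurable] = 0
  have "list_space (density M v) = list_space M" by (simp add: list_space_def)
  then show ?case
    using sigma_finite_measure.nn_integral_list_power_0[OF sf, of F] 0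
    by (subst nn_integral_list_power_0) simp_all
next
  case (Suc n)
  note [measurable] = Suc.prems
  have eq: "list_space (density M v) = list_space M" by (simp add: list_space_def)
  interpret P: sigma_finite_measure "list_power M n" by (rule sigma_finite_list_power)
  interpret D: sigma_finite_measure "list_power (density M v) n"
    by (rule sigma_finite_measure.sigma_finite_list_power[OF sf])
  have [measurable_cong]: "sets (list_power (density M v) n) = sets (list_space M)"
    by (simp add: eq)
  have "(\<integral>\<^sup>+xs. F xs \<partial>list_power (density M v) (Suc n))
      = (\<integral>\<^sup>+x. v x * (\<integral>\<^sup>+xs. F (x # xs) \<partial>list_power (density M v) n) \<partial>M)"
    using Suc.prems by (simp add: sigma_finite_measure.nn_integral_list_power_Suc[OF sf] eq nn_integral_density)
  also have "\<dots> = (\<integral>\<^sup>+x. v x * (\<integral>\<^sup>+xs. pl v xs * F (x # xs) \<partial>list_power M n) \<partial>M)"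
    by (intro nn_integral_cong arg_cong2[where f = times] refl Suc.IH) simp
  also have "\<dots> = (\<integral>\<^sup>+x. \<integral>\<^sup>+xs. pl v (x # xs) * F (x # xs) \<partial>list_power M n \<partial>M)"
    by (intro nn_integral_cong) (simp add: nn_integral_cmult[symmetric] mult.assoc)
  also have "\<dots> = (\<integral>\<^sup>+xs. pl v xs * F xs \<partial>list_power M (Suc n))"
    by (rule nn_integral_list_power_Suc[symmetric]) measurable
  finally show ?case .
qed

lemma nn_integral_LP_density:
  fixes v :: "'a \<Rightarrow> ennreal"
  assumes [measurable]: "v \<in> borel_measurable M" "F \<in> borel_measurable (list_space M)"
    and sf: "sigma_finite_measure (density M v)"
  shows "(\<integral>\<^sup>+xs. F xs \<partial>LP (density M v)) = (\<integral>\<^sup>+xs. pl v xs * F xs \<partial>LP M)"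
proof -
  have eq: "list_space (density M v) = list_space M" by (simp add: list_space_def)
  show ?thesis
    using assms by (simp add: nn_integral_LP nn_integral_list_power_density eq)
qed

lemma LP_density:
  fixes v :: "'a \<Rightarrow> ennreal"
  assumes [measurable]: "v \<in> borel_measurable M" and sf: "sigma_finite_measure (density M v)"
  shows "LP (density M v) = density (LP M) (pl v)"
proof (rule measure_eqI)
  have eq: "list_space (density M v) = list_space M" by (simp add: list_space_def)
  then show "sets (LP (density M v)) = sets (density (LP M) (pl v))" by simp
  fix S assume "S \<in> sets (LP (density M v))"
  then have [measurable]: "S \<in> sets (list_space M)" by (simp add: eq)
  show "emeasure (LP (density M v)) S = emeasure (density (LP M) (pl v)) S"
    using nn_integral_LP_density[OF assms(1) borel_measurable_indicator[OF \<open>S \<in> sets (list_space M)\<close>] sf]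
    by (simp add: emeasure_density eq)
qed

section \<open>Bochner integrals over lists as series over the length\<close>

lemma LP_nonneg_sums:
  fixes F :: "'a list \<Rightarrow> real"
  assumes int: "integrable (LP M) F" and nonneg: "\<And>xs. 0 \<le> F xs"
  shows "integrable (list_power M n) F"
    and "(\<lambda>n. 1 / fact n * (\<integral>xs. F xs \<partial>list_power M n)) sums (\<integral>xs. F xs \<partial>LP M)"
proof -
  have [measurable]: "F \<in> borel_measurable (list_space M)"
    using borel_measurable_integrable[OF int] by simp
  have eq: "(\<integral>\<^sup>+xs. F xs \<partial>LP M) = (\<Sum>n. ennreal (1 / fact n) * (\<integral>\<^sup>+xs. F xs \<partial>list_power M n))"
    by (rule nn_integral_LP) measurable
  have fin: "(\<integral>\<^sup>+xs. F xs \<partial>LP M) < \<infinity>"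
    using int nonneg by (simp add: integrable_iff_bounded)
  have "ennreal (1 / fact n) * (\<integral>\<^sup>+xs. F xs \<partial>list_power M n) < \<infinity>" for n
    by (rule ennreal_suminf_lessD[OF fin[unfolded eq]])
  \<comment> \<open>Finiteness of the weighted term gives finiteness of the integral only because
    the weight is not zero.\<close>
  moreover have "ennreal (1 / fact n) \<noteq> 0" for n
    using fact_gt_zero[of n, where 'a = real] by (simp only: ennreal_eq_0_iff not_le) simp
  ultimately have fin_n: "(\<integral>\<^sup>+xs. F xs \<partial>list_power M n) < \<infinity>" for n
    by (metis ennreal_mult_less_top infinity_ennreal_def ennreal_zero_less_top)
  then show int_n: "integrable (list_power M n) F" for n
    using nonneg by (intro integrableI_nonneg) auto
  have "ennreal (1 / fact n) * (\<integral>\<^sup>+xs. F xs \<partial>list_power M n)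
      = ennreal (1 / fact n * (\<integral>xs. F xs \<partial>list_power M n))" for n
  proof -
    have "(\<integral>\<^sup>+xs. F xs \<partial>list_power M n) = ennreal (\<integral>xs. F xs \<partial>list_power M n)"
      by (rule nn_integral_eq_integral[OF int_n]) (simp add: nonneg)
    moreover have "ennreal (1 / fact n * (\<integral>xs. F xs \<partial>list_power M n))
        = ennreal (1 / fact n) * ennreal (\<integral>xs. F xs \<partial>list_power M n)"
      by (rule ennreal_mult') simp
    ultimately show ?thesis by (simp only:)
  qed
  then have "(\<Sum>n. ennreal (1 / fact n * (\<integral>xs. F xs \<partial>list_power M n))) = ennreal (\<integral>xs. F xs \<partial>LP M)"
    using nn_integral_eq_integral[OF int AE_I2[OF nonneg]] eq by (simp only:)
  moreover have "(\<lambda>n. ennreal (1 / fact n * (\<integral>xs. F xs \<partial>list_power M n))) sums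
      (\<Sum>n. ennreal (1 / fact n * (\<integral>xs. F xs \<partial>list_power M n)))"
    by (rule summable_sums[OF summableI])
  ultimately have "(\<lambda>n. ennreal (1 / fact n * (\<integral>xs. F xs \<partial>list_power M n))) sums ennreal (\<integral>xs. F xs \<partial>LP M)"
    by (simp only:)
  then show "(\<lambda>n. 1 / fact n * (\<integral>xs. F xs \<partial>list_power M n)) sums (\<integral>xs. F xs \<partial>LP M)"
    by (subst (asm) sums_ennreal)
       (simp_all add: Bochner_Integration.integral_nonneg nonneg)
qed

lemma LP_sums:
  fixes F :: "'a list \<Rightarrow> real"
  assumes int: "integrable (LP M) F"
  shows "integrable (list_power M n) F"
    and "(\<lambda>n. 1 / fact n * (\<integral>xs. F xs \<partial>list_power M n)) sums (\<integral>xs. F xs \<partial>LP M)"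
proof -
  let ?p = "\<lambda>xs. max 0 (F xs)" and ?m = "\<lambda>xs. max 0 (- F xs)"
  have F: "F = (\<lambda>xs. ?p xs - ?m xs)" by (auto simp: fun_eq_iff)
  have ip: "integrable (LP M) ?p" "integrable (LP M) ?m" using int by auto
  note p = LP_nonneg_sums[OF ip(1)] and m = LP_nonneg_sums[OF ip(2)]
  show "integrable (list_power M n) F" for n
    by (subst F, rule Bochner_Integration.integrable_diff) (use p(1) m(1) in auto)
  have e1: "(\<integral>xs. F xs \<partial>LP M) = (\<integral>xs. ?p xs \<partial>LP M) - (\<integral>xs. ?m xs \<partial>LP M)"
    by (subst F, rule Bochner_Integration.integral_diff[OF ip])
  have e2: "(\<integral>xs. F xs \<partial>list_power M n) = (\<integral>xs. ?p xs \<partial>list_power M n) - (\<integral>xs. ?m xs \<partial>list_power M n)" for n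
    by (subst F, rule Bochner_Integration.integral_diff) (use p(1) m(1) in auto)
  have "(\<lambda>n. 1 / fact n * (\<integral>xs. ?p xs \<partial>list_power M n) - 1 / fact n * (\<integral>xs. ?m xs \<partial>list_power M n)) sums
      ((\<integral>xs. ?p xs \<partial>LP M) - (\<integral>xs. ?m xs \<partial>LP M))"
    by (rule sums_diff) (use p(2) m(2) in auto)
  then show "(\<lambda>n. 1 / fact n * (\<integral>xs. F xs \<partial>list_power M n)) sums (\<integral>xs. F xs \<partial>LP M)"
    unfolding e1 e2 right_diff_distrib .
qed

lemma integral_list_power_pl:
  fixes u :: "'a \<Rightarrow> real"
  assumes u: "integrable M u"
  shows "(\<integral>xs. pl u xs \<partial>list_power M n) = (\<integral>x. u x \<partial>M) ^ n"
proof -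
  interpret product_sigma_finite "\<lambda>_ :: nat. M" by (rule product_sf)
  have [measurable]: "u \<in> borel_measurable M" using u by simp
  have "(\<integral>xs. pl u xs \<partial>list_power M n) = (\<integral>x. (\<Prod>i\<in>{1..n}. u (x i)) \<partial>PiM {1..n} (\<lambda>_. M))"
    unfolding list_power_def by (subst integral_distr) (simp_all only: pl_tup, measurable)
  also have "\<dots> = (\<Prod>i\<in>{1..n}. \<integral>x. u x \<partial>M)"
    by (rule product_integral_prod) (use u in auto)
  finally show ?thesis by simp
qed

lemma integrable_pl:
  fixes u :: "'a \<Rightarrow> real"
  assumes u: "integrable M u"
  shows "integrable (LP M) (pl u)"
proof (rule integrableI_bounded)
  have [measurable]: "u \<in> borel_measurable M" using u by simp
  show "pl u \<in> borel_measurable (LP M)" by measurable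
  have "(\<integral>\<^sup>+xs. norm (pl u xs) \<partial>LP M) = (\<integral>\<^sup>+xs. pl (\<lambda>x. ennreal \<bar>u x\<bar>) xs \<partial>LP M)"
    by (simp add: abs_pl ennreal_pl)
  also have "\<dots> = ennreal (exp (\<integral>x. \<bar>u x\<bar> \<partial>M))"
    using u by (intro nn_integral_LP_pl) (auto intro!: nn_integral_eq_integral)
  finally show "(\<integral>\<^sup>+xs. norm (pl u xs) \<partial>LP M) < \<infinity>" by simp
qed

lemma integral_LP_pl:
  fixes u :: "'a \<Rightarrow> real"
  assumes u: "integrable M u"
  shows "(\<integral>xs. pl u xs \<partial>LP M) = exp (\<integral>x. u x \<partial>M)"
proof -
  have "(\<lambda>n. 1 / fact n * (\<integral>x. u x \<partial>M) ^ n) sums (\<integral>xs. pl u xs \<partial>LP M)"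
    using LP_sums(2)[OF integrable_pl[OF u]] by (simp add: integral_list_power_pl[OF u])
  moreover have "(\<lambda>n. 1 / fact n * (\<integral>x. u x \<partial>M) ^ n) sums exp (\<integral>x. u x \<partial>M)"
    using exp_converges[of "\<integral>x. u x \<partial>M"] by (simp add: field_simps)
  ultimately show ?thesis by (rule sums_unique2)
qed

lemma integrable_LP_sum_splits:
  fixes H :: "'a list \<Rightarrow> 'a list \<Rightarrow> real"
  assumes H: "integrable (LP M \<Otimes>\<^sub>M LP M) (case_prod H)"
  shows "integrable (LP M) (sum_splits H)"
proof -
  interpret PS: pair_sigma_finite "LP M" "LP M" by (rule pair_sigma_finite_LP)
  have Hm [measurable]: "case_prod H \<in> borel_measurable (list_space M \<Otimes>\<^sub>M list_space M)"
    using borel_measurable_integrable[OF H] by simp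
  have Ha: "(\<lambda>(a, b). ennreal \<bar>H a b\<bar>) \<in> borel_measurable (list_space M \<Otimes>\<^sub>M list_space M)"
    using Hm by (simp add: split_def)
  note [measurable] = measurable_sum_splits[OF Hm] measurable_sum_splits[OF Ha]
  have e: "ennreal (sum_splits (\<lambda>a b. \<bar>H a b\<bar>) xs) = sum_splits (\<lambda>a b. ennreal \<bar>H a b\<bar>) xs" for xs
  proof -
    have "ennreal (sum_splits (\<lambda>a b. \<bar>H a b\<bar>) xs) = sum_splits (\<lambda>a b. ennreal \<bar>H a b\<bar>) xs
       \<and> 0 \<le> sum_splits (\<lambda>a b. \<bar>H a b\<bar>) xs" for H :: "'a list \<Rightarrow> 'a list \<Rightarrow> real"
      by (induction xs arbitrary: H) (simp_all add: ennreal_plus del: abs_ge_self)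
    then show ?thesis by blast
  qed
  show ?thesis
  proof (rule integrableI_bounded)
    show "sum_splits H \<in> borel_measurable (LP M)" by measurable
    have "(\<integral>\<^sup>+z. norm (sum_splits H z) \<partial>LP M) \<le> (\<integral>\<^sup>+z. sum_splits (\<lambda>a b. ennreal \<bar>H a b\<bar>) z \<partial>LP M)"
      unfolding e[symmetric] real_norm_def by (intro nn_integral_mono ennreal_leI abs_sum_splits_le)
    also have "\<dots> = (\<integral>\<^sup>+a. \<integral>\<^sup>+b. ennreal \<bar>H a b\<bar> \<partial>LP M \<partial>LP M)"
      by (rule nn_integral_LP_sum_splits[OF Ha])
    also have "\<dots> = (\<integral>\<^sup>+p. norm (case_prod H p) \<partial>(LP M \<Otimes>\<^sub>M LP M))"
      using Ha by (subst sigma_finite_measure.nn_integral_fst[OF sigma_finite_LP, symmetric]) (simp_all add: split_def)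
    also have "\<dots> < \<infinity>"
      using H by (simp add: integrable_iff_bounded)
    finally show "(\<integral>\<^sup>+z. norm (sum_splits H z) \<partial>LP M) < \<infinity>" .
  qed
qed

lemma integral_LP_sum_splits:
  fixes H :: "'a list \<Rightarrow> 'a list \<Rightarrow> real"
  assumes H: "integrable (LP M \<Otimes>\<^sub>M LP M) (case_prod H)"
  shows "(\<integral>z. sum_splits H z \<partial>LP M) = (\<integral>a. \<integral>b. H a b \<partial>LP M \<partial>LP M)"
proof -
  interpret PS: pair_sigma_finite "LP M" "LP M" by (rule pair_sigma_finite_LP)
  have pos: "(\<integral>z. sum_splits K z \<partial>LP M) = (\<integral>p. case_prod K p \<partial>(LP M \<Otimes>\<^sub>M LP M))"
    if K: "integrable (LP M \<Otimes>\<^sub>M LP M) (case_prod K)" and nn: "\<And>a b. 0 \<le> K a b" for K :: "'a list \<Rightarrow> 'a list \<Rightarrow> real"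
  proof -
    have Km [measurable]: "case_prod K \<in> borel_measurable (list_space M \<Otimes>\<^sub>M list_space M)"
      using borel_measurable_integrable[OF K] by simp
    have Ke: "(\<lambda>(a, b). ennreal (K a b)) \<in> borel_measurable (list_space M \<Otimes>\<^sub>M list_space M)"
      using Km by (simp add: split_def)
    have e: "ennreal (sum_splits K xs) = sum_splits (\<lambda>a b. ennreal (K a b)) xs \<and> 0 \<le> sum_splits K xs" for xs
      using nn by (induction xs arbitrary: K) (simp_all add: ennreal_plus)
    have "ennreal (\<integral>z. sum_splits K z \<partial>LP M) = (\<integral>\<^sup>+z. ennreal (sum_splits K z) \<partial>LP M)"
      using e by (intro nn_integral_eq_integral[symmetric] integrable_LP_sum_splits[OF K]) auto
    also have "\<dots> = (\<integral>\<^sup>+a. \<integral>\<^sup>+b. ennreal (K a b) \<partial>LP M \<partial>LP M)"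
      using nn_integral_LP_sum_splits[OF Ke] e by simp
    also have "\<dots> = (\<integral>\<^sup>+p. ennreal (case_prod K p) \<partial>(LP M \<Otimes>\<^sub>M LP M))"
      using Ke by (subst sigma_finite_measure.nn_integral_fst[OF sigma_finite_LP, symmetric]) (simp_all add: split_def)
    also have "\<dots> = ennreal (\<integral>p. case_prod K p \<partial>(LP M \<Otimes>\<^sub>M LP M))"
      using nn by (intro nn_integral_eq_integral[OF K]) auto
    finally show ?thesis
      using e nn by (subst (asm) ennreal_inj) (auto intro!: integral_nonneg_AE)
  qed
  let ?p = "\<lambda>a b. max 0 (H a b)" and ?m = "\<lambda>a b. max 0 (- H a b)"
  have H': "integrable (LP M \<Otimes>\<^sub>M LP M) (\<lambda>p. H (fst p) (snd p))"
    using H by (simp add: split_def)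
  have i: "integrable (LP M \<Otimes>\<^sub>M LP M) (case_prod ?p)" "integrable (LP M \<Otimes>\<^sub>M LP M) (case_prod ?m)"
    unfolding split_def using H' by auto
  have "sum_splits H z = sum_splits ?p z - sum_splits ?m z" for z
  proof -
    have "sum_splits (\<lambda>a b. ?p a b + - ?m a b) z = sum_splits ?p z + sum_splits (\<lambda>a b. - ?m a b) z"
      by (rule sum_splits_add)
    moreover have "(\<lambda>a b. ?p a b + - ?m a b) = H" by (auto simp: fun_eq_iff)
    ultimately show ?thesis by (simp only: sum_splits_minus)
  qed
  then have "(\<integral>z. sum_splits H z \<partial>LP M) = (\<integral>z. sum_splits ?p z \<partial>LP M) - (\<integral>z. sum_splits ?m z \<partial>LP M)"
    by (simp add: Bochner_Integration.integral_diff integrable_LP_sum_splits[OF i(1)] integrable_LP_sum_splits[OF i(2)])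
  also have "\<dots> = (\<integral>p. case_prod ?p p - case_prod ?m p \<partial>(LP M \<Otimes>\<^sub>M LP M))"
    by (simp only: pos[OF i(1)] pos[OF i(2)] Bochner_Integration.integral_diff[OF i] max.cobounded1)
  also have "\<dots> = (\<integral>p. case_prod H p \<partial>(LP M \<Otimes>\<^sub>M LP M))"
    by (intro Bochner_Integration.integral_cong) auto
  also have "\<dots> = (\<integral>a. \<integral>b. H a b \<partial>LP M \<partial>LP M)"
    using PS.integral_fst'[OF H] by simp
  finally show ?thesis .
qed

end

section \<open>The finite case: difference and summation operators\<close>

definition list_symmetric :: "('a list \<Rightarrow> 'b) \<Rightarrow> bool" where
  "list_symmetric a \<longleftrightarrow> (\<forall>xs ys. mset xs = mset ys \<longrightarrow> a xs = a ys)"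

lemma list_symmetricD: "list_symmetric a \<Longrightarrow> mset xs = mset ys \<Longrightarrow> a xs = a ys"
  unfolding list_symmetric_def by blast

lemma list_symmetric_pl: "list_symmetric (pl (v :: _ \<Rightarrow> 'b::comm_monoid_mult))"
  unfolding list_symmetric_def by (metis mset_map prod_mset_prod_list)

lemma list_symmetric_splits:
  assumes "list_symmetric a" "(p, q) \<in> set (splits xs)"
  shows "a (zs @ p @ q) = a (zs @ xs)" "a (p @ q) = a xs"
  by (rule list_symmetricD[OF assms(1)]; simp add: mset_splits[OF assms(2)])+

text \<open>The iterated difference: \<open>p\<close> collects the points that are added,
  \<open>q\<close> those that are left out, whence the sign. It becomes \<open>diff_op\<close> when
  \<open>a p\<close> is the value of a functional at a configuration with \<open>p\<close>
  added.\<close>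

definition list_diff :: "('a list \<Rightarrow> real) \<Rightarrow> 'a list \<Rightarrow> real" where
  "list_diff a xs = sum_splits (\<lambda>p q. (-1) ^ length q * a p) xs"

text \<open>Moebius inversion over sublists. The difference at \<open>x # p\<close> is that of
  \<open>r \<mapsto> a (x # r)\<close> at \<open>p\<close> minus that of \<open>a\<close> at
  \<open>p\<close>; the subtracted part cancels against the splittings that send \<open>x\<close> to
  the right.\<close>

lemma sum_splits_list_diff: "sum_splits (\<lambda>p q. list_diff a p) xs = a xs"
proof (induction xs arbitrary: a)
  case (Cons x xs)
  have "list_diff a (x # p) = list_diff (\<lambda>r. a (x # r)) p - list_diff a p" for p
    unfolding list_diff_def by (simp add: sum_splits_minus)
  then have "sum_splits (\<lambda>p q. list_diff a p) (x # xs)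
      = sum_splits (\<lambda>p q. list_diff (\<lambda>r. a (x # r)) p + - list_diff a p) xs + sum_splits (\<lambda>p q. list_diff a p) xs"
    by simp
  then show ?case by (simp only: sum_splits_add sum_splits_minus Cons)
qed (simp add: list_diff_def)

lemma list_diff_cong:
  "(\<And>p q. (p, q) \<in> set (splits xs) \<Longrightarrow> a p = b p) \<Longrightarrow> list_diff a xs = list_diff b xs"
  unfolding list_diff_def by (rule sum_splits_cong) simp

text \<open>Differences at two blocks of points are taken one after the other. This later identifies
  the kernels of a differenced functional with kernels of the original one.\<close>

lemma list_diff_append:
  "list_diff a (xs @ ys) = list_diff (\<lambda>p. list_diff (\<lambda>r. a (p @ r)) ys) xs"
  unfolding list_diff_def sum_splits_append
  by (simp add: power_add mult.assoc sum_splits_mult)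

lemma list_diff_mult: "list_diff (\<lambda>p. c * a p) xs = c * list_diff a xs"
  unfolding list_diff_def by (simp add: mult.left_commute[of _ c] sum_splits_mult)

lemma sum_splits_swap_Cons:
  fixes H :: "'a list \<Rightarrow> 'a list \<Rightarrow> 'b::comm_monoid_add"
  assumes "\<And>a b a' b'. mset a = mset a' \<Longrightarrow> mset b = mset b' \<Longrightarrow> H a b = H a' b'"
  shows "sum_splits H (us @ x # vs) = sum_splits H (x # us @ vs)"
  using assms
proof (induction us arbitrary: H)
  case (Cons u us)
  have "H (u # x # a) b = H (x # u # a) b" "H a (u # x # b) = H a (x # u # b)" for a b
    by (rule Cons.prems; simp)+
  moreover have "sum_splits (\<lambda>a. H (u # a)) (us @ x # vs) = sum_splits (\<lambda>a. H (u # a)) (x # us @ vs)"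
    by (rule Cons.IH, rule Cons.prems) simp_all
  moreover have "sum_splits (\<lambda>a b. H a (u # b)) (us @ x # vs) = sum_splits (\<lambda>a b. H a (u # b)) (x # us @ vs)"
    by (rule Cons.IH, rule Cons.prems) simp_all
  ultimately show ?case by (simp add: ac_simps)
qed simp

text \<open>\<open>splits\<close> follows the order of its list, so invariance has to be proved: the
  first entry of one list is located in the other and moved to the front, and the remaining lists
  are again permutations of each other.\<close>

lemma sum_splits_perm:
  fixes H :: "'a list \<Rightarrow> 'a list \<Rightarrow> 'b::comm_monoid_add"
  assumes "\<And>a b a' b'. mset a = mset a' \<Longrightarrow> mset b = mset b' \<Longrightarrow> H a b = H a' b'"
    and "mset xs = mset ys"
  shows "sum_splits H xs = sum_splits H ys"
  using assms
proof (induction xs arbitrary: ys H)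
  case Nil
  from Nil.prems(2) have "ys = []" by simp
  then show ?case by (simp only:)
next
  case (Cons x xs)
  from Cons.prems(2) have "x \<in> set ys" by (metis list.set_intros(1) set_mset_mset)
  then obtain us vs where ys: "ys = us @ x # vs" by (auto simp: in_set_conv_decomp)
  then have m: "mset xs = mset (us @ vs)" using Cons.prems(2) by simp
  have "sum_splits H (x # xs) = sum_splits H (x # us @ vs)"
    unfolding sum_splits_Cons
    by (rule arg_cong2[where f = plus]; rule Cons.IH[OF _ m]; rule Cons.prems(1); simp)
  also have "\<dots> = sum_splits H (us @ x # vs)"
    by (rule sum_splits_swap_Cons[symmetric], rule Cons.prems(1))
  finally show ?case unfolding ys .
qed

lemma list_symmetric_list_diff:
  assumes "list_symmetric a"
  shows "list_symmetric (list_diff a)"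
  unfolding list_symmetric_def list_diff_def
proof (intro allI impI)
  fix xs ys :: "'a list" assume eq: "mset xs = mset ys"
  show "sum_splits (\<lambda>p q. (-1) ^ length q * a p) xs = sum_splits (\<lambda>p q. (-1) ^ length q * a p) ys"
  proof (rule sum_splits_perm[OF _ eq])
    fix p q p' q' :: "'a list" assume "mset p = mset p'" "mset q = mset q'"
    then show "(-1) ^ length q * a p = (-1) ^ length q' * a p'"
      using list_symmetricD[OF assms, of p p'] mset_eq_length[of q q'] by simp
  qed
qed

lemma abs_list_diff_le:
  assumes "\<And>p. \<bar>a p\<bar> \<le> K"
  shows "\<bar>list_diff a xs\<bar> \<le> K * 2 ^ length xs"
proof -
  have "\<bar>list_diff a xs\<bar> \<le> sum_splits (\<lambda>p q. \<bar>(-1) ^ length q * a p\<bar>) xs"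
    unfolding list_diff_def by (rule abs_sum_splits_le)
  also have "\<dots> \<le> sum_splits (\<lambda>p q. K * (pl (\<lambda>_. 1) p * pl (\<lambda>_. 1) q)) xs"
    by (rule sum_splits_mono) (use assms in \<open>simp add: abs_mult power_abs pl_const\<close>)
  also have "\<dots> = K * 2 ^ length xs"
    unfolding sum_splits_mult sum_splits_pl by (simp add: pl_const)
  finally show ?thesis .
qed

lemma integral_sum_splits:
  fixes F :: "'a list \<Rightarrow> 'a list \<Rightarrow> 'b \<Rightarrow> real"
  assumes "\<And>p q. (p, q) \<in> set (splits xs) \<Longrightarrow> integrable N (F p q)"
  shows "integrable N (\<lambda>w. sum_splits (\<lambda>p q. F p q w) xs)"
    and "(\<integral>w. sum_splits (\<lambda>p q. F p q w) xs \<partial>N) = sum_splits (\<lambda>p q. \<integral>w. F p q w \<partial>N) xs"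
proof -
  have "integrable N (\<lambda>w. \<Sum>(p, q)\<leftarrow>L. F p q w) \<and>
      (\<integral>w. (\<Sum>(p, q)\<leftarrow>L. F p q w) \<partial>N) = (\<Sum>(p, q)\<leftarrow>L. \<integral>w. F p q w \<partial>N)"
    if "\<And>p q. (p, q) \<in> set L \<Longrightarrow> integrable N (F p q)" for L
    using that by (induction L) auto
  from this[of "splits xs"] assms
  show "integrable N (\<lambda>w. sum_splits (\<lambda>p q. F p q w) xs)"
    "(\<integral>w. sum_splits (\<lambda>p q. F p q w) xs \<partial>N) = sum_splits (\<lambda>p q. \<integral>w. F p q w \<partial>N) xs" by auto
qed

lemma (in sigma_finite_measure) integrable_pair_pl:
  fixes v w :: "'a \<Rightarrow> real"
  assumes "integrable M v" "integrable M w"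
  shows "integrable (LP M \<Otimes>\<^sub>M LP M) (\<lambda>(p, q). pl v p * pl w q)"
proof -
  interpret PS: pair_sigma_finite "LP M" "LP M" by (rule pair_sigma_finite_LP)
  have [measurable]: "v \<in> borel_measurable M" "w \<in> borel_measurable M" using assms by auto
  show ?thesis
  proof (rule PS.Fubini_integrable)
    show "(\<lambda>(p, q). pl v p * pl w q) \<in> borel_measurable (LP M \<Otimes>\<^sub>M LP M)" by measurable
    have "(\<lambda>p. \<integral>q. norm (case (p, q) of (p, q) \<Rightarrow> pl v p * pl w q) \<partial>LP M)
        = (\<lambda>p. norm (pl v p) * (\<integral>q. norm (pl w q) \<partial>LP M))"
      by (simp add: abs_mult)
    then show "integrable (LP M) (\<lambda>p. \<integral>q. norm (case (p, q) of (p, q) \<Rightarrow> pl v p * pl w q) \<partial>LP M)"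
      using integrable_pl[OF assms(1)] by simp
    show "AE p in LP M. integrable (LP M) (\<lambda>q. case (p, q) of (p, q) \<Rightarrow> pl v p * pl w q)"
      using integrable_pl[OF assms(2)] by simp
  qed
qed

section \<open>Two integral operators over a finite measure, and their adjoints\<close>

context finite_measure
begin

text \<open>Averages over additional points of unnormalised Lebesgue-Poisson law. Finiteness of
  \<open>M\<close> makes the integral converge for bounded measurable \<open>a\<close>; applied to
  conditional means it yields means of shifted functionals.\<close>

definition LPint :: "('a list \<Rightarrow> real) \<Rightarrow> 'a list \<Rightarrow> real" where
  "LPint a x = (\<integral>y. a (x @ y) \<partial>LP M)"

text \<open>The sign makes this the inverse of \<open>LPint\<close> on bounded measurable symmetric
  functions. It also arises when the alternating sum of \<open>list_diff\<close> is moved to the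
  other factor of an integral.\<close>

definition LPalt :: "('a list \<Rightarrow> real) \<Rightarrow> 'a list \<Rightarrow> real" where
  "LPalt a x = (\<integral>y. (-1) ^ length y * a (x @ y) \<partial>LP M)"

lemma integrable_LP_bounded:
  fixes F :: "'a list \<Rightarrow> real"
  assumes "F \<in> borel_measurable (list_space M)" "integrable M v" "\<And>x. \<bar>F x\<bar> \<le> c * pl v x"
  shows "integrable (LP M) F"
proof (rule Bochner_Integration.integrable_bound)
  show "integrable (LP M) (\<lambda>x. c * pl v x)" using integrable_pl[OF assms(2)] by simp
  show "F \<in> borel_measurable (LP M)" using assms(1) by simp
  show "AE x in LP M. norm (F x) \<le> norm (c * pl v x)"
    using assms(3) by (intro AE_I2) (metis abs_of_nonneg order.trans abs_ge_self real_norm_def)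
qed

lemma integrable_LP_pair_bounded:
  fixes F :: "'a list \<Rightarrow> 'a list \<Rightarrow> real"
  assumes "case_prod F \<in> borel_measurable (list_space M \<Otimes>\<^sub>M list_space M)"
    and "integrable M v" "integrable M w" "\<And>x y. \<bar>F x y\<bar> \<le> c * (pl v x * pl w y)"
  shows "integrable (LP M \<Otimes>\<^sub>M LP M) (case_prod F)"
proof (rule Bochner_Integration.integrable_bound)
  show "integrable (LP M \<Otimes>\<^sub>M LP M) (\<lambda>p. c * (case p of (p, q) \<Rightarrow> pl v p * pl w q))"
    using integrable_pair_pl[OF assms(2,3)] by simp
  show "case_prod F \<in> borel_measurable (LP M \<Otimes>\<^sub>M LP M)" using assms(1) by simp
  show "AE x in LP M \<Otimes>\<^sub>M LP M. norm (case_prod F x) \<le> norm (c * (case x of (p, q) \<Rightarrow> pl v p * pl w q))"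
    using assms(4) by (intro AE_I2) (auto intro: order.trans[OF assms(4) abs_ge_self])
qed

lemma integrable_one: "integrable M (\<lambda>_. c :: real)"
  by simp

lemma integrable_const_LP [simp]: "integrable (LP M) (\<lambda>_. c :: real)"
  using integrable_LP_bounded[of "\<lambda>_. c" "\<lambda>_. 1" "\<bar>c\<bar>"] by (simp add: pl_const)

lemma integral_const_LP: "(\<integral>y. c \<partial>LP M) = exp (measure M (space M)) * (c :: real)"
proof -
  have "(\<integral>y. c * pl (\<lambda>_. 1) y \<partial>LP M) = c * exp (measure M (space M))"
    using integral_LP_pl[OF integrable_one[of 1]] by simp
  then show ?thesis by (simp add: pl_const mult.commute)
qed

lemma LPint_measurable [measurable]:
  assumes [measurable]: "a \<in> borel_measurable (list_space M)"
  shows "LPint a \<in> borel_measurable (list_space M)"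
proof -
  interpret L: sigma_finite_measure "LP M" by (rule sigma_finite_LP)
  show ?thesis unfolding LPint_def by measurable
qed

lemma LPalt_measurable [measurable]:
  assumes [measurable]: "a \<in> borel_measurable (list_space M)"
  shows "LPalt a \<in> borel_measurable (list_space M)"
proof -
  interpret L: sigma_finite_measure "LP M" by (rule sigma_finite_LP)
  show ?thesis unfolding LPalt_def by measurable
qed

lemma list_diff_measurable [measurable]:
  assumes [measurable]: "a \<in> borel_measurable (list_space M)"
  shows "list_diff a \<in> borel_measurable (list_space M)"
  unfolding list_diff_def by (rule measurable_sum_splits) measurable

lemma list_symmetric_LPint: "list_symmetric a \<Longrightarrow> list_symmetric (LPint a)"
  unfolding list_symmetric_def LPint_def
  by (intro allI impI Bochner_Integration.integral_cong refl) simp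

lemma abs_LPint_le:
  assumes K: "\<And>p. \<bar>a p\<bar> \<le> K"
  shows "\<bar>LPint a x\<bar> \<le> exp (measure M (space M)) * K"
proof (cases "integrable (LP M) (\<lambda>y. a (x @ y))")
  case True
  have "\<bar>LPint a x\<bar> \<le> (\<integral>y. \<bar>a (x @ y)\<bar> \<partial>LP M)"
    unfolding LPint_def by (rule integral_abs_bound)
  also have "\<dots> \<le> (\<integral>y. K \<partial>LP M)"
    by (rule integral_mono) (use True K in auto)
  finally show ?thesis by (simp only: integral_const_LP)
next
  \<comment> \<open>A non-integrable function has integral 0 by convention, so the bound holds for
    every list, including those outside the space, as the bounds assumed below require.\<close>
  case False
  moreover have "0 \<le> K" using K[of x] by simp
  ultimately show ?thesis by (simp add: LPint_def not_integrable_integral_eq)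
qed

lemma abs_LPalt_le:
  assumes v: "integrable M v" "\<And>x. 0 \<le> v x" and g: "\<And>x. \<bar>g x\<bar> \<le> c * pl v x"
  shows "\<bar>LPalt g x\<bar> \<le> c * exp (\<integral>x. v x \<partial>M) * pl v x"
proof (cases "integrable (LP M) (\<lambda>y. (-1) ^ length y * g (x @ y))")
  case True
  have "\<bar>LPalt g x\<bar> \<le> (\<integral>y. \<bar>(-1) ^ length y * g (x @ y)\<bar> \<partial>LP M)"
    unfolding LPalt_def by (rule integral_abs_bound)
  also have "\<dots> \<le> (\<integral>y. c * pl v x * pl v y \<partial>LP M)"
  proof (rule integral_mono)
    show "integrable (LP M) (\<lambda>y. \<bar>(-1) ^ length y * g (x @ y)\<bar>)" by (rule integrable_abs[OF True])
    show "integrable (LP M) (\<lambda>y. c * pl v x * pl v y)" using integrable_pl[OF v(1)] by simp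
    show "\<bar>(-1) ^ length y * g (x @ y)\<bar> \<le> c * pl v x * pl v y" for y
      using g[of "x @ y"] by (simp add: abs_mult power_abs mult.assoc)
  qed
  also have "\<dots> = c * exp (\<integral>x. v x \<partial>M) * pl v x"
    by (simp add: integral_LP_pl[OF v(1)])
  finally show ?thesis .
next
  case False
  have "0 \<le> c" using g[of "[]"] by simp
  with False v(2) show ?thesis
    by (simp add: LPalt_def not_integrable_integral_eq pl_nonneg)
qed

text \<open>
  The adjoint of \<open>a \<mapsto> list_diff (LPint a)\<close>: both \<open>list_diff\<close> and \<open>LPint\<close> are moved to the
  other factor by the splitting identity.
\<close>

lemma list_diff_LPint_adjoint:
  assumes a [measurable]: "a \<in> borel_measurable (list_space M)"
    and K: "\<And>p. \<bar>a p\<bar> \<le> K" and sym: "list_symmetric a"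
    and g [measurable]: "g \<in> borel_measurable (list_space M)" and gsym: "list_symmetric g"
    and v: "integrable M v" "\<And>x. 0 \<le> v x" and gb: "\<And>x. \<bar>g x\<bar> \<le> c * pl v x"
  shows "(\<integral>x. list_diff (LPint a) x * g x \<partial>LP M) = (\<integral>z. a z * sum_splits (\<lambda>p q. LPalt g p) z \<partial>LP M)"
proof -
  have K0: "0 \<le> K" using K[of undefined] by simp
  have c0: "0 \<le> c" using gb[of "[]"] by simp
  let ?e = "exp (measure M (space M)) * K"
  have e0: "0 \<le> ?e" using K0 by simp
  \<comment> \<open>\<open>?H\<close> comes from the left side, with \<open>g x\<close> rewritten as
    \<open>g (p @ q)\<close> by symmetry; integrating out \<open>q\<close> leaves
    \<open>LPint a p * LPalt g p\<close>. \<open>?G\<close> is this product with the integral in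
    \<open>LPint a p\<close> opened, ready to be folded into a sum over the splittings of
    \<open>z\<close>.\<close>
  let ?H = "\<lambda>p q. (-1) ^ length q * LPint a p * g (p @ q)"
  let ?G = "\<lambda>p y. a (p @ y) * LPalt g p"
  have H: "integrable (LP M \<Otimes>\<^sub>M LP M) (case_prod ?H)"
  proof (rule integrable_LP_pair_bounded[OF _ v(1) v(1)])
    show "case_prod ?H \<in> borel_measurable (list_space M \<Otimes>\<^sub>M list_space M)" by measurable
    fix p q
    have "\<bar>LPint a p\<bar> * \<bar>g (p @ q)\<bar> \<le> ?e * (c * pl v (p @ q))"
      by (intro mult_mono abs_LPint_le K gb e0) auto
    then show "\<bar>?H p q\<bar> \<le> ?e * c * (pl v p * pl v q)"
      by (simp add: abs_mult power_abs mult.assoc)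
  qed
  have G: "integrable (LP M \<Otimes>\<^sub>M LP M) (case_prod ?G)"
  proof (rule integrable_LP_pair_bounded[OF _ v(1) integrable_one[of 1]])
    show "case_prod ?G \<in> borel_measurable (list_space M \<Otimes>\<^sub>M list_space M)" by measurable
    fix p y
    have "\<bar>a (p @ y)\<bar> * \<bar>LPalt g p\<bar> \<le> K * (c * exp (\<integral>x. v x \<partial>M) * pl v p)"
      by (intro mult_mono abs_LPalt_le K v gb K0) auto
    then show "\<bar>?G p y\<bar> \<le> K * (c * exp (\<integral>x. v x \<partial>M)) * (pl v p * pl (\<lambda>_. 1) y)"
      by (simp add: abs_mult mult.assoc pl_const)
  qed
  have "(\<integral>x. list_diff (LPint a) x * g x \<partial>LP M) = (\<integral>x. sum_splits ?H x \<partial>LP M)"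
  proof (rule Bochner_Integration.integral_cong[OF refl])
    fix x
    have "list_diff (LPint a) x * g x = sum_splits (\<lambda>p q. g x * ((-1) ^ length q * LPint a p)) x"
      unfolding sum_splits_mult list_diff_def by simp
    also have "\<dots> = sum_splits ?H x"
      by (rule sum_splits_cong) (simp add: list_symmetric_splits[OF gsym] ac_simps)
    finally show "list_diff (LPint a) x * g x = sum_splits ?H x" .
  qed
  also have "\<dots> = (\<integral>p. \<integral>q. ?H p q \<partial>LP M \<partial>LP M)"
    by (rule integral_LP_sum_splits[OF H])
  also have "\<dots> = (\<integral>p. \<integral>y. ?G p y \<partial>LP M \<partial>LP M)"
  proof (rule Bochner_Integration.integral_cong[OF refl])
    fix p
    have "(\<integral>q. ?H p q \<partial>LP M) = LPint a p * LPalt g p"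
      unfolding LPalt_def by (subst Bochner_Integration.integral_mult_right_zero[symmetric]) (simp add: ac_simps)
    also have "\<dots> = (\<integral>y. ?G p y \<partial>LP M)"
      unfolding LPint_def by (rule Bochner_Integration.integral_mult_left_zero[symmetric])
    finally show "(\<integral>q. ?H p q \<partial>LP M) = (\<integral>y. ?G p y \<partial>LP M)" .
  qed
  also have "\<dots> = (\<integral>z. sum_splits ?G z \<partial>LP M)"
    by (rule integral_LP_sum_splits[OF G, symmetric])
  also have "\<dots> = (\<integral>z. a z * sum_splits (\<lambda>p q. LPalt g p) z \<partial>LP M)"
  proof (rule Bochner_Integration.integral_cong[OF refl])
    fix z
    show "sum_splits ?G z = a z * sum_splits (\<lambda>p q. LPalt g p) z"
      unfolding sum_splits_mult[symmetric]
      by (rule sum_splits_cong) (simp add: list_symmetric_splits[OF sym] ac_simps)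
  qed
  finally show ?thesis .
qed

lemma LPalt_pl:
  assumes "integrable M u"
  shows "LPalt (pl u) x = pl u x * exp (- (\<integral>x. u x \<partial>M))"
proof -
  have e: "(-1) ^ length y * pl u (x @ y) = pl u x * pl (\<lambda>x. - u x) y" for y
    by (induction y) auto
  have "(\<integral>y. pl (\<lambda>x. - u x) y \<partial>LP M) = exp (- (\<integral>x. u x \<partial>M))"
    using integral_LP_pl[of "\<lambda>x. - u x"] assms by simp
  then show ?thesis unfolding LPalt_def e by simp
qed

text \<open>On products the adjoint is explicit: \<open>LPalt\<close> only multiplies
  \<open>pl u\<close> by a constant, and summing over sublists replaces \<open>u\<close> by
  \<open>1 + u\<close>. For \<open>u = h - 1\<close> the right-hand side is the shape of an
  expectation after a change of intensity by the density \<open>h\<close>.\<close>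

lemma integral_list_diff_LPint_pl:
  assumes a: "a \<in> borel_measurable (list_space M)" "\<And>p. \<bar>a p\<bar> \<le> K" "list_symmetric a"
    and u: "integrable M u"
  shows "(\<integral>x. list_diff (LPint a) x * pl u x \<partial>LP M)
    = exp (- (\<integral>x. u x \<partial>M)) * (\<integral>z. a z * pl (\<lambda>x. 1 + u x) z \<partial>LP M)"
proof -
  have [measurable]: "u \<in> borel_measurable M" using u by simp
  have "(\<integral>x. list_diff (LPint a) x * pl u x \<partial>LP M) = (\<integral>z. a z * sum_splits (\<lambda>p q. LPalt (pl u) p) z \<partial>LP M)"
    by (rule list_diff_LPint_adjoint[OF a(1) a(2) a(3), where v = "\<lambda>x. \<bar>u x\<bar>" and c = 1])
       (use u in \<open>auto simp: list_symmetric_pl abs_pl\<close>)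
  also have "\<dots> = (\<integral>z. exp (- (\<integral>x. u x \<partial>M)) * (a z * pl (\<lambda>x. 1 + u x) z) \<partial>LP M)"
  proof (rule Bochner_Integration.integral_cong[OF refl])
    fix z
    have "sum_splits (\<lambda>p q. LPalt (pl u) p) z
        = sum_splits (\<lambda>p q. exp (- (\<integral>x. u x \<partial>M)) * (pl u p * pl (\<lambda>_. 1) q)) z"
      by (simp add: LPalt_pl[OF u] pl_const mult.commute)
    also have "\<dots> = exp (- (\<integral>x. u x \<partial>M)) * pl (\<lambda>x. 1 + u x) z"
      unfolding sum_splits_mult sum_splits_pl by (simp add: add.commute)
    finally show "a z * sum_splits (\<lambda>p q. LPalt (pl u) p) z
        = exp (- (\<integral>x. u x \<partial>M)) * (a z * pl (\<lambda>x. 1 + u x) z)" by simp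
  qed
  finally show ?thesis by simp
qed

text \<open>A product of zeros is the indicator of the empty list, and the empty list has
  Lebesgue-Poisson mass 1.\<close>

lemma integral_LP_pl_0:
  fixes F :: "'a list \<Rightarrow> real"
  shows "(\<integral>w. pl (\<lambda>_. 0) w * F w \<partial>LP M) = F []"
proof -
  have z: "pl (\<lambda>_. 0 :: real) w = indicator {[]} w" for w by (cases w) auto
  have "(\<integral>w. pl (\<lambda>_. 0) w * F w \<partial>LP M) = (\<integral>w. pl (\<lambda>_. 0) w * F [] \<partial>LP M)"
    by (intro Bochner_Integration.integral_cong refl) (simp add: z indicator_def)
  also have "\<dots> = F []"
    using integral_LP_pl[of "\<lambda>_. 0"] by simp
  finally show ?thesis .
qed

lemma const_in_list_space:
  "x \<in> lists (space M) \<Longrightarrow> (\<lambda>_. x) \<in> measurable N (list_space M)"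
  by (simp add: space_list_space)

text \<open>The two lists that are appended merge into one list, and the alternating sum over its
  splittings vanishes unless that list is empty.\<close>

lemma LPalt_LPint:
  assumes [measurable]: "a \<in> borel_measurable (list_space M)" and K: "\<And>p. \<bar>a p\<bar> \<le> K"
    and sym: "list_symmetric a" and x: "x \<in> lists (space M)"
  shows "LPalt (LPint a) x = a x"
proof -
  note [measurable] = const_in_list_space[OF x]
  let ?H = "\<lambda>y z. (-1) ^ length y * a (x @ y @ z)"
  have H: "integrable (LP M \<Otimes>\<^sub>M LP M) (case_prod ?H)"
    by (rule integrable_LP_pair_bounded[OF _ integrable_one[of 1] integrable_one[of 1], of _ K])
       (use K in \<open>auto simp: abs_mult power_abs pl_const\<close>)
  have "LPalt (LPint a) x = (\<integral>y. \<integral>z. ?H y z \<partial>LP M \<partial>LP M)"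
    unfolding LPalt_def LPint_def by simp
  also have "\<dots> = (\<integral>w. sum_splits ?H w \<partial>LP M)"
    by (rule integral_LP_sum_splits[OF H, symmetric])
  also have "\<dots> = (\<integral>w. pl (\<lambda>_. 0) w * a (x @ w) \<partial>LP M)"
  proof (rule Bochner_Integration.integral_cong[OF refl])
    fix w
    have "sum_splits ?H w = sum_splits (\<lambda>p q. a (x @ w) * (-1) ^ length p) w"
      by (rule sum_splits_cong) (simp add: list_symmetric_splits[OF sym] ac_simps)
    also have "\<dots> = pl (\<lambda>_. 0) w * a (x @ w)"
      unfolding sum_splits_mult sum_splits_alternating by (cases w) auto
    finally show "sum_splits ?H w = pl (\<lambda>_. 0) w * a (x @ w)" .
  qed
  also have "\<dots> = a x" by (simp add: integral_LP_pl_0)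
  finally show ?thesis .
qed

text \<open>Of the appended list, the entries selected by the difference keep a sign and form
  \<open>LPalt\<close>. For the others the sign of the difference and the sign of
  \<open>LPalt\<close> cancel, so they integrate freely and contribute the total mass
  \<open>exp (measure M (space M))\<close>.\<close>

lemma LPalt_list_diff:
  assumes [measurable]: "a \<in> borel_measurable (list_space M)" and K: "\<And>p. \<bar>a p\<bar> \<le> K"
    and x: "x \<in> lists (space M)"
  shows "LPalt (list_diff a) x = exp (measure M (space M)) * list_diff (LPalt a) x"
proof -
  let ?F = "\<lambda>p y. sum_splits (\<lambda>p' q'. (-1) ^ length p' * a (p @ p')) y"
  have KL: "integrable (LP M) (?F p)" "(\<integral>y. ?F p y \<partial>LP M) = exp (measure M (space M)) * LPalt a p"
    if p: "p \<in> lists (space M)" for p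
  proof -
    note [measurable] = const_in_list_space[OF p]
    have H: "integrable (LP M \<Otimes>\<^sub>M LP M) (\<lambda>(p', q'). (-1) ^ length p' * a (p @ p'))"
      by (rule integrable_LP_pair_bounded[OF _ integrable_one[of 1] integrable_one[of 1], of _ K])
         (use K in \<open>auto simp: abs_mult power_abs pl_const\<close>)
    show "integrable (LP M) (?F p)" by (rule integrable_LP_sum_splits[OF H])
    show "(\<integral>y. ?F p y \<partial>LP M) = exp (measure M (space M)) * LPalt a p"
      unfolding integral_LP_sum_splits[OF H] integral_const_LP LPalt_def by simp
  qed
  have pl: "p \<in> lists (space M)" if "(p, q) \<in> set (splits x)" for p q
    using splits_in_lists[OF that x] by simp
  have "(-1) ^ length y * list_diff a (x @ y) = sum_splits (\<lambda>p q. (-1) ^ length q * ?F p y) x" for y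
    unfolding list_diff_def sum_splits_append sum_splits_mult[symmetric]
  proof (intro sum_splits_cong)
    fix p q p' q' assume "(p', q') \<in> set (splits y)"
    then have "length y = length p' + length q'" using length_splits by metis
    then show "(-1) ^ length y * ((-1) ^ length (q @ q') * a (p @ p')) = (-1) ^ length q * ((-1) ^ length p' * a (p @ p'))"
      by (simp add: power_add mult.assoc[symmetric])
  qed
  then have "LPalt (list_diff a) x = (\<integral>y. sum_splits (\<lambda>p q. (-1) ^ length q * ?F p y) x \<partial>LP M)"
    unfolding LPalt_def by simp
  also have "\<dots> = sum_splits (\<lambda>p q. \<integral>y. (-1) ^ length q * ?F p y \<partial>LP M) x"
    by (rule integral_sum_splits) (use KL(1)[OF pl] in simp)
  also have "\<dots> = sum_splits (\<lambda>p q. exp (measure M (space M)) * ((-1) ^ length q * LPalt a p)) x"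
    by (rule sum_splits_cong) (simp add: KL(2)[OF pl])
  finally show ?thesis unfolding sum_splits_mult list_diff_def .
qed

text \<open>In the adjoint identity \<open>g\<close> is taken to be the transform itself.
  \<open>LPalt\<close> passes through \<open>list_diff\<close> at the cost of the exponential
  factor, undoes \<open>LPint\<close>, and Moebius inversion removes the remaining difference. The
  transform is thus an isometry up to a constant, which is the source of the Bessel
  inequality.\<close>

lemma integral_list_diff_LPint_square:
  assumes a [measurable]: "a \<in> borel_measurable (list_space M)"
    and K: "\<And>p. \<bar>a p\<bar> \<le> K" and sym: "list_symmetric a"
  shows "(\<integral>x. (list_diff (LPint a) x)\<^sup>2 \<partial>LP M) = exp (measure M (space M)) * (\<integral>z. (a z)\<^sup>2 \<partial>LP M)"
    and "integrable (LP M) (\<lambda>x. (list_diff (LPint a) x)\<^sup>2)"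
proof -
  let ?m = "exp (measure M (space M))"
  let ?t = "list_diff (LPint a)"
  \<comment> \<open>A difference of a bounded function at \<open>n\<close> points has
    \<open>2^n\<close> terms. This gives the weight 2 per point in the adjoint identity and 4 per
    point for the square.\<close>
  have tb: "\<bar>?t x\<bar> \<le> ?m * K * pl (\<lambda>_. 2) x" for x
    unfolding pl_const by (rule abs_list_diff_le) (rule abs_LPint_le[OF K])
  have "(\<integral>x. (?t x)\<^sup>2 \<partial>LP M) = (\<integral>x. ?t x * ?t x \<partial>LP M)"
    by (simp add: power2_eq_square)
  also have "\<dots> = (\<integral>z. a z * sum_splits (\<lambda>p q. LPalt ?t p) z \<partial>LP M)"
    by (rule list_diff_LPint_adjoint[OF a K sym _ _ integrable_one[of 2] _ tb])
       (auto intro!: list_symmetric_list_diff list_symmetric_LPint sym)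
  also have "\<dots> = (\<integral>z. ?m * (a z)\<^sup>2 \<partial>LP M)"
  proof (rule Bochner_Integration.integral_cong[OF refl])
    fix z assume "z \<in> space (LP M)"
    then have z: "z \<in> lists (space M)" by (simp add: space_LP)
    have "LPalt ?t p = ?m * list_diff a p" if "(p, q) \<in> set (splits z)" for p q
    proof -
      have p: "p \<in> lists (space M)" using splits_in_lists[OF that z] by simp
      have "list_diff (LPalt (LPint a)) p = list_diff a p"
        by (rule list_diff_cong) (use LPalt_LPint[OF a K sym] splits_in_lists[OF _ p] in blast)
      then show ?thesis
        using LPalt_list_diff[OF LPint_measurable[OF a] abs_LPint_le[OF K] p] by simp
    qed
    then have "sum_splits (\<lambda>p q. LPalt ?t p) z = sum_splits (\<lambda>p q. ?m * list_diff a p) z"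
      by (rule sum_splits_cong)
    also have "\<dots> = ?m * a z" by (simp only: sum_splits_mult sum_splits_list_diff)
    finally show "a z * sum_splits (\<lambda>p q. LPalt ?t p) z = ?m * (a z)\<^sup>2"
      by (simp add: power2_eq_square)
  qed
  finally show "(\<integral>x. (?t x)\<^sup>2 \<partial>LP M) = ?m * (\<integral>z. (a z)\<^sup>2 \<partial>LP M)" by simp
  show "integrable (LP M) (\<lambda>x. (?t x)\<^sup>2)"
  proof (rule integrable_LP_bounded[OF _ integrable_one[of 4]])
    fix x
    have "\<bar>?t x\<bar>\<^sup>2 \<le> (?m * K * pl (\<lambda>_. 2) x)\<^sup>2"
      by (rule power_mono[OF tb]) simp
    also have "\<dots> = (?m * K)\<^sup>2 * pl (\<lambda>_. 4) x"
      by (simp add: pl_const power_mult_distrib power_mult[symmetric] mult.commute[of _ 2])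
         (simp add: power_mult)
    finally show "\<bar>(?t x)\<^sup>2\<bar> \<le> (?m * K)\<^sup>2 * pl (\<lambda>_. 4) x" by simp
  qed measurable
qed

end

section \<open>Configurations and partition events\<close>

lemma config_setD:
  assumes "\<phi> \<in> config_set X"
  shows "sets \<phi> = sets X" "sigma_finite_measure \<phi>"
    "B \<in> sets X \<Longrightarrow> emeasure \<phi> B \<in> insert \<infinity> (range of_nat)"
  using assms by (auto simp: config_set_def)

definition partition_event :: "'a measure \<Rightarrow> 'a set set \<Rightarrow> ('a set \<Rightarrow> ennreal) \<Rightarrow> 'a measure set" where
  "partition_event X P k = {\<phi> \<in> config_set X. \<forall>C\<in>P. emeasure \<phi> C = k C}"

text \<open>Every block lies inside or outside \<open>A\<close>, so the masses of the blocks
  determine the mass of \<open>A\<close>. The Mecke equation and the law conditioned to be empty on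
  \<open>A\<close> are both checked on such partitions.\<close>

definition measurable_partition :: "'a measure \<Rightarrow> 'a set \<Rightarrow> 'a set set \<Rightarrow> bool" where
  "measurable_partition X A P \<longleftrightarrow> finite P \<and> P \<subseteq> sets X \<and> disjoint P \<and> \<Union>P = space X \<and>
     (\<forall>C\<in>P. C \<subseteq> A \<or> C \<inter> A = {})"

definition counts :: "ennreal set" where
  "counts = insert \<infinity> (range of_nat)"

lemma countable_counts: "countable counts"
  by (simp add: counts_def)

lemma emeasure_partition_sum:
  assumes "sets \<phi> = sets X" "finite P" "P \<subseteq> sets X" "disjoint P" "\<Union>P = space X"
    and "\<And>C. C \<in> P \<Longrightarrow> C \<subseteq> B \<or> C \<inter> B = {}" and B: "B \<subseteq> space X"
  shows "emeasure \<phi> B = (\<Sum>C | C \<in> P \<and> C \<subseteq> B. emeasure \<phi> C)"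
proof -
  let ?I = "{C. C \<in> P \<and> C \<subseteq> B}"
  have "B = (\<Union>C\<in>?I. C)"
  proof (intro equalityI subsetI)
    fix x assume "x \<in> B"
    then obtain C where "C \<in> P" "x \<in> C" using B assms(5) by blast
    with assms(6)[of C] \<open>x \<in> B\<close> show "x \<in> (\<Union>C\<in>?I. C)" by blast
  qed auto
  moreover have "(\<Sum>C\<in>?I. emeasure \<phi> C) = emeasure \<phi> (\<Union>C\<in>?I. C)"
    by (rule sum_emeasure)
       (use assms in \<open>auto simp: disjoint_family_on_def disjoint_def\<close>)
  ultimately show ?thesis by simp
qed

text \<open>
  The masses of a configuration on finitely many sets are sums of its masses on the atoms that
  these sets generate, and the latter take only countably many values.
\<close>

lemma config_space_induct [consumes 2, case_names basic empty compl union]: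
  assumes A: "A \<in> sets X" and S: "S \<in> sets (config_space X)"
    and basic: "\<And>P k. measurable_partition X A P \<Longrightarrow> (\<And>C. C \<in> P \<Longrightarrow> k C \<in> counts) \<Longrightarrow> Q (partition_event X P k)"
    and empty: "Q {}"
    and compl: "\<And>S. S \<in> sets (config_space X) \<Longrightarrow> Q S \<Longrightarrow> Q (config_set X) \<Longrightarrow> Q (config_set X - S)"
    and union: "\<And>S. disjoint_family S \<Longrightarrow> range S \<subseteq> sets (config_space X) \<Longrightarrow> (\<And>i. Q (S i)) \<Longrightarrow> Q (\<Union>i::nat. S i)"
  shows "Q S"
proof -
  define ev where "ev \<B> R = {\<phi> \<in> config_set X. \<forall>B\<in>\<B>. emeasure \<phi> B \<in> R B}"
    for \<B> and R :: "'a set \<Rightarrow> ennreal set"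
  define G where "G = {ev \<B> R | \<B> R. finite \<B> \<and> \<B> \<subseteq> sets X \<and> (\<forall>B. R B \<in> sets borel)}"
  have G_Pow: "G \<subseteq> Pow (config_set X)" by (auto simp: G_def ev_def)
  have ev_sets: "ev \<B> R \<in> sets (config_space X)"
    if "finite \<B>" "\<B> \<subseteq> sets X" "\<forall>B. R B \<in> sets borel" for \<B> R
  proof -
    have "{\<phi> \<in> space (config_space X). \<forall>B\<in>\<B>. emeasure \<phi> B \<in> R B} \<in> sets (config_space X)"
      using that
      by (intro sets.sets_Collect_finite_All) (auto intro!: measurable_sets_Collect[OF measurable_emeasure_config_space])
    then show ?thesis by (simp add: ev_def space_config_space)
  qed
  have Int: "Int_stable G"
  proof (rule Int_stableI)
    fix a b assume "a \<in> G" "b \<in> G"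
    then obtain \<B> R \<B>' R' where ab: "a = ev \<B> R" "b = ev \<B>' R'"
      and f: "finite \<B>" "\<B> \<subseteq> sets X" "\<forall>B. R B \<in> sets borel" "finite \<B>'" "\<B>' \<subseteq> sets X" "\<forall>B. R' B \<in> sets borel"
      by (auto simp: G_def)
    define R'' where "R'' B = (if B \<in> \<B> then R B else UNIV) \<inter> (if B \<in> \<B>' then R' B else UNIV)" for B
    have "a \<inter> b = ev (\<B> \<union> \<B>') R''"
      unfolding ab ev_def R''_def by auto
    moreover have "\<forall>B. R'' B \<in> sets borel" using f by (auto simp: R''_def)
    ultimately show "a \<inter> b \<in> G" using f unfolding G_def by blast
  qed
  have eq: "sets (config_space X) = sigma_sets (config_set X) G"
  proof
    have "(\<lambda>\<phi>. \<phi>) \<in> measurable (sigma (config_set X) G) (config_space X)"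
    proof (rule measurable_config_spaceI)
      fix \<phi> assume "\<phi> \<in> space (sigma (config_set X) G)"
      then show "\<phi> \<in> config_set X" using G_Pow by (simp add: space_measure_of)
    next
      fix B assume B: "B \<in> sets X"
      show "(\<lambda>\<phi>. emeasure \<phi> B) \<in> borel_measurable (sigma (config_set X) G)"
      proof (rule measurableI)
        fix R :: "ennreal set" assume "R \<in> sets borel"
        then have "ev {B} (\<lambda>_. R) \<in> G" using B unfolding G_def by blast
        moreover have "(\<lambda>\<phi>. emeasure \<phi> B) -` R \<inter> space (sigma (config_set X) G) = ev {B} (\<lambda>_. R)"
          using G_Pow by (auto simp: ev_def space_measure_of)
        ultimately show "(\<lambda>\<phi>. emeasure \<phi> B) -` R \<inter> space (sigma (config_set X) G) \<in> sets (sigma (config_set X) G)"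
          using G_Pow by (simp add: in_measure_of)
      qed simp
    qed
    from measurable_sets[OF this] show "sets (config_space X) \<subseteq> sigma_sets (config_set X) G"
      using G_Pow sets.sets_into_space[of _ "config_space X"]
      by (fastforce simp: space_measure_of space_config_space Int_absorb2)
    show "sigma_sets (config_set X) G \<subseteq> sets (config_space X)"
      using ev_sets sets.sigma_sets_subset[of G "config_space X"]
      by (auto simp: G_def space_config_space)
  qed
  have Qev: "Q (ev \<B> R)" if f: "finite \<B>" "\<B> \<subseteq> sets X" "\<forall>B. R B \<in> sets borel" for \<B> R
  proof -
    \<comment> \<open>An atom fixes membership in each of the finitely many sets. \<open>A\<close>
      is included among them, so that every atom respects \<open>A\<close>.\<close>
    define atm where "atm J = {x \<in> space X. \<forall>B\<in>insert A \<B>. x \<in> B \<longleftrightarrow> B \<in> J}" for J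
    define P where "P = atm ` Pow (insert A \<B>)"
    have atm_sets: "atm J \<in> sets X" for J
    proof -
      have "{x \<in> space X. x \<in> B \<longleftrightarrow> B \<in> J} \<in> sets X" if "B \<in> insert A \<B>" for B
      proof -
        have [measurable]: "B \<in> sets X" using that A f by auto
        show ?thesis by measurable
      qed
      then show ?thesis
        unfolding atm_def using f(1) by (intro sets.sets_Collect_finite_All) auto
    qed
    have P: "finite P" "P \<subseteq> sets X" using f atm_sets by (auto simp: P_def)
    have disj: "disjoint P"
    proof (rule disjointI)
      fix C D assume "C \<in> P" "D \<in> P" "C \<noteq> D"
      then obtain I J where IJ: "C = atm I" "D = atm J" "I \<subseteq> insert A \<B>" "J \<subseteq> insert A \<B>" "I \<noteq> J"
        by (auto simp: P_def)
      then obtain B where "B \<in> insert A \<B>" "(B \<in> I) \<noteq> (B \<in> J)" by blast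
      then show "C \<inter> D = {}" unfolding IJ atm_def by blast
    qed
    have cover: "\<Union>P = space X"
    proof (intro equalityI subsetI)
      fix x assume "x \<in> space X"
      then have "x \<in> atm {B \<in> insert A \<B>. x \<in> B}" by (auto simp: atm_def)
      moreover have "atm {B \<in> insert A \<B>. x \<in> B} \<in> P" unfolding P_def by blast
      ultimately show "x \<in> \<Union>P" by blast
    qed (auto simp: P_def atm_def)
    have refine: "C \<subseteq> B \<or> C \<inter> B = {}" if "C \<in> P" "B \<in> insert A \<B>" for C B
      using that by (auto simp: P_def atm_def)
    have Bsub: "B \<subseteq> space X" if "B \<in> \<B>" for B
      using that f(2) sets.sets_into_space by blast
    have mp: "measurable_partition X A P"
      using P disj cover refine by (auto simp: measurable_partition_def)
    \<comment> \<open>The assignments of masses to atoms that are compatible with the event. They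
      are countably many since \<open>counts\<close> is countable and \<open>P\<close> finite; being
      extensional, two different assignments differ on some atom and give disjoint events.\<close>
    define K where "K = {k \<in> P \<rightarrow>\<^sub>E counts. \<forall>B\<in>\<B>. (\<Sum>C | C \<in> P \<and> C \<subseteq> B. k C) \<in> R B}"
    have "countable (P \<rightarrow>\<^sub>E counts)"
      by (intro countable_PiE P countable_counts)
    then have cK: "countable K" unfolding K_def by (rule countable_subset[rotated]) auto
    have ev: "ev \<B> R = (\<Union>k\<in>K. partition_event X P k)"
    proof (intro equalityI subsetI)
      fix \<phi> assume \<phi>: "\<phi> \<in> ev \<B> R"
      then have cs: "\<phi> \<in> config_set X" by (simp add: ev_def)
      define k where "k = (\<lambda>C\<in>P. emeasure \<phi> C)"
      have "k \<in> K"
        unfolding K_def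
      proof (intro CollectI conjI ballI)
        show "k \<in> P \<rightarrow>\<^sub>E counts" using config_setD(3)[OF cs] P(2) by (auto simp: k_def counts_def)
        fix B assume B: "B \<in> \<B>"
        have "emeasure \<phi> B = (\<Sum>C | C \<in> P \<and> C \<subseteq> B. emeasure \<phi> C)"
          by (rule emeasure_partition_sum[OF config_setD(1)[OF cs] P disj cover])
             (use refine[of _ B] B Bsub[OF B] in auto)
        also have "\<dots> = (\<Sum>C | C \<in> P \<and> C \<subseteq> B. k C)" by (rule sum.cong) (auto simp: k_def)
        finally show "(\<Sum>C | C \<in> P \<and> C \<subseteq> B. k C) \<in> R B" using \<phi> B by (auto simp: ev_def)
      qed
      moreover have "\<phi> \<in> partition_event X P k" using cs by (auto simp: partition_event_def k_def)
      ultimately show "\<phi> \<in> (\<Union>k\<in>K. partition_event X P k)" by blast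
    next
      fix \<phi> assume "\<phi> \<in> (\<Union>k\<in>K. partition_event X P k)"
      then obtain k where k: "k \<in> K" and cs: "\<phi> \<in> config_set X" and e: "\<And>C. C \<in> P \<Longrightarrow> emeasure \<phi> C = k C"
        by (auto simp: partition_event_def)
      have "emeasure \<phi> B \<in> R B" if B: "B \<in> \<B>" for B
      proof -
        have "emeasure \<phi> B = (\<Sum>C | C \<in> P \<and> C \<subseteq> B. emeasure \<phi> C)"
          by (rule emeasure_partition_sum[OF config_setD(1)[OF cs] P disj cover])
             (use refine[of _ B] B Bsub[OF B] in auto)
        also have "\<dots> = (\<Sum>C | C \<in> P \<and> C \<subseteq> B. k C)" by (rule sum.cong) (auto simp: e)
        finally show ?thesis using k B by (auto simp: K_def)
      qed
      then show "\<phi> \<in> ev \<B> R" using cs by (simp add: ev_def)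
    qed
    define S' where "S' i = (if i \<in> to_nat_on K ` K then partition_event X P (from_nat_into K i) else {})" for i
    have S'_eq: "S' (to_nat_on K k) = partition_event X P k" if "k \<in> K" for k
      using that cK by (simp add: S'_def)
    have un: "(\<Union>i. S' i) = ev \<B> R"
      unfolding ev using S'_eq cK by (auto simp: S'_def split: if_splits)
    have Kc: "k C \<in> counts" if "k \<in> K" "C \<in> P" for k C using that by (auto simp: K_def)
    have "Q (\<Union>i. S' i)"
    proof (rule union)
      show "disjoint_family S'"
        unfolding disjoint_family_on_def
      proof (intro ballI impI)
        fix i j :: nat assume "i \<noteq> j"
        show "S' i \<inter> S' j = {}"
        proof (rule ccontr)
          assume "S' i \<inter> S' j \<noteq> {}"
          then obtain \<phi> where \<phi>: "\<phi> \<in> S' i" "\<phi> \<in> S' j" by blast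
          then obtain k l where kl: "k \<in> K" "i = to_nat_on K k" "l \<in> K" "j = to_nat_on K l"
            by (auto simp: S'_def split: if_splits)
          then have "\<phi> \<in> partition_event X P k" "\<phi> \<in> partition_event X P l" using \<phi> S'_eq by auto
          then have "\<And>C. C \<in> P \<Longrightarrow> k C = l C" by (auto simp: partition_event_def)
          then have "k = l" using kl(1,3) by (intro PiE_ext[of k P _ l]) (auto simp: K_def)
          then show False using kl \<open>i \<noteq> j\<close> by simp
        qed
      qed
      have pe: "partition_event X P k = ev P (\<lambda>C. {k C})" for k
        by (auto simp: partition_event_def ev_def)
      show "range S' \<subseteq> sets (config_space X)"
        using ev_sets[OF P] by (auto simp: S'_def pe)
      fix i show "Q (S' i)"
        using empty basic[OF mp Kc] cK by (auto simp: S'_def)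
    qed
    then show ?thesis using un by simp
  qed
  have "ev {} (\<lambda>_. UNIV) = config_set X" by (simp add: ev_def)
  then have Qtop: "Q (config_set X)" using Qev[of "{}" "\<lambda>_. UNIV"] by simp
  show ?thesis
    using Int G_Pow S[unfolded eq]
  proof (induction rule: sigma_sets_induct_disjoint)
    case (basic S)
    then show ?case using Qev by (auto simp: G_def)
  next
    case (compl S)
    then show ?case using assms(5) Qtop by (simp add: eq)
  next
    case (union S)
    then show ?case using assms(6) by (simp add: eq)
  qed (rule empty)
qed

text \<open>Partition events determine a finite measure. Finiteness enters at complements, where
  masses are subtracted.\<close>

lemma config_measure_eqI:
  assumes sets: "sets M = sets (config_space X)" "sets N = sets (config_space X)"
    and A: "A \<in> sets X" and fin: "emeasure N (config_set X) < \<infinity>"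
    and eq: "\<And>P k. measurable_partition X A P \<Longrightarrow> (\<And>C. C \<in> P \<Longrightarrow> k C \<in> counts) \<Longrightarrow>
      emeasure M (partition_event X P k) = emeasure N (partition_event X P k)"
  shows "M = N"
proof (rule measure_eqI)
  show "sets M = sets N" using sets by simp
  have sp: "space M = config_set X" "space N = config_set X"
    using sets sets_eq_imp_space_eq space_config_space by metis+
  fix S assume "S \<in> sets M"
  then have "S \<in> sets (config_space X)" using sets by simp
  with A show "emeasure M S = emeasure N S"
  proof (induction rule: config_space_induct)
    case (compl S)
    have "emeasure N S \<le> emeasure N (config_set X)"
      unfolding sp(2)[symmetric] by (rule emeasure_space)
    then have "emeasure N S \<noteq> \<infinity>" using fin by auto
    then show ?case
      using compl emeasure_compl[of S M] emeasure_compl[of S N] sets by (simp add: sp)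
  next
    case (union S)
    then show ?case
      using suminf_emeasure[of S M] suminf_emeasure[of S N] sets by simp
  qed (use eq in auto)
qed

lemma partition_event_sets:
  assumes "finite P" "P \<subseteq> sets X"
  shows "partition_event X P k \<in> sets (config_space X)"
proof -
  have "{\<phi> \<in> space (config_space X). \<forall>C\<in>P. emeasure \<phi> C = k C} \<in> sets (config_space X)"
  proof (rule sets.sets_Collect_finite_All[OF _ assms(1)])
    fix C assume "C \<in> P"
    then have [measurable]: "C \<in> sets X" using assms by auto
    show "{\<phi> \<in> space (config_space X). emeasure \<phi> C = k C} \<in> sets (config_space X)" by measurable
  qed
  then show ?thesis by (simp add: partition_event_def space_config_space)
qed

section \<open>Poisson laws on partition events\<close>

lemma sets_poisson_dist [simp]: "sets (poisson_dist c) = sets borel"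
  by (simp add: poisson_dist_def)

lemma poisson_dist_nat:
  assumes "0 \<le> c"
  shows "emeasure (poisson_dist (ennreal c)) {of_nat k} = ennreal (c ^ k / fact k * exp (- c))"
proof (cases "c = 0")
  case True
  then show ?thesis by (cases k) (auto simp: poisson_dist_def)
next
  case False
  then have c: "0 < c" using assms by simp
  have "(of_nat :: nat \<Rightarrow> ennreal) -` {of_nat k} = {k}" by auto
  then have "emeasure (poisson_dist (ennreal c)) {of_nat k} = emeasure (measure_pmf (poisson_pmf c)) {k}"
    using c by (simp add: poisson_dist_def emeasure_distr ennreal_eq_0_iff)
  also have "\<dots> = ennreal (c ^ k / fact k * exp (- c))"
    using c by (simp add: emeasure_pmf_single)
  finally show ?thesis .
qed

lemma poisson_dist_infinity:
  assumes "0 \<le> c"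
  shows "emeasure (poisson_dist (ennreal c)) {\<infinity>} = 0"
proof (cases "c = 0")
  case False
  then have c: "0 < c" using assms by simp
  have "(of_nat :: nat \<Rightarrow> ennreal) -` {\<infinity>} = {}" by auto
  then show ?thesis
    using c by (simp add: poisson_dist_def emeasure_distr ennreal_eq_0_iff)
qed (auto simp: poisson_dist_def)

lemma emeasure_poisson_partition:
  assumes law: "is_poisson_law X lam Q" and P: "measurable_partition X A P"
  shows "emeasure Q (partition_event X P k) = (\<Prod>C\<in>P. emeasure (poisson_dist (emeasure lam C)) {k C})"
proof -
  interpret prob_space Q using law by (simp add: is_poisson_law_def)
  have sQ: "sets Q = sets (config_space X)" using law by (simp add: is_poisson_law_def)
  have spQ: "space Q = config_set X" using sets_eq_imp_space_eq[OF sQ] space_config_space by metis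
  have P': "finite P" "P \<subseteq> sets X" "disjoint P" using P by (auto simp: measurable_partition_def)
  define n where "n = card P"
  obtain B where B: "bij_betw B {1..n} P"
    using ex_bij_betw_nat_finite_1[OF P'(1)] unfolding n_def by blast
  have BX: "\<forall>i\<in>{1..n}. B i \<in> sets X" using bij_betwE[OF B] P'(2) by blast
  have dB: "disjoint_family_on B {1..n}"
    unfolding disjoint_family_on_def
  proof (intro ballI impI)
    fix i j assume "i \<in> {1..n}" "j \<in> {1..n}" "i \<noteq> j"
    then have "B i \<in> P" "B j \<in> P" "B i \<noteq> B j"
      using bij_betwE[OF B] inj_onD[OF bij_betw_imp_inj_on[OF B]] by blast+
    then show "B i \<inter> B j = {}" using P'(3) by (auto simp: disjoint_def)
  qed
  have ind: "indep_vars (\<lambda>_. borel) (\<lambda>i \<phi>. emeasure \<phi> (B i)) {1..n}"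
    using law BX dB by (simp add: is_poisson_law_def)
  have meas: "(\<lambda>\<phi>. emeasure \<phi> C) \<in> borel_measurable Q" if "C \<in> sets X" for C
    by (subst measurable_cong_sets[OF sQ refl]) (rule measurable_emeasure_config_space[OF that])
  have one: "emeasure Q ((\<lambda>\<phi>. emeasure \<phi> C) -` {k C} \<inter> space Q) = emeasure (poisson_dist (emeasure lam C)) {k C}"
    if "C \<in> sets X" for C
  proof -
    have "distr Q borel (\<lambda>\<phi>. emeasure \<phi> C) = poisson_dist (emeasure lam C)"
      using law that by (simp add: is_poisson_law_def)
    then show ?thesis using emeasure_distr[OF meas[OF that], of "{k C}"] by simp
  qed
  show ?thesis
  \<comment> \<open>The empty partition occurs when the space is empty: the event is then certain
    and the product empty. The product rule for independent variables needs a nonempty index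
    set.\<close>
  proof (cases "P = {}")
    case True
    then show ?thesis using emeasure_space_1 by (simp add: partition_event_def spQ)
  next
    case False
    then have ne: "{1..n} \<noteq> {}" using B by (auto simp: bij_betw_def)
    have "partition_event X P k = (\<Inter>i\<in>{1..n}. (\<lambda>\<phi>. emeasure \<phi> (B i)) -` {k (B i)} \<inter> space Q)"
    proof -
      have PB: "P = B ` {1..n}" using B by (simp add: bij_betw_def)
      show ?thesis unfolding partition_event_def spQ by (subst PB) (use ne in auto)
    qed
    then have "prob (partition_event X P k) = (\<Prod>i\<in>{1..n}. prob ((\<lambda>\<phi>. emeasure \<phi> (B i)) -` {k (B i)} \<inter> space Q))"
      using indep_varsD_finite[OF ind ne, of "\<lambda>i. {k (B i)}"] by simp
    then have "emeasure Q (partition_event X P k)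
        = (\<Prod>i\<in>{1..n}. emeasure Q ((\<lambda>\<phi>. emeasure \<phi> (B i)) -` {k (B i)} \<inter> space Q))"
      by (simp add: emeasure_eq_measure prod_ennreal)
    also have "\<dots> = (\<Prod>i\<in>{1..n}. emeasure (poisson_dist (emeasure lam (B i))) {k (B i)})"
      using BX by (intro prod.cong refl one) auto
    also have "\<dots> = (\<Prod>C\<in>P. emeasure (poisson_dist (emeasure lam C)) {k C})"
      by (rule prod.reindex_bij_betw[OF B])
    finally show ?thesis .
  qed
qed

section \<open>Adding points and the Mecke equation\<close>

text \<open>The list form of \<open>add_points\<close>. List entries are indexed from 0, whereas the
  coordinates of tuples start at 1.\<close>

definition addl :: "'a measure \<Rightarrow> 'a list \<Rightarrow> 'a measure" where
  "addl \<phi> xs = add_points \<phi> {..<length xs} (\<lambda>j. xs ! j)"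

lemma sets_addl [simp]: "sets (addl \<phi> xs) = sets \<phi>"
  by (simp add: addl_def)

lemma emeasure_addl:
  "B \<in> sets \<phi> \<Longrightarrow> emeasure (addl \<phi> xs) B = emeasure \<phi> B + sum_list (map (indicator B) xs)"
  by (simp add: addl_def emeasure_add_points sum_list_sum_nth atLeast0LessThan)

lemma sum_list_indicator: "sum_list (map (indicator B) xs) = (of_nat (length (filter (\<lambda>x. x \<in> B) xs)) :: ennreal)"
  by (induction xs) (auto simp: ac_simps)

lemma addl_Nil [simp]: "addl \<phi> [] = \<phi>"
  by (rule measure_eqI) (auto simp: emeasure_addl)

lemma addl_append: "addl (addl \<phi> xs) ys = addl \<phi> (xs @ ys)"
  by (rule measure_eqI) (auto simp: emeasure_addl add.assoc)

lemma addl_perm: "mset xs = mset ys \<Longrightarrow> addl \<phi> xs = addl \<phi> ys"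
proof (rule measure_eqI)
  fix B assume m: "mset xs = mset ys" and B: "B \<in> sets (addl \<phi> xs)"
  have "sum_list (map (indicator B) xs) = (sum_list (map (indicator B) ys) :: ennreal)"
    using m by (metis mset_map sum_mset_sum_list)
  then show "emeasure (addl \<phi> xs) B = emeasure (addl \<phi> ys) B"
    using B by (simp add: emeasure_addl)
qed simp

lemma addl_config_set:
  assumes "\<phi> \<in> config_set X"
  shows "addl \<phi> xs \<in> config_set X"
proof -
  note \<phi> = config_setD[OF assms]
  interpret sigma_finite_measure \<phi> by (rule \<phi>)
  obtain A :: "nat \<Rightarrow> 'a set" where A: "range A \<subseteq> sets \<phi>" "(\<Union>i. A i) = space \<phi>" "\<And>i. emeasure \<phi> (A i) \<noteq> \<infinity>"
    using sigma_finite by blast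
  have sp: "space (addl \<phi> xs) = space \<phi>" by (rule sets_eq_imp_space_eq) simp
  have "emeasure (addl \<phi> xs) (A i) \<noteq> \<infinity>" for i
    using A(1,3) by (auto simp: emeasure_addl sum_list_indicator range_subsetD)
  then have "sigma_finite_measure (addl \<phi> xs)"
    using A(1,2) by (intro sigma_finite_measure.intro exI[of _ "range A"]) (auto simp: sp)
  moreover have "emeasure (addl \<phi> xs) B \<in> insert \<infinity> (range of_nat)" if "B \<in> sets X" for B
  proof -
    have "emeasure (addl \<phi> xs) B = emeasure \<phi> B + of_nat (length (filter (\<lambda>x. x \<in> B) xs))"
      using that \<phi>(1) by (simp add: emeasure_addl sum_list_indicator)
    with \<phi>(3)[OF that] show ?thesis by (auto simp flip: of_nat_add)
  qed
  ultimately show ?thesis using \<phi>(1) by (simp add: config_set_def)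
qed

lemma measurable_addl [measurable (raw)]:
  assumes f: "f \<in> measurable W (config_space X)" and g [measurable]: "g \<in> measurable W (list_space X)"
  shows "(\<lambda>w. addl (f w) (g w)) \<in> measurable W (config_space X)"
proof (rule measurable_config_spaceI)
  fix w assume "w \<in> space W"
  then show "addl (f w) (g w) \<in> config_set X"
    using measurable_space[OF f] by (auto simp: space_config_space intro: addl_config_set)
next
  fix B assume B [measurable]: "B \<in> sets X"
  note f [measurable]
  have "(\<lambda>w. emeasure (f w) B + sum_list (map (indicator B) (g w))) \<in> borel_measurable W"
    by measurable
  moreover have "emeasure (addl (f w) (g w)) B = emeasure (f w) B + sum_list (map (indicator B) (g w))"
    if "w \<in> space W" for w
  proof -
    have "f w \<in> config_set X" using measurable_space[OF f that] by (simp add: space_config_space)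
    from config_setD(1)[OF this] show ?thesis using B by (simp add: emeasure_addl)
  qed
  ultimately show "(\<lambda>w. emeasure (addl (f w) (g w)) B) \<in> borel_measurable W"
    by (simp cong: measurable_cong)
qed

lemma poisson_law_space:
  assumes "is_poisson_law X lam Q"
  shows "prob_space Q" "sets Q = sets (config_space X)" "space Q = config_set X"
  using assms sets_eq_imp_space_eq[of Q "config_space X"]
  by (auto simp: is_poisson_law_def space_config_space)

lemma partition_event_addl:
  assumes P: "measurable_partition X A P" and C: "C \<in> P" "x \<in> C" and \<phi>: "\<phi> \<in> config_set X"
  shows "addl \<phi> [x] \<in> partition_event X P k \<longleftrightarrow>
    emeasure \<phi> C + 1 = k C \<and> (\<forall>D\<in>P - {C}. emeasure \<phi> D = k D)"
proof -
  have s: "P \<subseteq> sets \<phi>" using P config_setD(1)[OF \<phi>] by (auto simp: measurable_partition_def)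
  have *: "x \<in> D \<longleftrightarrow> D = C" if "D \<in> P" for D
    using P C that by (auto simp: measurable_partition_def disjoint_def)
  have "emeasure (addl \<phi> [x]) D = (if D = C then emeasure \<phi> C + 1 else emeasure \<phi> D)" if "D \<in> P" for D
    using *[OF that] subsetD[OF s that] by (cases "D = C") (simp_all add: emeasure_addl)
  then show ?thesis
    using C(1) addl_config_set[OF \<phi>] by (auto simp: partition_event_def split: if_splits)
qed

lemma counts_cases:
  assumes "k \<in> counts"
  obtains "k = \<infinity>" | "k = 0" | n where "k = of_nat (Suc n)"
proof -
  have "k = \<infinity> \<or> (\<exists>m. k = of_nat m)" using assms by (auto simp: counts_def)
  then show thesis using that by (metis of_nat_0 not0_implies_Suc)
qed

text \<open>The Poisson recursion \<open>k p(k) = c p(k - 1)\<close>. Using the set of predecessors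
  of \<open>k\<close> covers \<open>k = 0\<close>, where the set is empty, and
  \<open>k = \<infinity>\<close>, where both sides vanish because a finite parameter gives no mass
  to \<open>\<infinity>\<close>.\<close>

lemma poisson_dist_Suc:
  assumes c: "c < \<infinity>" and k: "k \<in> counts"
  shows "k * emeasure (poisson_dist c) {k} = c * emeasure (poisson_dist c) {j. j \<in> counts \<and> j + 1 = k}"
proof -
  obtain c' where c': "c = ennreal c'" "0 \<le> c'" using c by (cases c) auto
  from k show ?thesis
  proof (cases rule: counts_cases)
    case 1
    have "{j. j \<in> counts \<and> j + 1 = k} = {\<infinity>}"
      using 1 by (auto simp: counts_def)
    then show ?thesis using 1 poisson_dist_infinity[OF c'(2)] c'(1) by simp
  next
    case 2
    then show ?thesis by simp
  next
    case (3 n)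
    have "j + 1 = k \<longleftrightarrow> j = of_nat n" if "j \<in> counts" for j
      using 3 ennreal_add_left_cancel[of 1 j "of_nat n"] by (simp add: add.commute)
    then have e: "{j. j \<in> counts \<and> j + 1 = k} = {of_nat n}"
      by (auto simp: counts_def)
    have "real (Suc n) * (c' ^ Suc n / fact (Suc n) * exp (- c')) = c' * (c' ^ n / fact n * exp (- c'))"
      by (simp add: field_simps del: of_nat_Suc)
    then have "ennreal (real (Suc n)) * ennreal (c' ^ Suc n / fact (Suc n) * exp (- c'))
        = ennreal c' * ennreal (c' ^ n / fact n * exp (- c'))"
      using c'(2) by (simp only: ennreal_mult'[symmetric] of_nat_0_le_iff)
    then show ?thesis
      unfolding e[unfolded 3] 3 c'(1) poisson_dist_nat[OF c'(2)] by (simp only: ennreal_of_nat_eq_real_of_nat)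
  qed
qed

locale poisson_law = sigma_finite_measure lam for lam :: "'a measure" +
  fixes X :: "'a measure" and Q :: "'a measure measure"
  assumes sets_lam [measurable_cong, simp]: "sets lam = sets X"
    and law: "is_poisson_law X lam Q"

sublocale poisson_law \<subseteq> Q: prob_space Q
  by (rule poisson_law_space(1)[OF law])

context poisson_law
begin

lemmas sets_Q [measurable_cong, simp] = poisson_law_space(2)[OF law]
lemmas space_Q = poisson_law_space(3)[OF law]

lemma list_space_lam: "list_space lam = list_space X"
  by (simp add: list_space_def sets_eq_imp_space_eq[OF sets_lam])

text \<open>A point added in the block \<open>C\<close> raises the mass of that block only. The
  event is again a partition event with the value at \<open>C\<close> lowered by one, or is
  impossible when \<open>k C = 0\<close>.\<close>

lemma emeasure_Q_shifted_event:
  assumes P: "measurable_partition X A P" and C: "C \<in> P" "x \<in> C" and k: "\<And>C. C \<in> P \<Longrightarrow> k C \<in> counts"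
  shows "emeasure Q {\<phi> \<in> space Q. addl \<phi> [x] \<in> partition_event X P k}
    = emeasure (poisson_dist (emeasure lam C)) {j. j \<in> counts \<and> j + 1 = k C} *
      (\<Prod>D\<in>P - {C}. emeasure (poisson_dist (emeasure lam D)) {k D})"
proof (cases "k C = 0")
  case True
  have "emeasure \<phi> C + 1 \<noteq> k C" for \<phi> :: "'a measure" using True by simp
  then have "{\<phi> \<in> space Q. addl \<phi> [x] \<in> partition_event X P k} = {}"
    using partition_event_addl[OF P C] by (auto simp: space_Q)
  moreover have "{j. j \<in> counts \<and> j + 1 = k C} = {}" using True by auto
  ultimately show ?thesis by (simp only: emeasure_empty mult_zero_left)
next
  case False
  obtain j where j: "j \<in> counts" "k C = j + 1"
  proof (cases rule: counts_cases[OF k[OF C(1)]])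
    case 1
    then show ?thesis using that[of \<infinity>] by (simp add: counts_def)
  next
    case (3 n)
    then show ?thesis using that[of "of_nat n"] by (simp add: counts_def add.commute)
  qed (use False in simp)
  have u: "i + 1 = k C \<longleftrightarrow> i = j" for i
    using j(2) ennreal_add_left_cancel[of 1 i j] by (simp add: add.commute)
  have e: "{\<phi> \<in> space Q. addl \<phi> [x] \<in> partition_event X P k} = partition_event X P (k(C := j))"
  proof -
    have 1: "\<phi> \<in> partition_event X P (k(C := j)) \<longleftrightarrow>
        \<phi> \<in> config_set X \<and> emeasure \<phi> C = j \<and> (\<forall>D\<in>P - {C}. emeasure \<phi> D = k D)" for \<phi>
      using C(1) unfolding partition_event_def by auto
    show ?thesis
    proof (rule set_eqI)
      fix \<phi>
      show "\<phi> \<in> {\<phi> \<in> space Q. addl \<phi> [x] \<in> partition_event X P k} \<longleftrightarrow> \<phi> \<in> partition_event X P (k(C := j))"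
        using partition_event_addl[OF P C, of \<phi> k] u[of "emeasure \<phi> C"] unfolding 1 space_Q by blast
    qed
  qed
  have "{i. i \<in> counts \<and> i + 1 = k C} = {j}" using u j by auto
  moreover have "(\<Prod>D\<in>P. emeasure (poisson_dist (emeasure lam D)) {(k(C := j)) D})
      = emeasure (poisson_dist (emeasure lam C)) {j} * (\<Prod>D\<in>P - {C}. emeasure (poisson_dist (emeasure lam D)) {k D})"
    using P C by (subst prod.remove[of P C]) (auto simp: measurable_partition_def)
  ultimately show ?thesis unfolding e emeasure_poisson_partition[OF law P] by simp
qed

text \<open>On a partition event the mass of \<open>A\<close> is the sum of the prescribed
  \<open>k C\<close> over the blocks inside \<open>A\<close>. For each block the Poisson recursion
  exchanges \<open>k C\<close> for the intensity of \<open>C\<close> and lowers the count by one,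
  which is exactly the effect of a point added in \<open>C\<close>.\<close>

lemma mecke_measure:
  assumes A [measurable]: "A \<in> sets X" and fin: "emeasure lam A < \<infinity>"
  shows "density Q (\<lambda>\<phi>. emeasure \<phi> A)
    = distr (density lam (indicator A) \<Otimes>\<^sub>M Q) (config_space X) (\<lambda>(x, \<phi>). addl \<phi> [x])" (is "?M = ?N")
proof (rule config_measure_eqI[OF _ _ A])
  have [measurable]: "(\<lambda>(x, \<phi>). addl \<phi> [x]) \<in> measurable (density lam (indicator A) \<Otimes>\<^sub>M Q) (config_space X)"
    by measurable
  have N: "emeasure ?N S = (\<integral>\<^sup>+x. indicator A x * emeasure Q {\<phi> \<in> space Q. addl \<phi> [x] \<in> S} \<partial>lam)"
    if S [measurable]: "S \<in> sets (config_space X)" for S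
  proof -
    have "emeasure ?N S = (\<integral>\<^sup>+\<phi>. indicator S \<phi> \<partial>?N)" by simp
    also have "\<dots> = (\<integral>\<^sup>+p. indicator S (case p of (x, \<phi>) \<Rightarrow> addl \<phi> [x]) \<partial>(density lam (indicator A) \<Otimes>\<^sub>M Q))"
      by (rule nn_integral_distr) simp_all
    also have "\<dots> = (\<integral>\<^sup>+x. \<integral>\<^sup>+\<phi>. indicator S (addl \<phi> [x]) \<partial>Q \<partial>density lam (indicator A))"
      by (subst Q.nn_integral_fst[symmetric]) simp_all
    also have "\<dots> = (\<integral>\<^sup>+x. indicator A x * (\<integral>\<^sup>+\<phi>. indicator S (addl \<phi> [x]) \<partial>Q) \<partial>lam)"
      by (subst nn_integral_density) simp_all
    also have "\<dots> = (\<integral>\<^sup>+x. indicator A x * emeasure Q {\<phi> \<in> space Q. addl \<phi> [x] \<in> S} \<partial>lam)"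
    proof (rule nn_integral_cong)
      fix x assume "x \<in> space lam"
      then have [measurable]: "x \<in> space X" using sets_eq_imp_space_eq[OF sets_lam] by simp
      have "(\<integral>\<^sup>+\<phi>. indicator S (addl \<phi> [x]) \<partial>Q) = (\<integral>\<^sup>+\<phi>. indicator {\<phi> \<in> space Q. addl \<phi> [x] \<in> S} \<phi> \<partial>Q)"
        by (rule nn_integral_cong) (simp add: indicator_def)
      also have "\<dots> = emeasure Q {\<phi> \<in> space Q. addl \<phi> [x] \<in> S}"
        by (rule nn_integral_indicator) measurable
      finally show "indicator A x * (\<integral>\<^sup>+\<phi>. indicator S (addl \<phi> [x]) \<partial>Q)
        = indicator A x * emeasure Q {\<phi> \<in> space Q. addl \<phi> [x] \<in> S}" by simp
    qed
    finally show ?thesis .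
  qed
  show "sets ?M = sets (config_space X)" "sets ?N = sets (config_space X)" by simp_all
  have "emeasure ?N (config_set X) \<le> (\<integral>\<^sup>+x. indicator A x * 1 \<partial>lam)"
    unfolding N[OF sets.top[of "config_space X", unfolded space_config_space]]
    by (intro nn_integral_mono mult_left_mono Q.emeasure_le_1) simp
  also have "\<dots> < \<infinity>" using fin by simp
  finally show "emeasure ?N (config_set X) < \<infinity>" .
  fix P k assume P: "measurable_partition X A P" and k: "\<And>C. C \<in> P \<Longrightarrow> k C \<in> counts"
  note P' = P[unfolded measurable_partition_def]
  let ?S = "partition_event X P k" and ?I = "{C. C \<in> P \<and> C \<subseteq> A}"
  let ?R = "\<lambda>C. \<Prod>D\<in>P - {C}. emeasure (poisson_dist (emeasure lam D)) {k D}"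
  let ?pc = "\<lambda>C. emeasure (poisson_dist (emeasure lam C)) {j. j \<in> counts \<and> j + 1 = k C}"
  have S [measurable]: "?S \<in> sets (config_space X)" using P' by (intro partition_event_sets) auto
  have Asub: "A \<subseteq> space X" using A by (rule sets.sets_into_space)
  have fI: "finite ?I" using P' by simp
  have finC: "emeasure lam C < \<infinity>" if "C \<in> ?I" for C
    using that fin emeasure_mono[of C A lam] P' by (auto intro: le_less_trans)
  have "emeasure ?M ?S = (\<integral>\<^sup>+\<phi>. (\<Sum>C\<in>?I. k C) * indicator ?S \<phi> \<partial>Q)"
  proof -
    have "emeasure ?M ?S = (\<integral>\<^sup>+\<phi>. emeasure \<phi> A * indicator ?S \<phi> \<partial>Q)"
      by (rule emeasure_density) simp_all
    also have "\<dots> = (\<integral>\<^sup>+\<phi>. (\<Sum>C\<in>?I. k C) * indicator ?S \<phi> \<partial>Q)"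
    proof (rule nn_integral_cong)
      fix \<phi> assume "\<phi> \<in> space Q"
      then have \<phi>: "\<phi> \<in> config_set X" by (simp add: space_Q)
      show "emeasure \<phi> A * indicator ?S \<phi> = (\<Sum>C\<in>?I. k C) * indicator ?S \<phi>"
      proof (cases "\<phi> \<in> ?S")
        case True
        then have "\<And>C. C \<in> P \<Longrightarrow> emeasure \<phi> C = k C" by (simp add: partition_event_def)
        then have "(\<Sum>C\<in>?I. emeasure \<phi> C) = (\<Sum>C\<in>?I. k C)" by (intro sum.cong) auto
        moreover have "emeasure \<phi> A = (\<Sum>C\<in>?I. emeasure \<phi> C)"
          by (rule emeasure_partition_sum[OF config_setD(1)[OF \<phi>]]) (use P' Asub in auto)
        ultimately show ?thesis by (simp only:)
      qed simp
    qed
    finally show ?thesis .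
  qed
  also have "\<dots> = (\<Sum>C\<in>?I. k C) * emeasure Q ?S" by (simp add: nn_integral_cmult_indicator)
  also have "\<dots> = (\<Sum>C\<in>?I. k C * (emeasure (poisson_dist (emeasure lam C)) {k C} * ?R C))"
    unfolding emeasure_poisson_partition[OF law P] sum_distrib_right
    by (intro sum.cong refl arg_cong[where f = "\<lambda>x. _ * x"] prod.remove) (use P' in auto)
  also have "\<dots> = (\<Sum>C\<in>?I. emeasure lam C * (?pc C * ?R C))"
    using poisson_dist_Suc[OF finC k] by (intro sum.cong refl) (simp flip: mult.assoc)
  also have "\<dots> = (\<Sum>C\<in>?I. \<integral>\<^sup>+x. (?pc C * ?R C) * indicator C x \<partial>lam)"
    using P' by (intro sum.cong refl) (subst nn_integral_cmult_indicator, auto simp: mult.commute)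
  also have "\<dots> = (\<integral>\<^sup>+x. (\<Sum>C\<in>?I. (?pc C * ?R C) * indicator C x) \<partial>lam)"
    using P' by (intro nn_integral_sum[symmetric]) auto
  also have "\<dots> = emeasure ?N ?S"
    unfolding N[OF S]
  proof (rule nn_integral_cong)
    fix x assume "x \<in> space lam"
    then have x: "x \<in> space X" using sets_eq_imp_space_eq[OF sets_lam] by simp
    then obtain C where C: "C \<in> P" "x \<in> C" using P' by blast
    have un: "D = C" if "D \<in> P" "x \<in> D" for D
      using P' that C by (auto simp: disjoint_def)
    show "(\<Sum>C\<in>?I. (?pc C * ?R C) * indicator C x)
      = indicator A x * emeasure Q {\<phi> \<in> space Q. addl \<phi> [x] \<in> ?S}"
    proof (cases "x \<in> A")
      case True
      then have "C \<in> ?I" using P' C by auto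
      then have "(\<Sum>D\<in>?I. (?pc D * ?R D) * indicator D x) = ?pc C * ?R C * indicator C x"
      proof -
        have "(\<Sum>D\<in>?I - {C}. (?pc D * ?R D) * indicator D x) = 0"
        proof (rule sum.neutral, rule ballI)
          fix D assume "D \<in> ?I - {C}"
          then have "x \<notin> D" using un by blast
          then show "(?pc D * ?R D) * indicator D x = 0" by simp
        qed
        then show ?thesis
          unfolding sum.remove[OF fI \<open>C \<in> ?I\<close>] by (simp only: add_0_right)
      qed
      also have "\<dots> = emeasure Q {\<phi> \<in> space Q. addl \<phi> [x] \<in> ?S}"
        using emeasure_Q_shifted_event[OF P C k] C by simp
      finally show ?thesis using True by simp
    next
      case False
      then show ?thesis by (auto intro!: sum.neutral simp: indicator_def)
    qed
  qed
  finally show "emeasure ?M ?S = emeasure ?N ?S" .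
qed

lemma mecke:
  assumes A [measurable]: "A \<in> sets X" and fin: "emeasure lam A < \<infinity>"
    and g [measurable]: "g \<in> borel_measurable (config_space X)"
  shows "(\<integral>\<^sup>+\<phi>. emeasure \<phi> A * g \<phi> \<partial>Q) = (\<integral>\<^sup>+x. \<integral>\<^sup>+\<phi>. g (addl \<phi> [x]) \<partial>Q \<partial>density lam (indicator A))"
proof -
  have "(\<integral>\<^sup>+\<phi>. emeasure \<phi> A * g \<phi> \<partial>Q) = (\<integral>\<^sup>+\<phi>. g \<phi> \<partial>density Q (\<lambda>\<phi>. emeasure \<phi> A))"
    by (subst nn_integral_density) simp_all
  also have "\<dots> = (\<integral>\<^sup>+p. g (case p of (x, \<phi>) \<Rightarrow> addl \<phi> [x]) \<partial>(density lam (indicator A) \<Otimes>\<^sub>M Q))"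
    unfolding mecke_measure[OF A fin] by (rule nn_integral_distr) simp_all
  also have "\<dots> = (\<integral>\<^sup>+x. \<integral>\<^sup>+\<phi>. g (addl \<phi> [x]) \<partial>Q \<partial>density lam (indicator A))"
    by (subst Q.nn_integral_fst[symmetric]) simp_all
  finally show ?thesis .
qed

section \<open>The process without points in a given set\<close>

lemma finite_measure_restriction:
  assumes [measurable]: "A \<in> sets X" and fin: "emeasure lam A < \<infinity>"
  shows "finite_measure (density lam (indicator A))"
proof (rule finite_measureI)
  have "emeasure (density lam (indicator A)) (space lam) = (\<integral>\<^sup>+x. indicator A x * indicator (space lam) x \<partial>lam)"
    by (rule emeasure_density[OF _ sets.top]) measurable
  also have "\<dots> = (\<integral>\<^sup>+x. indicator A x \<partial>lam)"
    by (rule nn_integral_cong) simp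
  finally show "emeasure (density lam (indicator A)) (space (density lam (indicator A))) \<noteq> \<infinity>"
    using fin by simp
qed

text \<open>Left unnormalised: the product with the Lebesgue-Poisson measure on \<open>A\<close>
  then maps to \<open>Q\<close> without any constant.\<close>

definition void :: "'a set \<Rightarrow> 'a measure measure" where
  "void A = density Q (\<lambda>\<phi>. indicator {0} (emeasure \<phi> A))"

lemma sets_void [measurable_cong, simp]: "sets (void A) = sets (config_space X)"
  by (simp add: void_def)

lemma nn_integral_void:
  assumes [measurable]: "A \<in> sets X" "g \<in> borel_measurable (config_space X)"
  shows "(\<integral>\<^sup>+\<phi>. g \<phi> \<partial>void A) = (\<integral>\<^sup>+\<phi>. indicator {0} (emeasure \<phi> A) * g \<phi> \<partial>Q)"
  unfolding void_def by (rule nn_integral_density) simp_all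

lemma finite_measure_void: "A \<in> sets X \<Longrightarrow> finite_measure (void A)"
proof (rule finite_measureI)
  assume A [measurable]: "A \<in> sets X"
  have "emeasure (void A) (space (void A)) = (\<integral>\<^sup>+\<phi>. indicator {0} (emeasure \<phi> A) * 1 \<partial>Q)"
    using nn_integral_void[OF A, of "\<lambda>_. 1"] by simp
  also have "\<dots> \<le> (\<integral>\<^sup>+\<phi>. 1 \<partial>Q)"
    by (rule nn_integral_mono) (simp add: indicator_def)
  also have "\<dots> < \<infinity>"
    using Q.emeasure_space_1 by simp
  finally show "emeasure (void A) (space (void A)) \<noteq> \<infinity>" by simp
qed

text \<open>On the event of exactly \<open>n\<close> points in \<open>A\<close>, the Mecke equation
  trades the factor \<open>emeasure \<phi> A\<close> for one point taken out of the configuration.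
  After \<open>n\<close> rounds \<open>A\<close> is empty and the counts have accumulated to
  \<open>1 / fact n\<close>.\<close>

lemma nn_integral_Q_count:
  assumes A [measurable]: "A \<in> sets X" and fin: "emeasure lam A < \<infinity>"
    and "g \<in> borel_measurable (config_space X)"
  shows "(\<integral>\<^sup>+\<phi>. indicator {of_nat n} (emeasure \<phi> A) * g \<phi> \<partial>Q)
    = ennreal (1 / fact n) * (\<integral>\<^sup>+xs. \<integral>\<^sup>+\<phi>. g (addl \<phi> xs) \<partial>void A \<partial>list_power (density lam (indicator A)) n)"
  using assms(3)
proof (induction n arbitrary: g)
  case 0
  note [measurable] = 0
  interpret mu: finite_measure "density lam (indicator A)" by (rule finite_measure_restriction[OF A fin])
  interpret V: finite_measure "void A" by (rule finite_measure_void[OF A])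
  have ls: "list_space (density lam (indicator A)) = list_space X"
    using list_space_lam by (simp add: list_space_def)
  show ?case
    by (subst mu.nn_integral_list_power_0) (simp_all add: ls nn_integral_void)
next
  case (Suc n)
  note [measurable] = Suc.prems
  interpret mu: finite_measure "density lam (indicator A)" by (rule finite_measure_restriction[OF A fin])
  interpret V: finite_measure "void A" by (rule finite_measure_void[OF A])
  interpret L: sigma_finite_measure "list_power (density lam (indicator A)) n"
    by (rule mu.sigma_finite_list_power)
  have ls [measurable_cong, simp]: "sets (list_power (density lam (indicator A)) m) = sets (list_space X)" for m
    using list_space_lam by (simp add: list_space_def)
  have ls': "list_space (density lam (indicator A)) = list_space X"
    using list_space_lam by (simp add: list_space_def)
  \<comment> \<open>Multiplying and dividing by \<open>Suc n\<close> supplies the factor that the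
    indicator turns into the mass of \<open>A\<close>, as the Mecke equation requires.\<close>
  have c: "c = ennreal (1 / real (Suc n)) * (of_nat (Suc n) * c)" for c
  proof -
    have "ennreal (1 / real (Suc n)) * of_nat (Suc n) = 1"
      by (simp add: ennreal_of_nat_eq_real_of_nat ennreal_mult'[symmetric] del: of_nat_Suc)
    then show ?thesis by (simp only: mult.assoc[symmetric] mult_1_left)
  qed
  have Aa: "emeasure (addl \<phi> [x]) A = emeasure \<phi> A + 1" if "\<phi> \<in> space Q" "x \<in> A" for \<phi> x
    using that(2) A config_setD(1)[of \<phi> X] that(1)[unfolded space_Q] by (simp add: emeasure_addl)
  have ind: "indicator {of_nat (Suc n)} (y + 1 :: ennreal) = (indicator {of_nat n} y :: ennreal)" for y
    by (cases y) (auto simp: indicator_def add.commute ennreal_of_nat_eq_real_of_nat simp flip: ennreal_plus ennreal_1)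
  have "of_nat (Suc n) * (\<integral>\<^sup>+\<phi>. indicator {of_nat (Suc n)} (emeasure \<phi> A) * g \<phi> \<partial>Q)
      = (\<integral>\<^sup>+\<phi>. of_nat (Suc n) * (indicator {of_nat (Suc n)} (emeasure \<phi> A) * g \<phi>) \<partial>Q)"
    by (rule nn_integral_cmult[symmetric]) measurable
  also have "\<dots> = (\<integral>\<^sup>+\<phi>. emeasure \<phi> A * (indicator {of_nat (Suc n)} (emeasure \<phi> A) * g \<phi>) \<partial>Q)"
    by (rule nn_integral_cong) (auto simp: indicator_def)
  also have "\<dots> = (\<integral>\<^sup>+x. \<integral>\<^sup>+\<phi>. indicator {of_nat (Suc n)} (emeasure (addl \<phi> [x]) A) * g (addl \<phi> [x]) \<partial>Q \<partial>density lam (indicator A))"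
    by (rule mecke[OF A fin]) measurable
  also have "\<dots> = (\<integral>\<^sup>+x. \<integral>\<^sup>+\<phi>. indicator {of_nat n} (emeasure \<phi> A) * g (addl \<phi> [x]) \<partial>Q \<partial>density lam (indicator A))"
  proof (rule nn_integral_cong_AE)
    have "AE x in density lam (indicator A). x \<in> A" by (subst AE_density) (auto simp: indicator_def)
    then show "AE x in density lam (indicator A).
        (\<integral>\<^sup>+\<phi>. indicator {of_nat (Suc n)} (emeasure (addl \<phi> [x]) A) * g (addl \<phi> [x]) \<partial>Q)
        = (\<integral>\<^sup>+\<phi>. indicator {of_nat n} (emeasure \<phi> A) * g (addl \<phi> [x]) \<partial>Q)"
      by eventually_elim (rule nn_integral_cong, simp only: Aa ind)
  qed
  also have "\<dots> = (\<integral>\<^sup>+x. ennreal (1 / fact n) * (\<integral>\<^sup>+xs. \<integral>\<^sup>+\<phi>. g (addl \<phi> (x # xs)) \<partial>void A \<partial>list_power (density lam (indicator A)) n) \<partial>density lam (indicator A))"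
  proof (rule nn_integral_cong)
    fix x assume "x \<in> space (density lam (indicator A))"
    then have [measurable]: "x \<in> space X" using sets_eq_imp_space_eq[OF sets_lam] by simp
    have "addl (addl \<phi> xs) [x] = addl \<phi> (x # xs)" for \<phi> :: "'a measure" and xs
      unfolding addl_append by (rule addl_perm) simp
    moreover have "(\<lambda>\<phi>. g (addl \<phi> [x])) \<in> borel_measurable (config_space X)" by measurable
    ultimately show "(\<integral>\<^sup>+\<phi>. indicator {of_nat n} (emeasure \<phi> A) * g (addl \<phi> [x]) \<partial>Q)
        = ennreal (1 / fact n) * (\<integral>\<^sup>+xs. \<integral>\<^sup>+\<phi>. g (addl \<phi> (x # xs)) \<partial>void A \<partial>list_power (density lam (indicator A)) n)"
      using Suc.IH[of "\<lambda>\<phi>. g (addl \<phi> [x])"] by simp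
  qed
  also have "\<dots> = ennreal (1 / fact n) * (\<integral>\<^sup>+x. \<integral>\<^sup>+xs. \<integral>\<^sup>+\<phi>. g (addl \<phi> (x # xs)) \<partial>void A \<partial>list_power (density lam (indicator A)) n \<partial>density lam (indicator A))"
    by (rule nn_integral_cmult) measurable
  also have "(\<integral>\<^sup>+x. \<integral>\<^sup>+xs. \<integral>\<^sup>+\<phi>. g (addl \<phi> (x # xs)) \<partial>void A \<partial>list_power (density lam (indicator A)) n \<partial>density lam (indicator A))
      = (\<integral>\<^sup>+xs. \<integral>\<^sup>+\<phi>. g (addl \<phi> xs) \<partial>void A \<partial>list_power (density lam (indicator A)) (Suc n))"
    by (rule mu.nn_integral_list_power_Suc[symmetric]) (simp add: ls')
  finally have "(\<integral>\<^sup>+\<phi>. indicator {of_nat (Suc n)} (emeasure \<phi> A) * g \<phi> \<partial>Q)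
      = ennreal (1 / real (Suc n)) * (ennreal (1 / fact n) * (\<integral>\<^sup>+xs. \<integral>\<^sup>+\<phi>. g (addl \<phi> xs) \<partial>void A \<partial>list_power (density lam (indicator A)) (Suc n)))"
    using c by metis
  moreover have "ennreal (1 / real (Suc n)) * ennreal (1 / fact n) = ennreal (1 / fact (Suc n))"
    by (simp add: ennreal_mult'[symmetric] del: of_nat_Suc)
  ultimately show ?case by (simp only: mult.assoc[symmetric])
qed

text \<open>
  Conditionally on the configuration outside \<open>A\<close>, the points in \<open>A\<close> have, up to normalisation,
  the Lebesgue--Poisson law.
\<close>

lemma nn_integral_Q_LP:
  assumes A [measurable]: "A \<in> sets X" and fin: "emeasure lam A < \<infinity>"
    and g [measurable]: "g \<in> borel_measurable (config_space X)"
  shows "(\<integral>\<^sup>+\<phi>. g \<phi> \<partial>Q) = (\<integral>\<^sup>+xs. \<integral>\<^sup>+\<phi>. g (addl \<phi> xs) \<partial>void A \<partial>LP (density lam (indicator A)))"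
proof -
  interpret mu: finite_measure "density lam (indicator A)" by (rule finite_measure_restriction[OF A fin])
  interpret V: finite_measure "void A" by (rule finite_measure_void[OF A])
  have ls: "list_space (density lam (indicator A)) = list_space X"
    using list_space_lam by (simp add: list_space_def)
  \<comment> \<open>Summing over finite counts loses nothing, because a set of finite intensity
    carries infinitely many points with probability zero.\<close>
  have "emeasure Q ((\<lambda>\<phi>. emeasure \<phi> A) -` {\<infinity>} \<inter> space Q) = emeasure (poisson_dist (emeasure lam A)) {\<infinity>}"
  proof -
    have "distr Q borel (\<lambda>\<phi>. emeasure \<phi> A) = poisson_dist (emeasure lam A)"
      using law A by (simp add: is_poisson_law_def)
    moreover have "emeasure (distr Q borel (\<lambda>\<phi>. emeasure \<phi> A)) {\<infinity>}
        = emeasure Q ((\<lambda>\<phi>. emeasure \<phi> A) -` {\<infinity>} \<inter> space Q)"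
      by (rule emeasure_distr) simp_all
    ultimately show ?thesis by simp
  qed
  also have "\<dots> = 0"
    using fin poisson_dist_infinity[of "enn2real (emeasure lam A)"] by simp
  finally have "(\<lambda>\<phi>. emeasure \<phi> A) -` {\<infinity>} \<inter> space Q \<in> null_sets Q"
    by (rule null_setsI) (rule measurable_sets[of _ Q borel], measurable)
  then have "AE \<phi> in Q. emeasure \<phi> A \<noteq> \<infinity>"
    by (rule AE_I') auto
  then have "(\<integral>\<^sup>+\<phi>. g \<phi> \<partial>Q) = (\<integral>\<^sup>+\<phi>. (\<Sum>n. indicator {of_nat n} (emeasure \<phi> A) * g \<phi>) \<partial>Q)"
  proof (intro nn_integral_cong_AE)
    assume "AE \<phi> in Q. emeasure \<phi> A \<noteq> \<infinity>"
    then show "AE \<phi> in Q. g \<phi> = (\<Sum>n. indicator {of_nat n} (emeasure \<phi> A) * g \<phi>)"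
      using AE_space
    proof eventually_elim
      case (elim \<phi>)
      then obtain m where m: "emeasure \<phi> A = of_nat m"
        using config_setD(3)[of \<phi> X A] by (auto simp: space_Q)
      have "(\<Sum>n. indicator {of_nat n} (emeasure \<phi> A) * g \<phi>) = (\<Sum>n\<in>{m}. indicator {of_nat n} (emeasure \<phi> A) * g \<phi>)"
        by (rule suminf_finite) (auto simp: m indicator_def)
      then show "g \<phi> = (\<Sum>n. indicator {of_nat n} (emeasure \<phi> A) * g \<phi>)" by (simp add: m)
    qed
  qed
  also have "\<dots> = (\<Sum>n. \<integral>\<^sup>+\<phi>. indicator {of_nat n} (emeasure \<phi> A) * g \<phi> \<partial>Q)"
    by (rule nn_integral_suminf) measurable
  also have "\<dots> = (\<integral>\<^sup>+xs. \<integral>\<^sup>+\<phi>. g (addl \<phi> xs) \<partial>void A \<partial>LP (density lam (indicator A)))"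
    by (subst nn_integral_LP) (simp_all add: ls nn_integral_Q_count[OF A fin g])
  finally show ?thesis .
qed

lemma emeasure_void:
  assumes A [measurable]: "A \<in> sets X" and S [measurable]: "S \<in> sets (config_space X)"
  shows "emeasure (void A) S = emeasure Q {\<phi> \<in> S. emeasure \<phi> A = 0}"
proof -
  have [measurable]: "{\<phi> \<in> space (config_space X). \<phi> \<in> S \<and> emeasure \<phi> A = 0} \<in> sets (config_space X)"
    by measurable
  have eq: "{\<phi> \<in> space (config_space X). \<phi> \<in> S \<and> emeasure \<phi> A = 0} = {\<phi> \<in> S. emeasure \<phi> A = 0}"
    using sets.sets_into_space[OF S] by auto
  have "emeasure (void A) S = (\<integral>\<^sup>+\<phi>. indicator {0} (emeasure \<phi> A) * indicator S \<phi> \<partial>Q)"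
    unfolding void_def by (rule emeasure_density) simp_all
  also have "\<dots> = (\<integral>\<^sup>+\<phi>. indicator {\<phi> \<in> S. emeasure \<phi> A = 0} \<phi> \<partial>Q)"
    by (rule nn_integral_cong) (auto simp: indicator_def)
  also have "\<dots> = emeasure Q {\<phi> \<in> S. emeasure \<phi> A = 0}"
    using eq by (intro nn_integral_indicator) simp
  finally show ?thesis .
qed

lemma emeasure_void_partition:
  assumes P: "measurable_partition X A P" and A: "A \<in> sets X" and fin: "emeasure lam A < \<infinity>"
  shows "emeasure (void A) (partition_event X P k) = (if \<exists>C\<in>P. C \<subseteq> A \<and> k C \<noteq> 0 then 0 else
    ennreal (exp (- measure lam A)) * (\<Prod>C | C \<in> P \<and> \<not> C \<subseteq> A. emeasure (poisson_dist (emeasure lam C)) {k C}))"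
proof -
  note P' = P[unfolded measurable_partition_def]
  have Asub: "A \<subseteq> space X" using A by (rule sets.sets_into_space)
  have S: "partition_event X P k \<in> sets (config_space X)" using P' by (intro partition_event_sets) auto
  have sum: "emeasure \<phi> A = (\<Sum>C | C \<in> P \<and> C \<subseteq> A. emeasure \<phi> C)" if "sets \<phi> = sets X" for \<phi>
    by (rule emeasure_partition_sum[OF that]) (use P' Asub in auto)
  show ?thesis
  proof (cases "\<exists>C\<in>P. C \<subseteq> A \<and> k C \<noteq> 0")
    case True
    then obtain C where C: "C \<in> P" "C \<subseteq> A" "k C \<noteq> 0" by blast
    have "emeasure \<phi> A \<noteq> 0" if \<phi>: "\<phi> \<in> partition_event X P k" for \<phi>
    proof -
      have "sets \<phi> = sets X" using \<phi> config_setD(1)[of \<phi> X] by (simp add: partition_event_def)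
      then have "emeasure \<phi> C \<le> emeasure \<phi> A" using A C by (intro emeasure_mono) auto
      moreover have "emeasure \<phi> C = k C" using \<phi> C by (simp add: partition_event_def)
      ultimately show ?thesis using C(3) by auto
    qed
    then have "{\<phi> \<in> partition_event X P k. emeasure \<phi> A = 0} = {}" by blast
    then have "emeasure (void A) (partition_event X P k) = 0"
      unfolding emeasure_void[OF A S] by (simp only: emeasure_empty)
    then show ?thesis using True by (simp only: if_True)
  next
    case False
    have z: "k C = 0" if "C \<in> P" "C \<subseteq> A" for C using False that by auto
    have "emeasure \<phi> A = 0" if "\<phi> \<in> partition_event X P k" for \<phi>
    proof -
      have "emeasure \<phi> A = (\<Sum>C | C \<in> P \<and> C \<subseteq> A. emeasure \<phi> C)"
        using that config_setD(1)[of \<phi> X] by (intro sum) (simp add: partition_event_def)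
      also have "\<dots> = 0"
        using that z by (intro sum.neutral) (simp add: partition_event_def)
      finally show ?thesis .
    qed
    then have "{\<phi> \<in> partition_event X P k. emeasure \<phi> A = 0} = partition_event X P k" by blast
    then have "emeasure (void A) (partition_event X P k) = (\<Prod>C\<in>P. emeasure (poisson_dist (emeasure lam C)) {k C})"
      by (simp add: emeasure_void[OF A S] emeasure_poisson_partition[OF law P])
    also have "\<dots> = (\<Prod>C | C \<in> P \<and> C \<subseteq> A. emeasure (poisson_dist (emeasure lam C)) {k C})
        * (\<Prod>C | C \<in> P \<and> \<not> C \<subseteq> A. emeasure (poisson_dist (emeasure lam C)) {k C})"
      using P' by (subst prod.union_disjoint[symmetric]) (auto intro!: prod.cong)
    also have "(\<Prod>C | C \<in> P \<and> C \<subseteq> A. emeasure (poisson_dist (emeasure lam C)) {k C})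
        = (\<Prod>C | C \<in> P \<and> C \<subseteq> A. ennreal (exp (- measure lam C)))"
    proof (rule prod.cong[OF refl])
      fix C assume C: "C \<in> {C. C \<in> P \<and> C \<subseteq> A}"
      then have "emeasure lam C < \<infinity>" using fin emeasure_mono[of C A lam] A by (auto intro: le_less_trans)
      then have "emeasure lam C = ennreal (measure lam C)" by (simp add: emeasure_eq_ennreal_measure)
      then show "emeasure (poisson_dist (emeasure lam C)) {k C} = ennreal (exp (- measure lam C))"
        using z C poisson_dist_nat[of "measure lam C" 0] by simp
    qed
    also have "\<dots> = ennreal (exp (- measure lam A))"
    proof -
      have "measure lam A = (\<Sum>C | C \<in> P \<and> C \<subseteq> A. measure lam C)"
      proof -
        have "\<And>C. C \<in> P \<Longrightarrow> C \<subseteq> A \<Longrightarrow> emeasure lam C = ennreal (measure lam C)"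
          using fin emeasure_mono[of _ A lam] A sets_lam
          by (intro emeasure_eq_ennreal_measure) (metis infinity_ennreal_def less_irrefl order_le_less_trans)
        then have "(\<Sum>C | C \<in> P \<and> C \<subseteq> A. emeasure lam C) = (\<Sum>C | C \<in> P \<and> C \<subseteq> A. ennreal (measure lam C))"
          by (intro sum.cong) auto
        then have "emeasure lam A = ennreal (\<Sum>C | C \<in> P \<and> C \<subseteq> A. measure lam C)"
          by (subst sum) (simp_all add: sum_ennreal)
        then show ?thesis by (simp add: measure_def sum_nonneg)
      qed
      then show ?thesis using P' by (simp add: prod_ennreal exp_sum sum_negf[symmetric])
    qed
    finally show ?thesis using False by (simp only: if_False)
  qed
qed

end

text \<open>By independence the configuration outside \<open>A\<close> does not depend on the
  intensity inside. The two restricted laws differ only through the probabilities that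
  \<open>A\<close> is empty, \<open>exp (- measure lam A)\<close> and
  \<open>exp (- measure rho A)\<close>, and the constant densities cancel these.\<close>

lemma void_eq:
  assumes l: "poisson_law lam X Q" and r: "poisson_law rho X Q'"
    and A [measurable]: "A \<in> sets X" and fin: "emeasure lam A < \<infinity>" "emeasure rho A < \<infinity>"
    and off: "\<And>B. B \<in> sets X \<Longrightarrow> B \<inter> A = {} \<Longrightarrow> emeasure lam B = emeasure rho B"
  shows "density (poisson_law.void Q A) (\<lambda>_. ennreal (exp (measure lam A)))
    = density (poisson_law.void Q' A) (\<lambda>_. ennreal (exp (measure rho A)))" (is "?M = ?N")
proof (rule config_measure_eqI[OF _ _ A])
  interpret l: poisson_law lam X Q by fact
  interpret r: poisson_law rho X Q' by fact
  interpret rV: finite_measure "r.void A" by (rule r.finite_measure_void[OF A])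
  show "sets ?M = sets (config_space X)" "sets ?N = sets (config_space X)" by simp_all
  have e: "emeasure ?M S = ennreal (exp (measure lam A)) * emeasure (l.void A) S"
    "emeasure ?N S = ennreal (exp (measure rho A)) * emeasure (r.void A) S"
    if "S \<in> sets (config_space X)" for S
    using that by (simp_all add: emeasure_density nn_integral_cmult_indicator)
  show "emeasure ?N (config_set X) < \<infinity>"
    using sets.top[of "config_space X"]
    by (simp add: e space_config_space rV.emeasure_eq_measure ennreal_mult'[symmetric])
  fix P k assume P: "measurable_partition X A P"
  note P' = P[unfolded measurable_partition_def]
  have S: "partition_event X P k \<in> sets (config_space X)" using P' by (intro partition_event_sets) auto
  have "(\<Prod>C | C \<in> P \<and> \<not> C \<subseteq> A. emeasure (poisson_dist (emeasure lam C)) {k C})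
      = (\<Prod>C | C \<in> P \<and> \<not> C \<subseteq> A. emeasure (poisson_dist (emeasure rho C)) {k C})"
  proof (rule prod.cong[OF refl])
    fix C assume "C \<in> {C. C \<in> P \<and> \<not> C \<subseteq> A}"
    then have "C \<in> sets X" "C \<inter> A = {}" using P' by auto
    then have "emeasure lam C = emeasure rho C" by (rule off)
    then show "emeasure (poisson_dist (emeasure lam C)) {k C} = emeasure (poisson_dist (emeasure rho C)) {k C}"
      by simp
  qed
  moreover have "ennreal (exp x) * (ennreal (exp (- x)) * c) = c" for x c
    by (simp add: mult.assoc[symmetric] ennreal_mult'[symmetric] exp_minus_inverse)
  ultimately show "emeasure ?M (partition_event X P k) = emeasure ?N (partition_event X P k)"
    unfolding e[OF S] l.emeasure_void_partition[OF P A fin(1)] r.emeasure_void_partition[OF P A fin(2)]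
    by (simp only: if_distrib[of "\<lambda>y. _ * y"] mult_zero_right)
qed

section \<open>The chaos kernels of a functional\<close>

definition shift_mean :: "'a measure measure \<Rightarrow> ('a measure \<Rightarrow> real) \<Rightarrow> 'a list \<Rightarrow> real" where
  "shift_mean Q f p = (\<integral>\<phi>. f (addl \<phi> p) \<partial>Q)"

text \<open>\<open>chaos Q f xs\<close> is \<open>E D\<^sup>n f\<close> at the points \<open>xs\<close>, with the expectation taken inside the alternating sum.\<close>

definition chaos :: "'a measure measure \<Rightarrow> ('a measure \<Rightarrow> real) \<Rightarrow> 'a list \<Rightarrow> real" where
  "chaos Q f = list_diff (shift_mean Q f)"

lemma list_symmetric_shift_mean: "list_symmetric (shift_mean Q f)"
  unfolding list_symmetric_def shift_mean_def
  by (intro allI impI Bochner_Integration.integral_cong refl arg_cong[where f = f] addl_perm)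

lemma list_symmetric_chaos: "list_symmetric (chaos Q f)"
  unfolding chaos_def by (rule list_symmetric_list_diff[OF list_symmetric_shift_mean])

text \<open>The number of splittings with left part in the exceptional set integrates, by the
  splitting identity, to a double integral over that null set and a second list; hence it is zero
  almost everywhere.\<close>

lemma (in sigma_finite_measure) AE_LP_splits:
  assumes "AE x in LP M. G x"
  shows "AE x in LP M. \<forall>(p, q)\<in>set (splits x). G p"
proof -
  obtain N where N: "{x \<in> space (LP M). \<not> G x} \<subseteq> N" "emeasure (LP M) N = 0" and NS: "N \<in> sets (LP M)"
    using assms by (auto elim!: AE_E)
  have [measurable]: "N \<in> sets (list_space M)" using NS by simp
  let ?H = "\<lambda>p q. indicator N p :: ennreal"
  have H: "case_prod ?H \<in> borel_measurable (list_space M \<Otimes>\<^sub>M list_space M)" by measurable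
  have "(\<integral>\<^sup>+x. sum_splits ?H x \<partial>LP M) = (\<integral>\<^sup>+p. \<integral>\<^sup>+q. indicator N p \<partial>LP M \<partial>LP M)"
    by (rule nn_integral_LP_sum_splits[OF H])
  also have "\<dots> = 0"
    using N(2) by (simp add: nn_integral_multc mult.commute)
  finally have "AE x in LP M. sum_splits ?H x = 0"
    using measurable_sum_splits[OF H] by (subst (asm) nn_integral_0_iff_AE) simp_all
  then show ?thesis
    using AE_space
  proof eventually_elim
    case (elim x)
    show ?case
    proof (clarify)
      fix p q assume pq: "(p, q) \<in> set (splits x)"
      have "x \<in> lists (space M)" using elim(2) by (simp add: space_LP)
      with splits_in_lists[OF pq] have p: "p \<in> space (LP M)" by (simp add: space_LP)
      have "\<forall>n\<in>set (splits x). (case n of (a, b) \<Rightarrow> indicator N a) = (0 :: ennreal)"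
        using elim(1) by (simp add: sum_list_eq_0_iff)
      with pq have "indicator N p = (0 :: ennreal)" by fastforce
      then show "G p" using N(1) p by (auto simp: indicator_def split: if_splits)
    qed
  qed
qed

lemma integrable_square_bound:
  fixes f :: "'b \<Rightarrow> real"
  assumes "finite_measure M" "f \<in> borel_measurable M" "integrable M (\<lambda>x. (f x)\<^sup>2)"
  shows "integrable M f"
proof -
  interpret finite_measure M by fact
  have "\<bar>y\<bar> \<le> 1 + y\<^sup>2" for y :: real
    using sum_squares_ge_zero[of "\<bar>y\<bar> - 1" "0"] zero_le_power2[of "\<bar>y\<bar> - 1"] by (auto simp: power2_diff)
  then show ?thesis
    using assms by (intro Bochner_Integration.integrable_bound[of M "\<lambda>x. 1 + (f x)\<^sup>2" f]) auto
qed

text \<open>Cauchy-Schwarz against the constant 1, obtained from nonnegativity of the integral of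
  \<open>(f - c)^2\<close> at the mean value \<open>c\<close>.\<close>

lemma (in finite_measure) square_integral_le:
  fixes f :: "'a \<Rightarrow> real"
  assumes "f \<in> borel_measurable M" "integrable M (\<lambda>x. (f x)\<^sup>2)" "0 < measure M (space M)"
  shows "(\<integral>x. f x \<partial>M)\<^sup>2 \<le> measure M (space M) * (\<integral>x. (f x)\<^sup>2 \<partial>M)"
proof -
  let ?m = "measure M (space M)" and ?I = "\<integral>x. f x \<partial>M"
  have i: "integrable M f" by (rule integrable_square_bound) (use assms finite_measure_axioms in auto)
  define c where "c = ?I / ?m"
  have "0 \<le> (\<integral>x. (f x - c)\<^sup>2 \<partial>M)" by simp
  also have "\<dots> = (\<integral>x. (f x)\<^sup>2 - 2 * c * f x + c\<^sup>2 \<partial>M)"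
    by (simp add: power2_diff algebra_simps)
  also have "\<dots> = (\<integral>x. (f x)\<^sup>2 \<partial>M) - 2 * c * ?I + ?m * c\<^sup>2"
    using assms(2) i by simp
  also have "\<dots> = (\<integral>x. (f x)\<^sup>2 \<partial>M) - ?I\<^sup>2 / ?m"
    using assms(3) by (simp add: c_def field_simps power2_eq_square)
  finally show ?thesis using assms(3) by (simp add: field_simps)
qed

section \<open>Decomposition of a Poisson law over a set of finite intensity\<close>

context poisson_law
begin

lemma sets_LP_lam [measurable_cong, simp]: "sets (LP lam) = sets (list_space X)"
  using list_space_lam by simp

lemma space_lam: "space lam = space X"
  by (rule sets_eq_imp_space_eq) simp

definition restr :: "'a set \<Rightarrow> 'a measure" where
  "restr A = density lam (indicator A)"

lemma sets_restr [measurable_cong, simp]: "sets (restr A) = sets X"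
  by (simp add: restr_def)

lemma list_space_restr: "list_space (restr A) = list_space X"
  by (simp add: list_space_def sets_eq_imp_space_eq[OF sets_restr])

lemma sets_LP_restr [measurable_cong, simp]: "sets (LP (restr A)) = sets (list_space X)"
  using list_space_restr by simp

lemma LP_restr:
  assumes A: "A \<in> sets X" "emeasure lam A < \<infinity>"
  shows "LP (restr A) = density (LP lam) (indicator (lists A))"
proof -
  interpret mu: finite_measure "restr A"
    unfolding restr_def by (rule finite_measure_restriction[OF A])
  have "LP (restr A) = density (LP lam) (pl (indicator A :: 'a \<Rightarrow> ennreal))"
    unfolding restr_def
    by (rule LP_density) (use A mu.sigma_finite_measure_axioms in \<open>auto simp: restr_def\<close>)
  then show ?thesis by (simp only: pl_indicator)
qed

lemma lists_sets_X [measurable]: "A \<in> sets X \<Longrightarrow> lists A \<in> sets (list_space X)"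
  using lists_in_sets[of A] list_space_lam by simp

text \<open>As an equality of measures the decomposition also transfers Bochner integrals, for which
  the version with nonnegative functions would not suffice.\<close>

lemma Q_eq_distr:
  assumes A [measurable]: "A \<in> sets X" and fin: "emeasure lam A < \<infinity>"
  shows "Q = distr (LP (restr A) \<Otimes>\<^sub>M void A) (config_space X) (\<lambda>(xs, \<phi>). addl \<phi> xs)"
proof (rule measure_eqI)
  interpret V: finite_measure "void A" by (rule finite_measure_void[OF A])
  fix S assume "S \<in> sets Q"
  then have S [measurable]: "S \<in> sets (config_space X)" by simp
  have "emeasure Q S = (\<integral>\<^sup>+\<phi>. indicator S \<phi> \<partial>Q)" by simp
  also have "\<dots> = (\<integral>\<^sup>+xs. \<integral>\<^sup>+\<phi>. indicator S (addl \<phi> xs) \<partial>void A \<partial>LP (restr A))"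
    unfolding restr_def by (rule nn_integral_Q_LP[OF A fin]) measurable
  also have "\<dots> = (\<integral>\<^sup>+p. indicator S (case p of (xs, \<phi>) \<Rightarrow> addl \<phi> xs) \<partial>(LP (restr A) \<Otimes>\<^sub>M void A))"
    by (subst V.nn_integral_fst[symmetric]) simp_all
  also have "\<dots> = (\<integral>\<^sup>+\<phi>. indicator S \<phi> \<partial>distr (LP (restr A) \<Otimes>\<^sub>M void A) (config_space X) (\<lambda>(xs, \<phi>). addl \<phi> xs))"
    by (rule nn_integral_distr[symmetric]) simp_all
  finally show "emeasure Q S = emeasure (distr (LP (restr A) \<Otimes>\<^sub>M void A) (config_space X) (\<lambda>(xs, \<phi>). addl \<phi> xs)) S"
    by simp
qed simp

lemma integral_Q_LP:
  fixes g :: "'a measure \<Rightarrow> real"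
  assumes A [measurable]: "A \<in> sets X" and fin: "emeasure lam A < \<infinity>" and g: "integrable Q g"
  shows "(\<integral>\<phi>. g \<phi> \<partial>Q) = (\<integral>xs. \<integral>\<phi>. g (addl \<phi> xs) \<partial>void A \<partial>LP (restr A))"
    and "integrable (LP (restr A)) (\<lambda>xs. \<integral>\<phi>. g (addl \<phi> xs) \<partial>void A)"
proof -
  interpret V: finite_measure "void A" by (rule finite_measure_void[OF A])
  interpret mu: finite_measure "restr A"
    unfolding restr_def by (rule finite_measure_restriction[OF A fin])
  interpret L: sigma_finite_measure "LP (restr A)" by (rule mu.sigma_finite_LP)
  interpret PS: pair_sigma_finite "LP (restr A)" "void A" ..
  let ?P = "LP (restr A) \<Otimes>\<^sub>M void A"
  have gm [measurable]: "g \<in> borel_measurable (config_space X)"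
    using borel_measurable_integrable[OF g] by simp
  have m: "(\<lambda>(xs, \<phi>). addl \<phi> xs) \<in> measurable ?P (config_space X)" by measurable
  have "integrable ?P (\<lambda>p. g (case p of (xs, \<phi>) \<Rightarrow> addl \<phi> xs))"
    using iffD1[OF arg_cong[OF Q_eq_distr[OF A fin], of "\<lambda>N. integrable N g"] g]
    by (subst (asm) integrable_distr_eq[OF m gm]) simp
  then have i: "integrable ?P (\<lambda>(xs, \<phi>). g (addl \<phi> xs))" by (simp add: split_beta')
  have "(\<integral>\<phi>. g \<phi> \<partial>Q) = (\<integral>p. g (case p of (xs, \<phi>) \<Rightarrow> addl \<phi> xs) \<partial>?P)"
    using arg_cong[OF Q_eq_distr[OF A fin], of "\<lambda>N. \<integral>\<phi>. g \<phi> \<partial>N"] integral_distr[OF m gm]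
    by (rule trans)
  also have "\<dots> = (\<integral>xs. \<integral>\<phi>. g (addl \<phi> xs) \<partial>void A \<partial>LP (restr A))"
    using PS.integral_fst'[OF i] by (simp add: split_beta')
  finally show "(\<integral>\<phi>. g \<phi> \<partial>Q) = (\<integral>xs. \<integral>\<phi>. g (addl \<phi> xs) \<partial>void A \<partial>LP (restr A))" .
  show "integrable (LP (restr A)) (\<lambda>xs. \<integral>\<phi>. g (addl \<phi> xs) \<partial>void A)"
    using PS.integrable_fst'[OF i] by simp
qed

lemma measure_void:
  assumes A [measurable]: "A \<in> sets X" and fin: "emeasure lam A < \<infinity>"
  shows "measure (void A) (space (void A)) = exp (- measure lam A)"
proof -
  have sp: "space (void A) = space Q" by (simp add: void_def)
  have "space Q \<in> sets (config_space X)" using sets.top[of Q] by simp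
  then have "emeasure (void A) (space (void A)) = emeasure Q {\<phi> \<in> space Q. emeasure \<phi> A = 0}"
    unfolding sp by (rule emeasure_void[OF A])
  also have "\<dots> = emeasure (distr Q borel (\<lambda>\<phi>. emeasure \<phi> A)) {0}"
    by (subst emeasure_distr) (auto intro!: arg_cong[where f = "emeasure Q"])
  also have "\<dots> = emeasure (poisson_dist (ennreal (measure lam A))) {of_nat 0}"
    using law A fin by (simp add: is_poisson_law_def emeasure_eq_ennreal_measure)
  also have "\<dots> = ennreal (exp (- measure lam A))"
    by (subst poisson_dist_nat) simp_all
  finally show ?thesis by (simp add: measure_def)
qed

lemma shift_mean_measurable [measurable]:
  assumes [measurable]: "f \<in> borel_measurable (config_space X)"
  shows "shift_mean Q f \<in> borel_measurable (list_space X)"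
  unfolding shift_mean_def by measurable

lemma chaos_measurable [measurable]:
  assumes [measurable]: "f \<in> borel_measurable (config_space X)"
  shows "chaos Q f \<in> borel_measurable (list_space X)"
  unfolding chaos_def list_diff_def by (rule measurable_sum_splits) measurable

lemma const_list_X: "p \<in> lists (space X) \<Longrightarrow> (\<lambda>_. p) \<in> measurable N (list_space X)"
  by (simp add: space_list_space)

text \<open>The conditional expectation of \<open>f\<close> given the points in \<open>A\<close>, up to normalisation.\<close>

definition inner_mean :: "'a set \<Rightarrow> ('a measure \<Rightarrow> real) \<Rightarrow> 'a list \<Rightarrow> real" where
  "inner_mean A f y = (\<integral>\<phi>. f (addl \<phi> y) \<partial>void A)"

section \<open>Bounded functionals: Bessel inequality and local change of intensity\<close>

context
  fixes f :: "'a measure \<Rightarrow> real" and K :: real and A :: "'a set"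
  assumes f [measurable]: "f \<in> borel_measurable (config_space X)" and K: "\<And>\<phi>. \<bar>f \<phi>\<bar> \<le> K"
    and A [measurable]: "A \<in> sets X" and fin: "emeasure lam A < \<infinity>"
begin

interpretation V: finite_measure "void A" by (rule finite_measure_void[OF A])

interpretation mu: finite_measure "restr A"
  unfolding restr_def by (rule finite_measure_restriction[OF A fin])

lemma inner_mean_measurable: "inner_mean A f \<in> borel_measurable (list_space X)"
  unfolding inner_mean_def by measurable

lemma list_symmetric_inner_mean: "list_symmetric (inner_mean A f)"
  unfolding list_symmetric_def inner_mean_def
  by (intro allI impI Bochner_Integration.integral_cong refl arg_cong[where f = f] addl_perm)

lemma abs_inner_mean_le: "\<bar>inner_mean A f y\<bar> \<le> measure (void A) (space (void A)) * K"
proof (cases "integrable (void A) (\<lambda>\<phi>. f (addl \<phi> y))")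
  case True
  have "\<bar>inner_mean A f y\<bar> \<le> (\<integral>\<phi>. \<bar>f (addl \<phi> y)\<bar> \<partial>void A)"
    unfolding inner_mean_def by (rule integral_abs_bound)
  also have "\<dots> \<le> (\<integral>\<phi>. K \<partial>void A)"
    by (rule integral_mono) (use True K in auto)
  finally show ?thesis by simp
next
  case False
  have "0 \<le> K" using K[of undefined] by simp
  with False show ?thesis by (simp add: inner_mean_def not_integrable_integral_eq)
qed

lemma integrable_bounded_shift:
  assumes "p \<in> lists (space X)"
  shows "integrable Q (\<lambda>\<phi>. f (addl \<phi> p))"
proof -
  note [measurable] = const_list_X[OF assms]
  show ?thesis
    by (rule Q.integrable_const_bound[of _ K]) (simp add: K, measurable)
qed

text \<open>Random points of the process in \<open>A\<close> and the deterministic points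
  \<open>p\<close> enter the functional in the same way, so the mean of the shifted functional
  averages the conditional means at \<open>p @ y\<close>.\<close>

lemma shift_mean_LPint:
  assumes p: "p \<in> lists (space X)"
  shows "shift_mean Q f p = mu.LPint (inner_mean A f) p"
proof -
  have "shift_mean Q f p = (\<integral>y. \<integral>\<phi>. f (addl (addl \<phi> y) p) \<partial>void A \<partial>LP (restr A))"
    unfolding shift_mean_def by (rule integral_Q_LP(1)[OF A fin integrable_bounded_shift[OF p]])
  also have "\<dots> = (\<integral>y. inner_mean A f (p @ y) \<partial>LP (restr A))"
  proof -
    have "addl \<phi> (y @ p) = addl \<phi> (p @ y)" for \<phi> :: "'a measure" and y by (rule addl_perm) simp
    then show ?thesis unfolding inner_mean_def addl_append by simp
  qed
  finally show ?thesis unfolding mu.LPint_def .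
qed

lemma chaos_LPint:
  "x \<in> lists (space X) \<Longrightarrow> chaos Q f x = list_diff (mu.LPint (inner_mean A f)) x"
  unfolding chaos_def by (rule list_diff_cong) (use shift_mean_LPint splits_in_lists in blast)

text \<open>The isometry leaves \<open>exp (measure lam A)\<close> times the squared norm of the
  conditional mean. The law conditioning on emptiness has mass \<open>exp (- measure lam A)\<close>,
  so Cauchy-Schwarz inside each conditional mean cancels this factor exactly.\<close>

lemma chaos_square_bounded:
  "(\<integral>\<^sup>+x. ennreal ((chaos Q f x)\<^sup>2) \<partial>LP (restr A)) \<le> ennreal (\<integral>\<phi>. (f \<phi>)\<^sup>2 \<partial>Q)"
proof -
  let ?a = "inner_mean A f"
  have am: "?a \<in> borel_measurable (list_space (restr A))"
    using inner_mean_measurable by (simp add: list_space_restr)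
  note sq = mu.integral_list_diff_LPint_square[OF am abs_inner_mean_le list_symmetric_inner_mean]
  have mass: "measure (restr A) (space (restr A)) = measure lam A"
  proof -
    have "emeasure (restr A) (space (restr A)) = (\<integral>\<^sup>+x. indicator A x * indicator (space lam) x \<partial>lam)"
      unfolding restr_def space_density by (rule emeasure_density[OF _ sets.top]) measurable
    also have "\<dots> = (\<integral>\<^sup>+x. indicator A x \<partial>lam)" by (rule nn_integral_cong) simp
    finally show ?thesis by (simp add: measure_def)
  qed
  have f2: "integrable Q (\<lambda>\<phi>. (f \<phi>)\<^sup>2)"
    using K by (intro Q.integrable_const_bound[of _ "K\<^sup>2"]) (auto intro!: AE_I2 simp: power2_le_iff_abs_le abs_le_square_iff[symmetric] intro: order.trans[OF K])
  have ne: "0 < measure (void A) (space (void A))" by (simp add: measure_void[OF A fin])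
  have spl: "space (LP (restr A)) = lists (space X)"
    by (simp add: space_LP sets_eq_imp_space_eq[OF sets_restr])
  have "(\<integral>\<^sup>+x. ennreal ((chaos Q f x)\<^sup>2) \<partial>LP (restr A))
      = (\<integral>\<^sup>+x. ennreal ((list_diff (mu.LPint ?a) x)\<^sup>2) \<partial>LP (restr A))"
    by (rule nn_integral_cong) (simp add: chaos_LPint spl)
  also have "\<dots> = ennreal (\<integral>x. (list_diff (mu.LPint ?a) x)\<^sup>2 \<partial>LP (restr A))"
    by (rule nn_integral_eq_integral[OF sq(2)]) simp
  also have "\<dots> = ennreal (\<integral>z. exp (measure lam A) * (?a z)\<^sup>2 \<partial>LP (restr A))"
    using sq(1) mass by simp
  also have "\<dots> \<le> ennreal (\<integral>z. \<integral>\<phi>. (f (addl \<phi> z))\<^sup>2 \<partial>void A \<partial>LP (restr A))"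
  proof (intro ennreal_leI integral_mono_AE)
    show "integrable (LP (restr A)) (\<lambda>z. \<integral>\<phi>. (f (addl \<phi> z))\<^sup>2 \<partial>void A)"
      by (rule integral_Q_LP(2)[OF A fin f2])
    have pw: "exp (measure lam A) * (?a z)\<^sup>2 \<le> (\<integral>\<phi>. (f (addl \<phi> z))\<^sup>2 \<partial>void A)" if "z \<in> space (LP (restr A))" for z
    proof -
      note [measurable] = const_list_X[of z]
      have z: "z \<in> lists (space X)" using that spl by simp
      have "(\<lambda>\<phi>. f (addl \<phi> z)) \<in> borel_measurable (void A)" using z by measurable
      moreover from this have "integrable (void A) (\<lambda>\<phi>. (f (addl \<phi> z))\<^sup>2)"
        using K by (intro V.integrable_const_bound[of _ "K\<^sup>2"]) (auto intro!: AE_I2 simp: power2_le_iff_abs_le abs_le_square_iff[symmetric] intro: order.trans[OF K])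
      ultimately have "(?a z)\<^sup>2 \<le> exp (- measure lam A) * (\<integral>\<phi>. (f (addl \<phi> z))\<^sup>2 \<partial>void A)"
        using V.square_integral_le[OF _ _ ne] unfolding inner_mean_def measure_void[OF A fin] by blast
      then have "exp (measure lam A) * (?a z)\<^sup>2 \<le> exp (measure lam A) * (exp (- measure lam A) * (\<integral>\<phi>. (f (addl \<phi> z))\<^sup>2 \<partial>void A))"
        by (rule mult_left_mono) simp
      then show ?thesis by (simp add: mult.assoc[symmetric] exp_minus_inverse)
    qed
    then show "AE z in LP (restr A). exp (measure lam A) * (?a z)\<^sup>2 \<le> (\<integral>\<phi>. (f (addl \<phi> z))\<^sup>2 \<partial>void A)"
      by (rule AE_I2)
    show "integrable (LP (restr A)) (\<lambda>z. exp (measure lam A) * (?a z)\<^sup>2)"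
      by (rule Bochner_Integration.integrable_bound[OF integral_Q_LP(2)[OF A fin f2]])
         (use pw inner_mean_measurable in \<open>auto intro!: AE_I2 intro: order.trans[OF _ abs_ge_self]\<close>)
  qed
  also have "\<dots> = ennreal (\<integral>\<phi>. (f \<phi>)\<^sup>2 \<partial>Q)"
    by (simp add: integral_Q_LP(1)[OF A fin f2])
  finally show ?thesis .
qed

text \<open>Both laws are decomposed over \<open>A\<close>. Outside they agree up to a constant, and
  inside the Lebesgue-Poisson measure acquires the density \<open>pl h\<close>. The adjoint identity
  for products with \<open>u = h - 1\<close> turns the resulting integral into one over
  kernels.\<close>

lemma local_change_of_intensity:
  assumes h [measurable]: "h \<in> borel_measurable X" and h0: "\<And>x. 0 \<le> h x"
    and h1: "\<And>x. x \<notin> A \<Longrightarrow> h x = 1"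
    and Q': "poisson_law (density lam (\<lambda>x. ennreal (h x))) X Q'"
    and hA: "integrable (restr A) h"
  shows "(\<integral>\<phi>. f \<phi> \<partial>Q') = (\<integral>x. chaos Q f x * pl (\<lambda>y. h y - 1) x \<partial>LP (restr A))"
proof -
  let ?lam' = "density lam (\<lambda>x. ennreal (h x))"
  let ?u = "\<lambda>y. h y - 1"
  interpret p: poisson_law ?lam' X Q' by fact
  interpret V': finite_measure "p.void A" by (rule p.finite_measure_void[OF A])
  have one: "integrable (restr A) (\<lambda>_. 1 :: real)" by simp
  have u: "integrable (restr A) ?u" using hA by simp
  have restr': "p.restr A = density (restr A) (\<lambda>x. ennreal (h x))"
    unfolding p.restr_def restr_def
    by (subst density_density_eq, simp_all, subst density_density_eq, simp_all add: mult.commute)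
  have hI: "(\<integral>\<^sup>+x. ennreal (h x) \<partial>restr A) = ennreal (\<integral>x. h x \<partial>restr A)"
    using h0 by (intro nn_integral_eq_integral hA) auto
  have lamA: "emeasure ?lam' A = ennreal (\<integral>x. h x \<partial>restr A)"
    by (subst hI[symmetric]) (simp add: restr_def emeasure_density nn_integral_density mult.commute)
  then have fin': "emeasure ?lam' A < \<infinity>" by simp
  have meas': "measure ?lam' A = (\<integral>x. h x \<partial>restr A)"
    using lamA h0 by (simp add: measure_def integral_nonneg_AE)
  have massA: "(\<integral>x. 1 \<partial>restr A) = measure lam A"
  proof -
    have "emeasure (restr A) (space (restr A)) = (\<integral>\<^sup>+x. indicator A x * indicator (space lam) x \<partial>lam)"
      unfolding restr_def space_density by (rule emeasure_density[OF _ sets.top]) measurable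
    also have "\<dots> = (\<integral>\<^sup>+x. indicator A x \<partial>lam)" by (rule nn_integral_cong) simp
    finally show ?thesis by (simp add: measure_def)
  qed
  have uI: "(\<integral>x. ?u x \<partial>restr A) = measure ?lam' A - measure lam A"
    using hA massA meas' by simp
  have off: "emeasure ?lam' B = emeasure lam B" if "B \<in> sets X" "B \<inter> A = {}" for B
  proof -
    have [measurable]: "B \<in> sets X" by fact
    have "emeasure ?lam' B = (\<integral>\<^sup>+x. ennreal (h x) * indicator B x \<partial>lam)" by (simp add: emeasure_density)
    also have "\<dots> = (\<integral>\<^sup>+x. indicator B x \<partial>lam)"
      by (rule nn_integral_cong) (use h1 that in \<open>auto simp: indicator_def\<close>)
    finally show ?thesis by simp
  qed
  have ve: "density (p.void A) (\<lambda>_. ennreal (exp (measure ?lam' A)))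
      = density (void A) (\<lambda>_. ennreal (exp (measure lam A)))"
    by (rule void_eq[OF Q' poisson_law_axioms A fin' fin off])
  have dens: "(\<integral>\<phi>. g \<phi> \<partial>density N (\<lambda>_. ennreal c)) = c * (\<integral>\<phi>. g \<phi> \<partial>N)"
    if "g \<in> borel_measurable N" "0 \<le> c" for g :: "'a measure \<Rightarrow> real" and c N
    using that by (simp add: integral_density)
  \<comment> \<open>The ratio of the two normalisations of the law without points in
    \<open>A\<close>. By \<open>uI\<close> it is the exponential of \<open>- \<integral>u\<close>,
    which is the factor in the adjoint identity.\<close>
  define c where "c = exp (measure lam A - measure ?lam' A)"
  have iv: "p.inner_mean A f z = c * inner_mean A f z" if "z \<in> lists (space X)" for z
  proof -
    note [measurable] = const_list_X[OF that]
    have "exp (measure ?lam' A) * p.inner_mean A f z = exp (measure lam A) * inner_mean A f z"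
      using arg_cong[OF ve, of "\<lambda>N. \<integral>\<phi>. f (addl \<phi> z) \<partial>N"]
      unfolding p.inner_mean_def inner_mean_def by (simp add: dens)
    then show ?thesis by (simp add: c_def exp_diff field_simps)
  qed
  have fi: "integrable Q' f" using K by (intro p.Q.integrable_const_bound[of _ K]) auto
  interpret mu': finite_measure "p.restr A"
    unfolding p.restr_def by (rule p.finite_measure_restriction[OF A fin'])
  have LP': "LP (p.restr A) = density (LP (restr A)) (\<lambda>x. ennreal (pl h x))"
  proof -
    have "LP (density (restr A) (\<lambda>x. ennreal (h x))) = density (LP (restr A)) (pl (\<lambda>x. ennreal (h x)))"
      by (rule mu.LP_density) (use mu'.sigma_finite_measure_axioms in \<open>auto simp: restr'\<close>)
    then show ?thesis unfolding restr' by (simp add: ennreal_pl h0)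
  qed
  have spl: "space (LP (restr A)) = lists (space X)"
    by (simp add: space_LP sets_eq_imp_space_eq[OF sets_restr])
  have am: "inner_mean A f \<in> borel_measurable (list_space (restr A))"
    using inner_mean_measurable by (simp add: list_space_restr)
  have "(\<integral>\<phi>. f \<phi> \<partial>Q') = (\<integral>xs. p.inner_mean A f xs \<partial>LP (p.restr A))"
    unfolding p.inner_mean_def by (rule p.integral_Q_LP(1)[OF A fin' fi])
  also have "\<dots> = (\<integral>xs. pl h xs * p.inner_mean A f xs \<partial>LP (restr A))"
    unfolding LP'
    by (subst integral_density)
       (use pl_nonneg[of h] h0 p.inner_mean_measurable[OF f K A fin'] in auto)
  also have "\<dots> = (\<integral>xs. c * (inner_mean A f xs * pl (\<lambda>x. 1 + ?u x) xs) \<partial>LP (restr A))"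
    by (rule Bochner_Integration.integral_cong) (simp_all add: iv spl)
  also have "\<dots> = c * (\<integral>xs. inner_mean A f xs * pl (\<lambda>x. 1 + ?u x) xs \<partial>LP (restr A))" by simp
  also have "\<dots> = (\<integral>x. list_diff (mu.LPint (inner_mean A f)) x * pl ?u x \<partial>LP (restr A))"
    unfolding mu.integral_list_diff_LPint_pl[OF am abs_inner_mean_le list_symmetric_inner_mean u] uI c_def
    by simp
  also have "\<dots> = (\<integral>x. chaos Q f x * pl ?u x \<partial>LP (restr A))"
    by (rule Bochner_Integration.integral_cong) (simp_all add: chaos_LPint spl)
  finally show ?thesis .
qed

end

end

section \<open>Square-integrable functionals\<close>

definition clip :: "nat \<Rightarrow> ('b \<Rightarrow> real) \<Rightarrow> 'b \<Rightarrow> real" where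
  "clip m f x = max (- real m) (min (real m) (f x))"

lemma clip_bound: "\<bar>clip m f x\<bar> \<le> real m"
  by (auto simp: clip_def)

lemma abs_clip_le: "\<bar>clip m f x\<bar> \<le> \<bar>f x\<bar>"
  by (auto simp: clip_def)

lemma clip_tendsto: "(\<lambda>m. clip m f x) \<longlonglongrightarrow> f x"
proof (rule tendsto_eventually)
  obtain n :: nat where "\<bar>f x\<bar> \<le> real n" using real_arch_simple by blast
  then show "\<forall>\<^sub>F m in sequentially. clip m f x = f x"
    by (intro eventually_sequentiallyI[of n]) (auto simp: clip_def)
qed

lemma clip_measurable [measurable]:
  assumes [measurable]: "f \<in> borel_measurable M"
  shows "clip m f \<in> borel_measurable M"
proof -
  have "clip m f = (\<lambda>x. max (- real m) (min (real m) (f x)))" by (simp add: fun_eq_iff clip_def)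
  then show ?thesis by simp
qed

lemma integral_clip_tendsto:
  assumes "integrable N g"
  shows "(\<lambda>m. \<integral>x. clip m g x \<partial>N) \<longlonglongrightarrow> (\<integral>x. g x \<partial>N)"
proof (rule integral_dominated_convergence)
  show "integrable N (\<lambda>x. \<bar>g x\<bar>)" using assms by simp
  have "g \<in> borel_measurable N" using assms by simp
  then show "g \<in> borel_measurable N" "\<And>m. clip m g \<in> borel_measurable N" by measurable
  show "AE x in N. norm (clip m g x) \<le> \<bar>g x\<bar>" for m by (auto simp: abs_clip_le)
  show "AE x in N. (\<lambda>m. clip m g x) \<longlonglongrightarrow> g x" by (auto simp: clip_tendsto)
qed

lemma tendsto_list_diff:
  assumes "\<And>p q. (p, q) \<in> set (splits x) \<Longrightarrow> (\<lambda>m. a m p) \<longlonglongrightarrow> b p"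
  shows "(\<lambda>m. list_diff (a m) x) \<longlonglongrightarrow> list_diff b x"
proof -
  have "(\<lambda>m. \<Sum>(p, q)\<leftarrow>L. (-1) ^ length q * a m p) \<longlonglongrightarrow> (\<Sum>(p, q)\<leftarrow>L. (-1) ^ length q * b p)"
    if "\<And>p q. (p, q) \<in> set L \<Longrightarrow> (\<lambda>m. a m p) \<longlonglongrightarrow> b p" for L :: "('a list \<times> 'a list) list"
    using that by (induction L) (auto intro!: tendsto_intros)
  from this[of "splits x"] assms show ?thesis by (simp add: list_diff_def)
qed

lemma list_diff_minus: "list_diff (\<lambda>p. a p - b p) x = list_diff a x - list_diff b x"
proof -
  have "list_diff (\<lambda>p. a p - b p) x
      = sum_splits (\<lambda>p q. (-1) ^ length q * a p + - ((-1) ^ length q * b p)) x"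
    unfolding list_diff_def by (simp add: algebra_simps)
  then show ?thesis by (simp only: sum_splits_add sum_splits_minus list_diff_def)
qed

lemma sum_splits_const: "sum_splits (\<lambda>_ _. c) z = 2 ^ length z * (c :: ennreal)"
proof -
  have "sum_splits (\<lambda>_ _. c) z = sum_splits (\<lambda>a b. c * (pl (\<lambda>_. 1) a * pl (\<lambda>_. 1) b)) z"
    by (simp add: pl_const)
  then show ?thesis
    unfolding sum_splits_mult sum_splits_pl by (simp add: pl_const mult.commute)
qed

lemma ennreal_square_le:
  assumes "B\<^sup>2 \<le> ennreal r" "0 \<le> r"
  shows "B \<le> ennreal (sqrt r)"
proof (cases B)
  case (real b)
  then have "b\<^sup>2 \<le> r" using assms by (simp add: ennreal_power)
  then show ?thesis using real by (simp add: real_le_rsqrt ennreal_leI)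
next
  case top
  then show ?thesis using assms by (simp add: power2_eq_square ennreal_mult_eq_top_iff top_unique)
qed

section \<open>Almost everywhere integrable shifts, and L2 continuity of the kernels\<close>

context poisson_law
begin

lemma exhaustion:
  "\<exists>A :: nat \<Rightarrow> 'a set. (\<forall>k. A k \<in> sets X) \<and> (\<Union>k. A k) = space X \<and>
    (\<forall>k. emeasure lam (A k) < \<infinity>) \<and> incseq A"
proof -
  obtain A :: "nat \<Rightarrow> 'a set" where "range A \<subseteq> sets lam" "(\<Union>i. A i) = space lam"
    "\<And>i. emeasure lam (A i) \<noteq> \<infinity>" "incseq A"
    using sigma_finite_incseq by blast
  then show ?thesis by (intro exI[of _ A]) (auto simp: space_lam less_top)
qed

lemma nn_integral_LP_restr:
  assumes A [measurable]: "A \<in> sets X" "emeasure lam A < \<infinity>" and [measurable]: "F \<in> borel_measurable (list_space X)"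
  shows "(\<integral>\<^sup>+x. F x \<partial>LP (restr A)) = (\<integral>\<^sup>+x. indicator (lists A) x * F x \<partial>LP lam)"
  unfolding LP_restr[OF A] by (rule nn_integral_density) simp_all

lemma AE_LP_restr:
  assumes A: "A \<in> sets X" "emeasure lam A < \<infinity>"
  shows "(AE x in LP (restr A). P x) \<longleftrightarrow> (AE x in LP lam. x \<in> lists A \<longrightarrow> P x)"
proof -
  have [measurable]: "A \<in> sets X" by fact
  show ?thesis
    unfolding LP_restr[OF A] by (subst AE_density) (simp_all add: indicator_def)
qed

lemma AE_LP_exhaust:
  assumes A: "\<And>k. A k \<in> sets X" "(\<Union>k. A k) = space X" "\<And>k. emeasure lam (A k) < \<infinity>" "incseq A"
    and "\<And>k. AE x in LP (restr (A k)). P x"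
  shows "AE x in LP lam. P x"
proof -
  have "AE x in LP lam. \<forall>k. x \<in> lists (A k) \<longrightarrow> P x"
    unfolding AE_all_countable using assms(5) AE_LP_restr[OF A(1) A(3)] by blast
  then show ?thesis
    using AE_space
  proof eventually_elim
    case (elim x)
    then have "x \<in> lists (\<Union>k. A k)" by (simp add: space_LP space_lam A(2))
    then show ?case using elim(1) unfolding lists_incseq_UN[OF A(4), symmetric] by blast
  qed
qed

lemma nn_integral_LP_exhaust:
  assumes A: "\<And>k. A k \<in> sets X" "(\<Union>k. A k) = space X" "\<And>k. emeasure lam (A k) < \<infinity>" "incseq A"
    and F [measurable]: "F \<in> borel_measurable (list_space X)"
  shows "(\<integral>\<^sup>+x. F x \<partial>LP lam) = (SUP k. \<integral>\<^sup>+x. F x \<partial>LP (restr (A k)))"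
proof -
  note [measurable] = A(1)
  have "(\<integral>\<^sup>+x. F x \<partial>LP lam) = (\<integral>\<^sup>+x. (SUP k. indicator (lists (A k)) x * F x) \<partial>LP lam)"
  proof (rule nn_integral_cong)
    fix x assume "x \<in> space (LP lam)"
    then have "x \<in> (\<Union>k. lists (A k))"
      unfolding lists_incseq_UN[OF A(4)] by (simp add: space_LP space_lam A(2))
    then obtain k where k: "x \<in> lists (A k)" by blast
    have "F x \<le> (SUP k. indicator (lists (A k)) x * F x)"
      by (rule SUP_upper2[of k]) (use k in auto)
    moreover have "(SUP k. indicator (lists (A k)) x * F x) \<le> F x"
      by (rule SUP_least) (auto simp: indicator_def)
    ultimately show "F x = (SUP k. indicator (lists (A k)) x * F x)" by (rule antisym)
  qed
  also have "\<dots> = (SUP k. \<integral>\<^sup>+x. indicator (lists (A k)) x * F x \<partial>LP lam)"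
  proof (rule nn_integral_monotone_convergence_SUP)
    have "lists (A i) \<subseteq> lists (A j)" if "i \<le> j" for i j
      using A(4) that by (intro lists_mono) (auto simp: incseq_def)
    then show "incseq (\<lambda>k x. indicator (lists (A k)) x * F x)"
      by (auto simp: incseq_def le_fun_def indicator_def)
  qed simp
  finally show ?thesis by (simp only: nn_integral_LP_restr[OF A(1) A(3) F])
qed

definition L2 :: "('a measure \<Rightarrow> real) \<Rightarrow> bool" where
  "L2 f \<longleftrightarrow> f \<in> borel_measurable (config_space X) \<and> integrable Q (\<lambda>\<phi>. (f \<phi>)\<^sup>2)"

lemma L2_measurable [measurable_dest]: "L2 f \<Longrightarrow> f \<in> borel_measurable (config_space X)"
  by (simp add: L2_def)

lemma L2_dominated:
  assumes "L2 g" "f \<in> borel_measurable (config_space X)" "\<And>\<phi>. \<phi> \<in> config_set X \<Longrightarrow> \<bar>f \<phi>\<bar> \<le> \<bar>g \<phi>\<bar>"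
  shows "L2 f"
  unfolding L2_def
proof
  note [measurable] = assms(2)
  show "integrable Q (\<lambda>\<phi>. (f \<phi>)\<^sup>2)"
  proof (rule Bochner_Integration.integrable_bound)
    show "integrable Q (\<lambda>\<phi>. (g \<phi>)\<^sup>2)" using assms(1) by (simp add: L2_def)
    show "AE \<phi> in Q. norm ((f \<phi>)\<^sup>2) \<le> norm ((g \<phi>)\<^sup>2)"
      using assms(3) by (intro AE_I2) (simp add: abs_le_square_iff[symmetric] space_Q)
  qed measurable
qed fact

lemma L2_bounded:
  assumes "f \<in> borel_measurable (config_space X)" "\<And>\<phi>. \<bar>f \<phi>\<bar> \<le> K"
  shows "L2 f"
  by (rule L2_dominated[of "\<lambda>_. K"]) (use assms in \<open>auto simp: L2_def intro: order.trans[OF _ abs_ge_self]\<close>)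

lemma L2_diff:
  assumes "L2 f" "L2 g" shows "L2 (\<lambda>\<phi>. f \<phi> - g \<phi>)"
proof -
  have [measurable]: "f \<in> borel_measurable (config_space X)" "g \<in> borel_measurable (config_space X)"
    using assms by (auto simp: L2_def)
  have "(a - b)\<^sup>2 \<le> 2 * a\<^sup>2 + 2 * b\<^sup>2" for a b :: real
    using zero_le_power2[of "a + b"] by (simp add: power2_sum power2_diff)
  note b = this
  have "integrable Q (\<lambda>\<phi>. (f \<phi> - g \<phi>)\<^sup>2)"
  proof (rule Bochner_Integration.integrable_bound)
    show "integrable Q (\<lambda>\<phi>. 2 * (f \<phi>)\<^sup>2 + 2 * (g \<phi>)\<^sup>2)" using assms by (simp add: L2_def)
    show "AE \<phi> in Q. norm ((f \<phi> - g \<phi>)\<^sup>2) \<le> norm (2 * (f \<phi>)\<^sup>2 + 2 * (g \<phi>)\<^sup>2)"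
      using b by (intro AE_I2) simp
  qed measurable
  then show ?thesis by (simp add: L2_def)
qed

text \<open>Merging the added points with the points of the process in \<open>A\<close> gives a
  single integral with weight \<open>2 ^ length z\<close>, the number of splittings of
  \<open>z\<close>. The inequality \<open>a b \<le> a^2 + b^2\<close> separates this weight from
  \<open>f\<close> and leaves \<open>4 ^ length z\<close>, which is integrable because
  \<open>A\<close> has finite intensity.\<close>

lemma AE_integrable_shift_restr:
  assumes f: "L2 f" and A [measurable]: "A \<in> sets X" and fin: "emeasure lam A < \<infinity>"
  shows "AE x in LP (restr A). \<forall>(p, q)\<in>set (splits x). integrable Q (\<lambda>\<phi>. f (addl \<phi> p))"
proof -
  interpret V: finite_measure "void A" by (rule finite_measure_void[OF A])
  interpret mu: finite_measure "restr A"
    unfolding restr_def by (rule finite_measure_restriction[OF A fin])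
  interpret L: sigma_finite_measure "LP (restr A)" by (rule mu.sigma_finite_LP)
  note [measurable] = L2_measurable[OF f]
  have spl: "space (LP (restr A)) = lists (space X)"
    by (simp add: space_LP sets_eq_imp_space_eq[OF sets_restr])
  define G where "G z = (\<integral>\<^sup>+\<phi>. ennreal \<bar>f (addl \<phi> z)\<bar> \<partial>void A)" for z
  have Gm [measurable]: "G \<in> borel_measurable (list_space X)" unfolding G_def by measurable
  have Gs: "G x = G y" if "mset x = mset y" for x y
    unfolding G_def using addl_perm[OF that] by simp
  have "(\<integral>\<^sup>+x. \<integral>\<^sup>+\<phi>. ennreal \<bar>f (addl \<phi> x)\<bar> \<partial>Q \<partial>LP (restr A))
      = (\<integral>\<^sup>+x. \<integral>\<^sup>+y. G (x @ y) \<partial>LP (restr A) \<partial>LP (restr A))"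
  proof (rule nn_integral_cong)
    fix x assume "x \<in> space (LP (restr A))"
    then have x: "x \<in> lists (space X)" using spl by simp
    note [measurable] = const_list_X[OF x]
    have "(\<integral>\<^sup>+\<phi>. ennreal \<bar>f (addl \<phi> x)\<bar> \<partial>Q) = (\<integral>\<^sup>+y. \<integral>\<^sup>+\<phi>. ennreal \<bar>f (addl (addl \<phi> y) x)\<bar> \<partial>void A \<partial>LP (restr A))"
      unfolding restr_def by (rule nn_integral_Q_LP[OF A fin]) measurable
    also have "\<dots> = (\<integral>\<^sup>+y. G (y @ x) \<partial>LP (restr A))" by (simp add: G_def addl_append)
    also have "\<dots> = (\<integral>\<^sup>+y. G (x @ y) \<partial>LP (restr A))" by (intro nn_integral_cong Gs) simp
    finally show "(\<integral>\<^sup>+\<phi>. ennreal \<bar>f (addl \<phi> x)\<bar> \<partial>Q) = (\<integral>\<^sup>+y. G (x @ y) \<partial>LP (restr A))" .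
  qed
  also have "\<dots> = (\<integral>\<^sup>+z. sum_splits (\<lambda>x y. G (x @ y)) z \<partial>LP (restr A))"
    by (rule mu.nn_integral_LP_sum_splits[symmetric]) (simp add: list_space_restr)
  also have "\<dots> = (\<integral>\<^sup>+z. 2 ^ length z * G z \<partial>LP (restr A))"
  proof (rule nn_integral_cong)
    fix z
    have "sum_splits (\<lambda>x y. G (x @ y)) z = sum_splits (\<lambda>_ _. G z) z"
      by (rule sum_splits_cong, rule Gs) (simp add: mset_splits)
    then show "sum_splits (\<lambda>x y. G (x @ y)) z = 2 ^ length z * G z" by (simp only: sum_splits_const)
  qed
  also have "\<dots> \<le> (\<integral>\<^sup>+z. \<integral>\<^sup>+\<phi>. ennreal (pl (\<lambda>_. 4) z) + ennreal ((f (addl \<phi> z))\<^sup>2) \<partial>void A \<partial>LP (restr A))"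
  proof (rule nn_integral_mono)
    fix z assume "z \<in> space (LP (restr A))"
    then have z: "z \<in> lists (space X)" using spl by simp
    note [measurable] = const_list_X[OF z]
    have "2 ^ length z * G z = (\<integral>\<^sup>+\<phi>. 2 ^ length z * ennreal \<bar>f (addl \<phi> z)\<bar> \<partial>void A)"
      unfolding G_def by (rule nn_integral_cmult[symmetric]) measurable
    also have "\<dots> \<le> (\<integral>\<^sup>+\<phi>. ennreal (pl (\<lambda>_. 4) z) + ennreal ((f (addl \<phi> z))\<^sup>2) \<partial>void A)"
    proof (rule nn_integral_mono)
      fix \<phi> :: "'a measure"
      have "a * b \<le> a\<^sup>2 + b\<^sup>2" if "0 \<le> a" "0 \<le> b" for a b :: real
        using zero_le_power2[of "a - b"] mult_nonneg_nonneg[OF that] by (simp add: power2_diff)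
      from this[of "2 ^ length z" "\<bar>f (addl \<phi> z)\<bar>"]
      have "2 ^ length z * \<bar>f (addl \<phi> z)\<bar> \<le> pl (\<lambda>_. 4) z + (f (addl \<phi> z))\<^sup>2"
        by (simp add: pl_const power_mult[symmetric] mult.commute[of _ 2]) (simp add: power_mult)
      then have "ennreal (2 ^ length z * \<bar>f (addl \<phi> z)\<bar>) \<le> ennreal (pl (\<lambda>_. 4) z + (f (addl \<phi> z))\<^sup>2)"
        by (rule ennreal_leI)
      then show "2 ^ length z * ennreal \<bar>f (addl \<phi> z)\<bar> \<le> ennreal (pl (\<lambda>_. 4) z) + ennreal ((f (addl \<phi> z))\<^sup>2)"
        by (simp add: ennreal_mult' ennreal_power[symmetric] pl_nonneg ennreal_plus)
    qed
    finally show "2 ^ length z * G z \<le> (\<integral>\<^sup>+\<phi>. ennreal (pl (\<lambda>_. 4) z) + ennreal ((f (addl \<phi> z))\<^sup>2) \<partial>void A)" .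
  qed
  also have "\<dots> = (\<integral>\<^sup>+z. \<integral>\<^sup>+\<phi>. ennreal (pl (\<lambda>_. 4) z) \<partial>void A \<partial>LP (restr A))
      + (\<integral>\<^sup>+z. \<integral>\<^sup>+\<phi>. ennreal ((f (addl \<phi> z))\<^sup>2) \<partial>void A \<partial>LP (restr A))"
  proof -
    have "(\<integral>\<^sup>+z. \<integral>\<^sup>+\<phi>. ennreal (pl (\<lambda>_. 4) z) + ennreal ((f (addl \<phi> z))\<^sup>2) \<partial>void A \<partial>LP (restr A))
        = (\<integral>\<^sup>+z. (\<integral>\<^sup>+\<phi>. ennreal (pl (\<lambda>_. 4) z) \<partial>void A) + (\<integral>\<^sup>+\<phi>. ennreal ((f (addl \<phi> z))\<^sup>2) \<partial>void A) \<partial>LP (restr A))"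
    proof (rule nn_integral_cong)
      fix z assume "z \<in> space (LP (restr A))"
      then have z: "z \<in> lists (space X)" using spl by simp
      note [measurable] = const_list_X[OF z]
      show "(\<integral>\<^sup>+\<phi>. ennreal (pl (\<lambda>_. 4) z) + ennreal ((f (addl \<phi> z))\<^sup>2) \<partial>void A)
        = (\<integral>\<^sup>+\<phi>. ennreal (pl (\<lambda>_. 4) z) \<partial>void A) + (\<integral>\<^sup>+\<phi>. ennreal ((f (addl \<phi> z))\<^sup>2) \<partial>void A)"
        by (rule nn_integral_add) measurable
    qed
    also have "\<dots> = (\<integral>\<^sup>+z. \<integral>\<^sup>+\<phi>. ennreal (pl (\<lambda>_. 4) z) \<partial>void A \<partial>LP (restr A))
      + (\<integral>\<^sup>+z. \<integral>\<^sup>+\<phi>. ennreal ((f (addl \<phi> z))\<^sup>2) \<partial>void A \<partial>LP (restr A))"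
      by (rule nn_integral_add) measurable
    finally show ?thesis .
  qed
  also have "\<dots> < \<infinity>"
  proof -
    have "(\<integral>\<^sup>+z. \<integral>\<^sup>+\<phi>. ennreal (pl (\<lambda>_. 4) z) \<partial>void A \<partial>LP (restr A))
        = (\<integral>\<^sup>+z. ennreal (pl (\<lambda>_. 4) z) \<partial>LP (restr A)) * emeasure (void A) (space (void A))"
      by (simp add: nn_integral_multc)
    also have "\<dots> < \<infinity>"
      using mu.integrable_pl[OF mu.integrable_one[of 4]]
      by (simp add: integrable_iff_bounded ennreal_mult_less_top pl_const V.emeasure_eq_measure)
    finally have 1: "(\<integral>\<^sup>+z. \<integral>\<^sup>+\<phi>. ennreal (pl (\<lambda>_. 4) z) \<partial>void A \<partial>LP (restr A)) < \<infinity>" .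
    have "(\<integral>\<^sup>+z. \<integral>\<^sup>+\<phi>. ennreal ((f (addl \<phi> z))\<^sup>2) \<partial>void A \<partial>LP (restr A)) = (\<integral>\<^sup>+\<phi>. ennreal ((f \<phi>)\<^sup>2) \<partial>Q)"
      unfolding restr_def by (rule nn_integral_Q_LP[OF A fin, symmetric]) measurable
    also have "\<dots> < \<infinity>" using f by (simp add: L2_def integrable_iff_bounded)
    finally show ?thesis using 1 by (simp add: ennreal_add_less_top)
  qed
  finally have "(\<integral>\<^sup>+x. \<integral>\<^sup>+\<phi>. ennreal \<bar>f (addl \<phi> x)\<bar> \<partial>Q \<partial>LP (restr A)) \<noteq> \<infinity>" by simp
  then have "AE x in LP (restr A). (\<integral>\<^sup>+\<phi>. ennreal \<bar>f (addl \<phi> x)\<bar> \<partial>Q) \<noteq> \<infinity>"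
    by (intro nn_integral_PInf_AE) measurable
  then have "AE x in LP (restr A). integrable Q (\<lambda>\<phi>. f (addl \<phi> x))"
    using AE_space
  proof eventually_elim
    case (elim x)
    then have x: "x \<in> lists (space X)" using spl by simp
    note [measurable] = const_list_X[OF x]
    show ?case using elim(1) by (intro integrableI_bounded) (simp_all add: less_top)
  qed
  then show ?thesis by (rule mu.AE_LP_splits)
qed

lemma AE_integrable_shift:
  assumes f: "L2 f"
  shows "AE x in LP lam. \<forall>(p, q)\<in>set (splits x). integrable Q (\<lambda>\<phi>. f (addl \<phi> p))"
proof -
  obtain A :: "nat \<Rightarrow> 'a set" where A: "\<And>k. A k \<in> sets X" "(\<Union>k. A k) = space X"
    "\<And>k. emeasure lam (A k) < \<infinity>" "incseq A"
    using exhaustion by blast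
  show ?thesis
    by (rule AE_LP_exhaust[OF A]) (rule AE_integrable_shift_restr[OF f A(1,3)])
qed

lemma chaos_clip_tendsto:
  assumes "\<forall>(p, q)\<in>set (splits x). integrable N (\<lambda>\<phi>. f (addl \<phi> p))"
  shows "(\<lambda>m. chaos N (clip m f) x) \<longlonglongrightarrow> chaos N f x"
  unfolding chaos_def
proof (rule tendsto_list_diff)
  fix p q assume "(p, q) \<in> set (splits x)"
  then have "integrable N (\<lambda>\<phi>. f (addl \<phi> p))" using assms by auto
  from integral_clip_tendsto[OF this]
  show "(\<lambda>m. shift_mean N (clip m f) p) \<longlonglongrightarrow> shift_mean N f p"
    by (simp add: shift_mean_def clip_def)
qed

text \<open>Truncations obey the bounded case on every set of finite intensity; Fatou's lemma
  removes the truncation and monotone convergence lets the sets exhaust the space.\<close>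

lemma chaos_square:
  assumes f: "L2 f"
  shows "(\<integral>\<^sup>+x. ennreal ((chaos Q f x)\<^sup>2) \<partial>LP lam) \<le> ennreal (\<integral>\<phi>. (f \<phi>)\<^sup>2 \<partial>Q)"
proof -
  obtain A :: "nat \<Rightarrow> 'a set" where A: "\<And>k. A k \<in> sets X" "(\<Union>k. A k) = space X"
    "\<And>k. emeasure lam (A k) < \<infinity>" "incseq A"
    using exhaustion by blast
  note [measurable] = L2_measurable[OF f]
  have "(\<integral>\<^sup>+x. ennreal ((chaos Q f x)\<^sup>2) \<partial>LP (restr (A k))) \<le> ennreal (\<integral>\<phi>. (f \<phi>)\<^sup>2 \<partial>Q)" for k
  proof -
    have "(\<integral>\<^sup>+x. ennreal ((chaos Q f x)\<^sup>2) \<partial>LP (restr (A k)))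
        = (\<integral>\<^sup>+x. liminf (\<lambda>m. ennreal ((chaos Q (clip m f) x)\<^sup>2)) \<partial>LP (restr (A k)))"
    proof (rule nn_integral_cong_AE)
      show "AE x in LP (restr (A k)). ennreal ((chaos Q f x)\<^sup>2) = liminf (\<lambda>m. ennreal ((chaos Q (clip m f) x)\<^sup>2))"
        using AE_integrable_shift_restr[OF f A(1,3), of k]
      proof eventually_elim
        case (elim x)
        have "(\<lambda>m. ennreal ((chaos Q (clip m f) x)\<^sup>2)) \<longlonglongrightarrow> ennreal ((chaos Q f x)\<^sup>2)"
          by (intro tendsto_intros chaos_clip_tendsto elim)
        then show ?case by (intro lim_imp_Liminf[symmetric]) simp
      qed
    qed
    also have "\<dots> \<le> liminf (\<lambda>m. \<integral>\<^sup>+x. ennreal ((chaos Q (clip m f) x)\<^sup>2) \<partial>LP (restr (A k)))"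
      by (rule nn_integral_liminf) measurable
    also have "\<dots> \<le> liminf (\<lambda>m. ennreal (\<integral>\<phi>. (f \<phi>)\<^sup>2 \<partial>Q))"
    proof (rule Liminf_mono, rule always_eventually, rule allI)
      fix m
      have "(\<integral>\<^sup>+x. ennreal ((chaos Q (clip m f) x)\<^sup>2) \<partial>LP (restr (A k))) \<le> ennreal (\<integral>\<phi>. (clip m f \<phi>)\<^sup>2 \<partial>Q)"
        by (rule chaos_square_bounded[OF _ clip_bound A(1,3)]) measurable
      also have "\<dots> \<le> ennreal (\<integral>\<phi>. (f \<phi>)\<^sup>2 \<partial>Q)"
      proof (intro ennreal_leI integral_mono)
        show "integrable Q (\<lambda>\<phi>. (f \<phi>)\<^sup>2)" using f by (simp add: L2_def)
        have "L2 (clip m f)" by (rule L2_bounded[OF _ clip_bound]) measurable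
        then show "integrable Q (\<lambda>\<phi>. (clip m f \<phi>)\<^sup>2)" by (simp add: L2_def)
        show "(clip m f \<phi>)\<^sup>2 \<le> (f \<phi>)\<^sup>2" for \<phi> by (simp add: abs_le_square_iff[symmetric] abs_clip_le)
      qed
      finally show "(\<integral>\<^sup>+x. ennreal ((chaos Q (clip m f) x)\<^sup>2) \<partial>LP (restr (A k))) \<le> ennreal (\<integral>\<phi>. (f \<phi>)\<^sup>2 \<partial>Q)" .
    qed
    also have "\<dots> = ennreal (\<integral>\<phi>. (f \<phi>)\<^sup>2 \<partial>Q)" by (simp add: Liminf_const)
    finally show ?thesis .
  qed
  then show ?thesis
    by (subst nn_integral_LP_exhaust[OF A]) (auto intro!: SUP_least)
qed

text \<open>Additivity of the integral needs both shifts to be integrable, which is known for almost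
  every list only.\<close>

lemma chaos_diff:
  assumes f: "L2 f" and g: "L2 g"
  shows "AE x in LP lam. chaos Q (\<lambda>\<phi>. f \<phi> - g \<phi>) x = chaos Q f x - chaos Q g x"
  using AE_integrable_shift[OF f] AE_integrable_shift[OF g]
proof eventually_elim
  case (elim x)
  have "chaos Q (\<lambda>\<phi>. f \<phi> - g \<phi>) x = list_diff (\<lambda>p. shift_mean Q f p - shift_mean Q g p) x"
    unfolding chaos_def
  proof (rule list_diff_cong)
    fix p q assume "(p, q) \<in> set (splits x)"
    then have "integrable Q (\<lambda>\<phi>. f (addl \<phi> p))" "integrable Q (\<lambda>\<phi>. g (addl \<phi> p))"
      using elim by auto
    then show "shift_mean Q (\<lambda>\<phi>. f \<phi> - g \<phi>) p = shift_mean Q f p - shift_mean Q g p"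
      unfolding shift_mean_def by (rule Bochner_Integration.integral_diff)
  qed
  then show ?case by (simp add: list_diff_minus chaos_def)
qed

text \<open>Cauchy-Schwarz on the list space. The kernel is bounded by the Bessel inequality, and
  the squared norm of the product is again a product, with exponential integral.\<close>

lemma chaos_pl_bound:
  assumes f: "L2 f" and v [measurable]: "v \<in> borel_measurable X" and v2: "integrable lam (\<lambda>y. (v y)\<^sup>2)"
  shows "(\<integral>\<^sup>+x. ennreal (\<bar>chaos Q f x\<bar> * pl (\<lambda>y. \<bar>v y\<bar>) x) \<partial>LP lam)
    \<le> ennreal (sqrt ((\<integral>\<phi>. (f \<phi>)\<^sup>2 \<partial>Q) * exp (\<integral>y. (v y)\<^sup>2 \<partial>lam)))"
proof (rule ennreal_square_le)
  note [measurable] = L2_measurable[OF f]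
  have vl [measurable]: "v \<in> borel_measurable lam" by simp
  have [measurable]: "pl (\<lambda>y. \<bar>v y\<bar>) \<in> borel_measurable (list_space X)"
    by (rule pl_measurable_real) measurable
  have "(\<integral>\<^sup>+x. ennreal (\<bar>chaos Q f x\<bar> * pl (\<lambda>y. \<bar>v y\<bar>) x) \<partial>LP lam)\<^sup>2
      = (\<integral>\<^sup>+x. ennreal \<bar>chaos Q f x\<bar> * ennreal (pl (\<lambda>y. \<bar>v y\<bar>) x) \<partial>LP lam)\<^sup>2"
    by (simp add: ennreal_mult' pl_nonneg)
  also have "\<dots> \<le> (\<integral>\<^sup>+x. (ennreal \<bar>chaos Q f x\<bar>)\<^sup>2 \<partial>LP lam) * (\<integral>\<^sup>+x. (ennreal (pl (\<lambda>y. \<bar>v y\<bar>) x))\<^sup>2 \<partial>LP lam)"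
    by (rule Cauchy_Schwarz_nn_integral) measurable
  also have "(\<integral>\<^sup>+x. (ennreal \<bar>chaos Q f x\<bar>)\<^sup>2 \<partial>LP lam) = (\<integral>\<^sup>+x. ennreal ((chaos Q f x)\<^sup>2) \<partial>LP lam)"
    by (simp add: ennreal_power)
  also have "(\<integral>\<^sup>+x. (ennreal (pl (\<lambda>y. \<bar>v y\<bar>) x))\<^sup>2 \<partial>LP lam) = (\<integral>\<^sup>+x. ennreal (pl (\<lambda>y. (v y)\<^sup>2) x) \<partial>LP lam)"
    by (simp add: ennreal_power pl_nonneg pl_square)
  also have "\<dots> = ennreal (exp (\<integral>y. (v y)\<^sup>2 \<partial>lam))"
    using nn_integral_eq_integral[OF integrable_pl[OF v2]] integral_LP_pl[OF v2] by (simp add: pl_nonneg)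
  also have "(\<integral>\<^sup>+x. ennreal ((chaos Q f x)\<^sup>2) \<partial>LP lam) * ennreal (exp (\<integral>y. (v y)\<^sup>2 \<partial>lam))
      \<le> ennreal (\<integral>\<phi>. (f \<phi>)\<^sup>2 \<partial>Q) * ennreal (exp (\<integral>y. (v y)\<^sup>2 \<partial>lam))"
    by (rule mult_right_mono[OF chaos_square[OF f]]) simp
  also have "\<dots> = ennreal ((\<integral>\<phi>. (f \<phi>)\<^sup>2 \<partial>Q) * exp (\<integral>y. (v y)\<^sup>2 \<partial>lam))"
    by (rule ennreal_mult[symmetric]) simp_all
  finally show "(\<integral>\<^sup>+x. ennreal (\<bar>chaos Q f x\<bar> * pl (\<lambda>y. \<bar>v y\<bar>) x) \<partial>LP lam)\<^sup>2
    \<le> ennreal ((\<integral>\<phi>. (f \<phi>)\<^sup>2 \<partial>Q) * exp (\<integral>y. (v y)\<^sup>2 \<partial>lam))" .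
qed simp

lemma chaos_pl_integrable:
  assumes f: "L2 f" and v [measurable]: "v \<in> borel_measurable X" and v2: "integrable lam (\<lambda>y. (v y)\<^sup>2)"
  shows "integrable (LP lam) (\<lambda>x. chaos Q f x * pl v x)"
proof (rule integrableI_bounded)
  note [measurable] = L2_measurable[OF f]
  have [measurable]: "v \<in> borel_measurable lam" by simp
  have [measurable]: "pl v \<in> borel_measurable (list_space X)"
    by (rule pl_measurable_real) measurable
  show "(\<lambda>x. chaos Q f x * pl v x) \<in> borel_measurable (LP lam)" by measurable
  have "(\<integral>\<^sup>+x. norm (chaos Q f x * pl v x) \<partial>LP lam) = (\<integral>\<^sup>+x. ennreal (\<bar>chaos Q f x\<bar> * pl (\<lambda>y. \<bar>v y\<bar>) x) \<partial>LP lam)"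
    by (simp add: abs_mult abs_pl)
  also have "\<dots> < \<infinity>"
    using chaos_pl_bound[OF f v v2] by (rule order.strict_trans1) simp
  finally show "(\<integral>\<^sup>+x. norm (chaos Q f x * pl v x) \<partial>LP lam) < \<infinity>" .
qed

text \<open>By linearity the difference of the kernels is the kernel of \<open>f m - g\<close>, to
  which the weighted bound applies. All later limits of events, simple functions and truncations
  pass through the kernels by this continuity.\<close>

lemma chaos_pl_converges:
  assumes f: "\<And>m. L2 (f m)" "L2 g" and lim: "(\<lambda>m. \<integral>\<phi>. (f m \<phi> - g \<phi>)\<^sup>2 \<partial>Q) \<longlonglongrightarrow> 0"
    and v [measurable]: "v \<in> borel_measurable X" and v2: "integrable lam (\<lambda>y. (v y)\<^sup>2)"
  shows "(\<lambda>m. \<integral>\<^sup>+x. ennreal (\<bar>chaos Q (f m) x - chaos Q g x\<bar> * pl (\<lambda>y. \<bar>v y\<bar>) x) \<partial>LP lam) \<longlonglongrightarrow> 0"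
    and "(\<lambda>m. \<integral>x. chaos Q (f m) x * pl v x \<partial>LP lam) \<longlonglongrightarrow> (\<integral>x. chaos Q g x * pl v x \<partial>LP lam)"
proof -
  let ?N = "\<lambda>m. \<integral>\<^sup>+x. ennreal (\<bar>chaos Q (f m) x - chaos Q g x\<bar> * pl (\<lambda>y. \<bar>v y\<bar>) x) \<partial>LP lam"
  let ?B = "\<lambda>m. sqrt ((\<integral>\<phi>. (f m \<phi> - g \<phi>)\<^sup>2 \<partial>Q) * exp (\<integral>y. (v y)\<^sup>2 \<partial>lam))"
  have N: "?N m \<le> ennreal (?B m)" for m
  proof -
    have "?N m = (\<integral>\<^sup>+x. ennreal (\<bar>chaos Q (\<lambda>\<phi>. f m \<phi> - g \<phi>) x\<bar> * pl (\<lambda>y. \<bar>v y\<bar>) x) \<partial>LP lam)"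
      by (rule nn_integral_cong_AE) (use chaos_diff[OF f(1)[of m] f(2)] in eventually_elim, simp)
    also have "\<dots> \<le> ennreal (?B m)" by (rule chaos_pl_bound[OF L2_diff[OF f] v v2])
    finally show ?thesis .
  qed
  have B: "?B \<longlonglongrightarrow> 0"
    using tendsto_real_sqrt[OF tendsto_mult_left[OF lim, of "exp (\<integral>y. (v y)\<^sup>2 \<partial>lam)"]] by (simp add: mult.commute)
  have "(\<lambda>m. ennreal (?B m)) \<longlonglongrightarrow> 0" using tendsto_ennrealI[OF B] by simp
  then show "?N \<longlonglongrightarrow> 0"
    by (rule tendsto_sandwich[OF _ _ tendsto_const, rotated 2]) (simp_all add: N)
  show "(\<lambda>m. \<integral>x. chaos Q (f m) x * pl v x \<partial>LP lam) \<longlonglongrightarrow> (\<integral>x. chaos Q g x * pl v x \<partial>LP lam)"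
  proof (rule Lim_transform_bound[OF _ B, THEN LIM_zero_cancel])
    have "norm ((\<integral>x. chaos Q (f m) x * pl v x \<partial>LP lam) - (\<integral>x. chaos Q g x * pl v x \<partial>LP lam)) \<le> ?B m" for m
    proof -
      note i = chaos_pl_integrable[OF f(1)[of m] v v2] chaos_pl_integrable[OF f(2) v v2]
      have "ennreal (norm ((\<integral>x. chaos Q (f m) x * pl v x \<partial>LP lam) - (\<integral>x. chaos Q g x * pl v x \<partial>LP lam)))
          = ennreal (norm (\<integral>x. (chaos Q (f m) x - chaos Q g x) * pl v x \<partial>LP lam))"
        by (simp add: Bochner_Integration.integral_diff[OF i, symmetric] left_diff_distrib)
      also have "\<dots> \<le> (\<integral>\<^sup>+x. norm ((chaos Q (f m) x - chaos Q g x) * pl v x) \<partial>LP lam)"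
        by (rule integral_norm_bound_ennreal) (use Bochner_Integration.integrable_diff[OF i] in \<open>simp add: left_diff_distrib\<close>)
      also have "\<dots> = ?N m" by (simp add: abs_mult abs_pl)
      also note N
      finally show ?thesis by (subst (asm) ennreal_le_iff) auto
    qed
    from order.trans[OF this abs_ge_self]
    show "\<forall>\<^sub>F m in sequentially. norm ((\<integral>x. chaos Q (f m) x * pl v x \<partial>LP lam) - (\<integral>x. chaos Q g x * pl v x \<partial>LP lam)) \<le> norm (?B m)"
      by (intro always_eventually allI) (simp only: real_norm_def)
  qed
qed

end

section \<open>Changing the intensity measure\<close>

lemma prob_space_poisson_dist: "prob_space (poisson_dist c)"
  unfolding poisson_dist_def
  by (auto intro!: prob_space_return prob_space.prob_space_distr prob_space_measure_pmf)

definition poisson_mass :: "ennreal \<Rightarrow> ennreal \<Rightarrow> real" where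
  "poisson_mass c k = measure (poisson_dist c) {k}"

lemma poisson_mass_nat: "0 \<le> c \<Longrightarrow> poisson_mass (ennreal c) (of_nat k) = c ^ k / fact k * exp (- c)"
  by (simp add: poisson_mass_def measure_def poisson_dist_nat)

lemma poisson_mass_infinity: "0 \<le> c \<Longrightarrow> poisson_mass (ennreal c) \<infinity> = 0"
  using poisson_dist_infinity[of c] by (simp add: poisson_mass_def measure_def)

text \<open>Continuity is along finite parameters: the weight of \<open>\<infinity>\<close> is 0 for
  each of them but 1 for an infinite parameter. Blocks of infinite intensity are therefore treated
  apart.\<close>

lemma poisson_mass_tendsto:
  assumes c: "\<And>n. 0 \<le> c n" "0 \<le> d" "c \<longlonglongrightarrow> d" and k: "k \<in> counts"
  shows "(\<lambda>n. poisson_mass (ennreal (c n)) k) \<longlonglongrightarrow> poisson_mass (ennreal d) k"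
proof -
  consider "k = \<infinity>" | j where "k = of_nat j" using k by (auto simp: counts_def)
  then show ?thesis
  proof cases
    case 1
    then show ?thesis using c by (simp add: poisson_mass_infinity[unfolded infinity_ennreal_def])
  next
    case (2 j)
    have "(\<lambda>n. c n ^ j / fact j * exp (- c n)) \<longlonglongrightarrow> d ^ j / fact j * exp (- d)"
      by (intro tendsto_intros c(3)) simp
    then show ?thesis using c 2 by (simp add: poisson_mass_nat)
  qed
qed

lemma (in poisson_law) measure_poisson_partition:
  assumes P: "measurable_partition X A P"
  shows "measure Q (partition_event X P k) = (\<Prod>C\<in>P. poisson_mass (emeasure lam C) (k C))"
proof -
  have "emeasure (poisson_dist c) S = ennreal (measure (poisson_dist c) S)" for c S
  proof -
    interpret p: prob_space "poisson_dist c" by (rule prob_space_poisson_dist)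
    show ?thesis by (rule p.emeasure_eq_measure)
  qed
  then have "emeasure Q (partition_event X P k) = ennreal (\<Prod>C\<in>P. poisson_mass (emeasure lam C) (k C))"
    unfolding emeasure_poisson_partition[OF law P] by (simp add: prod_ennreal poisson_mass_def)
  then show ?thesis by (simp add: measure_def prod_nonneg poisson_mass_def)
qed

section \<open>Intensities with a density relative to rho, and their local approximations\<close>

locale poisson_family =
  fixes X :: "'a measure" and Q :: "'a measure \<Rightarrow> 'a measure measure"
  assumes law: "\<And>mu. sigma_finite_measure mu \<Longrightarrow> sets mu = sets X \<Longrightarrow> is_poisson_law X mu (Q mu)"

lemma (in poisson_family) poisson_law:
  "sigma_finite_measure mu \<Longrightarrow> sets mu = sets X \<Longrightarrow> poisson_law mu X (Q mu)"
  by (simp add: poisson_law_def poisson_law_axioms_def law)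

locale intensity_change = poisson_family X Q + sigma_finite_measure rho
  for X :: "'a measure" and Q and rho :: "'a measure" +
  fixes h :: "'a \<Rightarrow> real"
  assumes sets_rho: "sets rho = sets X"
    and h_measurable [measurable]: "h \<in> borel_measurable X"
    and h_nonneg: "\<And>x. 0 \<le> h x"
    and h_square: "integrable rho (\<lambda>y. (h y - 1)\<^sup>2)"

sublocale intensity_change \<subseteq> r: poisson_law rho X "Q rho"
  by (rule poisson_law[OF sigma_finite_measure_axioms sets_rho])

context intensity_change
begin

definition lam :: "'a measure" where
  "lam = density rho (\<lambda>x. ennreal (h x))"

text \<open>Gives the intermediate intensity that is already changed inside \<open>A\<close> and
  still \<open>rho\<close> outside. The local formula applies to it when \<open>A\<close> has finite
  intensity, and it approaches \<open>lam\<close> as \<open>A\<close> grows.\<close>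

definition local_density :: "'a set \<Rightarrow> 'a \<Rightarrow> real" where
  "local_density A x = (if x \<in> A then h x else 1)"

definition local_lam :: "'a set \<Rightarrow> 'a measure" where
  "local_lam A = density rho (\<lambda>x. ennreal (local_density A x))"

lemma local_density_measurable [measurable]:
  assumes [measurable]: "A \<in> sets X"
  shows "local_density A \<in> borel_measurable X"
  unfolding local_density_def by measurable

lemma sigma_finite_density_real:
  assumes [measurable]: "g \<in> borel_measurable X"
  shows "sigma_finite_measure (density rho (\<lambda>x. ennreal (g x)))"
  by (subst sigma_finite_iff_density_finite) auto

lemma poisson_law_lam: "poisson_law lam X (Q lam)"
  unfolding lam_def by (rule poisson_law[OF sigma_finite_density_real]) simp_all

lemma poisson_law_local_lam: "A \<in> sets X \<Longrightarrow> poisson_law (local_lam A) X (Q (local_lam A))"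
  unfolding local_lam_def by (rule poisson_law[OF sigma_finite_density_real]) simp_all

end

sublocale intensity_change \<subseteq> l: poisson_law lam X "Q lam"
  by (rule poisson_law_lam)

context intensity_change
begin

lemma integrable_on_finite:
  assumes [measurable]: "g \<in> borel_measurable X" "C \<in> sets X" and fin: "emeasure rho C < \<infinity>"
    and le: "\<And>x. \<bar>g x\<bar> \<le> 2 + (h x - 1)\<^sup>2"
  shows "integrable rho (\<lambda>x. indicator C x * g x)"
proof (rule Bochner_Integration.integrable_bound)
  show "integrable rho (\<lambda>x. 2 * indicator C x + (h x - 1)\<^sup>2)"
    using fin h_square by (intro Bochner_Integration.integrable_add integrable_mult_right integrable_real_indicator) auto
  show "AE x in rho. norm (indicator C x * g x) \<le> norm (2 * indicator C x + (h x - 1)\<^sup>2)"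
    using le by (intro AE_I2) (auto simp: indicator_def intro: order.trans[OF _ abs_ge_self])
qed measurable

text \<open>If the new mass of \<open>C\<close> were finite, the pointwise bound of 1 by
  \<open>g\<close> and \<open>(h - 1)^2\<close> would make the mass of \<open>C\<close> under
  \<open>rho\<close> finite. Thus an infinite block stays infinite for \<open>lam\<close> and for
  all its local approximations.\<close>

lemma emeasure_density_infinite:
  assumes [measurable]: "g \<in> borel_measurable X" "C \<in> sets X" and inf: "emeasure rho C = \<infinity>"
    and g: "\<And>x. 0 \<le> g x" "\<And>x. (g x - 1)\<^sup>2 \<le> (h x - 1)\<^sup>2"
  shows "emeasure (density rho (\<lambda>x. ennreal (g x))) C = \<infinity>"
proof -
  \<comment> \<open>The difference of the two sides is \<open>4 (a - 3/4)^2 + 3/4\<close>.\<close>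
  have pw: "1 \<le> 2 * a + 4 * (a - 1)\<^sup>2" if "0 \<le> a" for a :: real
    using that zero_le_power2[of "a - 3/4"] by (simp add: power2_diff algebra_simps power2_eq_square)
  have "emeasure rho C = (\<integral>\<^sup>+x. indicator C x \<partial>rho)" by simp
  also have "\<dots> \<le> (\<integral>\<^sup>+x. 2 * (ennreal (g x) * indicator C x) + 4 * ennreal ((h x - 1)\<^sup>2) \<partial>rho)"
  proof (rule nn_integral_mono)
    fix x
    have "1 \<le> 2 * g x + 4 * (h x - 1)\<^sup>2" using pw[OF g(1)[of x]] g(2)[of x] by simp
    then have "ennreal 1 \<le> ennreal (2 * g x + 4 * (h x - 1)\<^sup>2)" by (rule ennreal_leI)
    also have "\<dots> = 2 * ennreal (g x) + 4 * ennreal ((h x - 1)\<^sup>2)"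
      using g(1)[of x] by (simp add: ennreal_plus ennreal_mult)
    finally show "indicator C x \<le> 2 * (ennreal (g x) * indicator C x) + 4 * ennreal ((h x - 1)\<^sup>2)"
      by (auto simp: indicator_def)
  qed
  also have "\<dots> = 2 * emeasure (density rho (\<lambda>x. ennreal (g x))) C + 4 * (\<integral>\<^sup>+x. ennreal ((h x - 1)\<^sup>2) \<partial>rho)"
    by (simp add: nn_integral_add nn_integral_cmult emeasure_density)
  finally have "2 * emeasure (density rho (\<lambda>x. ennreal (g x))) C + 4 * (\<integral>\<^sup>+x. ennreal ((h x - 1)\<^sup>2) \<partial>rho) = \<infinity>"
    using inf by (simp add: top_unique)
  moreover have "(\<integral>\<^sup>+x. ennreal ((h x - 1)\<^sup>2) \<partial>rho) < \<infinity>"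
    using h_square by (simp add: integrable_iff_bounded)
  ultimately show ?thesis by (auto simp: ennreal_add_eq_top ennreal_mult_eq_top_iff)
qed

lemma h_bound: "\<bar>h x\<bar> \<le> 2 + (h x - 1)\<^sup>2"
proof -
  \<comment> \<open>The difference of the two sides is \<open>(a - 3/2)^2 + 3/4\<close>.\<close>
  have "a \<le> 2 + (a - 1)\<^sup>2" for a :: real
    using zero_le_power2[of "a - 3/2"] by (simp add: power2_diff algebra_simps power2_eq_square)
  then show ?thesis using h_nonneg[of x] by simp
qed

lemma local_density_bound: "\<bar>local_density A x\<bar> \<le> 2 + (h x - 1)\<^sup>2"
  using h_bound[of x] zero_le_power2[of "h x - 1"] by (simp add: local_density_def)

text \<open>The probability is a finite product of Poisson weights, so each block is followed
  separately. A block of infinite mass under \<open>rho\<close> has infinite mass throughout; on a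
  block of finite mass the intensities converge by dominated convergence.\<close>

lemma measure_event_tendsto:
  assumes A: "\<And>k. A k \<in> sets X" "(\<Union>k. A k) = space X" "incseq A"
    and P: "measurable_partition X B P" and k: "\<And>C. C \<in> P \<Longrightarrow> k C \<in> counts"
  shows "(\<lambda>i. measure (Q (local_lam (A i))) (partition_event X P k)) \<longlonglongrightarrow> measure (Q lam) (partition_event X P k)"
proof -
  note [measurable] = A(1)
  have P': "finite P" "P \<subseteq> sets X" using P by (auto simp: measurable_partition_def)
  have "(\<lambda>i. poisson_mass (emeasure (local_lam (A i)) C) (k C)) \<longlonglongrightarrow> poisson_mass (emeasure lam C) (k C)" if "C \<in> P" for C
  proof (cases "emeasure rho C = \<infinity>")
    case True
    have [measurable]: "C \<in> sets X" using that P' by auto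
    have "emeasure (local_lam (A i)) C = \<infinity>" for i
      unfolding local_lam_def
      by (rule emeasure_density_infinite[OF _ _ True]) (auto simp: local_density_def h_nonneg)
    moreover have "emeasure lam C = \<infinity>"
      unfolding lam_def by (rule emeasure_density_infinite[OF _ _ True]) (auto simp: h_nonneg)
    ultimately show ?thesis by simp
  next
    case False
    then have fin: "emeasure rho C < \<infinity>" by (simp add: less_top)
    have [measurable]: "C \<in> sets X" using that P' by auto
    have e: "emeasure (density rho (\<lambda>x. ennreal (g x))) C = ennreal (\<integral>x. indicator C x * g x \<partial>rho)"
      if [measurable]: "g \<in> borel_measurable X" and "\<And>x. 0 \<le> g x" "\<And>x. \<bar>g x\<bar> \<le> 2 + (h x - 1)\<^sup>2" for g
    proof -
      have "emeasure (density rho (\<lambda>x. ennreal (g x))) C = (\<integral>\<^sup>+x. ennreal (indicator C x * g x) \<partial>rho)"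
        by (subst emeasure_density) (auto intro!: nn_integral_cong simp: indicator_def)
      also have "\<dots> = ennreal (\<integral>x. indicator C x * g x \<partial>rho)"
        by (rule nn_integral_eq_integral[OF integrable_on_finite[OF _ _ fin that(3)]]) (use that(2) in auto)
      finally show ?thesis .
    qed
    have e1: "emeasure (local_lam (A i)) C = ennreal (\<integral>x. indicator C x * local_density (A i) x \<partial>rho)" for i
      unfolding local_lam_def by (rule e) (auto simp: local_density_bound, auto simp: local_density_def h_nonneg)
    have e2: "emeasure lam C = ennreal (\<integral>x. indicator C x * h x \<partial>rho)"
      unfolding lam_def by (rule e[OF _ h_nonneg h_bound]) measurable
    have lim: "(\<lambda>i. \<integral>x. indicator C x * local_density (A i) x \<partial>rho) \<longlonglongrightarrow> (\<integral>x. indicator C x * h x \<partial>rho)"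
    proof (rule integral_dominated_convergence)
      show "integrable rho (\<lambda>x. indicator C x * (2 + (h x - 1)\<^sup>2))"
        by (rule integrable_on_finite[OF _ _ fin]) simp_all
      show "AE x in rho. norm (indicator C x * local_density (A i) x) \<le> indicator C x * (2 + (h x - 1)\<^sup>2)" for i
        by (intro AE_I2) (simp add: abs_mult mult_left_mono local_density_bound)
      show "AE x in rho. (\<lambda>i. indicator C x * local_density (A i) x) \<longlonglongrightarrow> indicator C x * h x"
      proof (rule AE_I2)
        fix x assume "x \<in> space rho"
        then obtain n where n: "x \<in> A n" using A(2) r.space_lam by auto
        have "\<forall>\<^sub>F i in sequentially. indicator C x * local_density (A i) x = indicator C x * h x"
          using n A(3) by (intro eventually_sequentiallyI[of n]) (auto simp: local_density_def incseq_def)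
        then show "(\<lambda>i. indicator C x * local_density (A i) x) \<longlonglongrightarrow> indicator C x * h x"
          by (rule tendsto_eventually)
      qed
    qed measurable
    show ?thesis
      unfolding e1 e2
      by (rule poisson_mass_tendsto[OF _ _ lim k[OF that]])
         (auto intro!: integral_nonneg_AE simp: h_nonneg local_density_def)
  qed
  then have "(\<lambda>i. \<Prod>C\<in>P. poisson_mass (emeasure (local_lam (A i)) C) (k C)) \<longlonglongrightarrow> (\<Prod>C\<in>P. poisson_mass (emeasure lam C) (k C))"
    by (rule tendsto_prod)
  moreover have "measure (Q (local_lam (A i))) (partition_event X P k) = (\<Prod>C\<in>P. poisson_mass (emeasure (local_lam (A i)) C) (k C))" for i
    by (rule poisson_law.measure_poisson_partition[OF poisson_law_local_lam[OF A(1)] P])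
  ultimately show ?thesis
    unfolding l.measure_poisson_partition[OF P] by simp
qed

section \<open>Expectations under the new intensity as integrals of kernels under rho\<close>

lemma chaos_minus_integral:
  assumes "r.L2 f" "r.L2 g" and v: "v \<in> borel_measurable X" "integrable rho (\<lambda>y. (v y)\<^sup>2)"
  shows "(\<integral>x. chaos (Q rho) (\<lambda>\<phi>. f \<phi> - g \<phi>) x * pl v x \<partial>LP rho)
    = (\<integral>x. chaos (Q rho) f x * pl v x \<partial>LP rho) - (\<integral>x. chaos (Q rho) g x * pl v x \<partial>LP rho)"
proof -
  note [measurable] = r.L2_measurable[OF assms(1)] r.L2_measurable[OF assms(2)] v(1)
  have [measurable]: "pl v \<in> borel_measurable (list_space X)" by (rule pl_measurable_real) measurable
  have "(\<integral>x. chaos (Q rho) (\<lambda>\<phi>. f \<phi> - g \<phi>) x * pl v x \<partial>LP rho)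
      = (\<integral>x. chaos (Q rho) f x * pl v x - chaos (Q rho) g x * pl v x \<partial>LP rho)"
  proof (rule integral_cong_AE)
    show "AE x in LP rho. chaos (Q rho) (\<lambda>\<phi>. f \<phi> - g \<phi>) x * pl v x
        = chaos (Q rho) f x * pl v x - chaos (Q rho) g x * pl v x"
      using r.chaos_diff[OF assms(1,2)] by eventually_elim (simp add: left_diff_distrib)
  qed measurable
  also have "\<dots> = (\<integral>x. chaos (Q rho) f x * pl v x \<partial>LP rho) - (\<integral>x. chaos (Q rho) g x * pl v x \<partial>LP rho)"
    by (rule Bochner_Integration.integral_diff) (rule r.chaos_pl_integrable[OF _ v]; fact)+
  finally show ?thesis .
qed

abbreviation expansion :: "('a measure \<Rightarrow> real) \<Rightarrow> real" where
  "expansion f \<equiv> (\<integral>x. chaos (Q rho) f x * pl (\<lambda>y. h y - 1) x \<partial>LP rho)"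

lemmas u_props = borel_measurable_diff[OF h_measurable borel_measurable_const[of 1]] h_square

lemma L2_indicator: "S \<in> sets (config_space X) \<Longrightarrow> r.L2 (indicator S)"
  by (rule r.L2_bounded[of _ 1]) (auto simp: indicator_def)

lemma expansion_local:
  assumes A [measurable]: "A \<in> sets X" and fin: "emeasure rho A < \<infinity>" and S [measurable]: "S \<in> sets (config_space X)"
  shows "measure (Q (local_lam A)) S = (\<integral>x. indicator (lists A) x * (chaos (Q rho) (indicator S) x * pl (\<lambda>y. h y - 1) x) \<partial>LP rho)"
proof -
  interpret p: poisson_law "local_lam A" X "Q (local_lam A)" by (rule poisson_law_local_lam[OF A])
  interpret mu: finite_measure "r.restr A"
    unfolding r.restr_def by (rule r.finite_measure_restriction[OF A fin])
  have [measurable]: "pl (\<lambda>y. h y - 1) \<in> borel_measurable (list_space X)" by (rule pl_measurable_real) measurable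
  have dens: "r.restr A = density rho (\<lambda>x. ennreal (indicator A x))"
    unfolding r.restr_def by (simp add: ennreal_indicator)
  have int: "integrable (r.restr A) (local_density A)"
    unfolding dens
    by (subst integrable_density)
       (use integrable_on_finite[OF _ A fin local_density_bound] in \<open>auto simp: sets_rho\<close>)
  have "measure (Q (local_lam A)) S = (\<integral>\<phi>. indicator S \<phi> \<partial>Q (local_lam A))" by simp
  also have "\<dots> = (\<integral>x. chaos (Q rho) (indicator S) x * pl (\<lambda>y. local_density A y - 1) x \<partial>LP (r.restr A))"
  proof (rule r.local_change_of_intensity[OF _ _ A fin, of _ 1])
    show "poisson_law (density rho (\<lambda>x. ennreal (local_density A x))) X (Q (local_lam A))"
      using p.poisson_law_axioms by (simp add: local_lam_def)
  qed (auto simp: int, auto simp: local_density_def h_nonneg indicator_def)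
  also have "\<dots> = (\<integral>x. indicator (lists A) x * (chaos (Q rho) (indicator S) x * pl (\<lambda>y. local_density A y - 1) x) \<partial>LP rho)"
  proof -
    have [measurable]: "pl (\<lambda>y. local_density A y - 1) \<in> borel_measurable (list_space X)"
      by (rule pl_measurable_real) measurable
    have "LP (r.restr A) = density (LP rho) (\<lambda>x. ennreal (indicator (lists A) x))"
      unfolding r.LP_restr[OF A fin] by (simp add: ennreal_indicator)
    then show ?thesis by (simp add: integral_density)
  qed
  also have "\<dots> = (\<integral>x. indicator (lists A) x * (chaos (Q rho) (indicator S) x * pl (\<lambda>y. h y - 1) x) \<partial>LP rho)"
  proof (rule Bochner_Integration.integral_cong[OF refl])
    fix x
    have "pl (\<lambda>y. local_density A y - 1) x = pl (\<lambda>y. h y - 1) x" if "x \<in> lists A"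
      using that by (induction x) (auto simp: local_density_def)
    then show "indicator (lists A) x * (chaos (Q rho) (indicator S) x * pl (\<lambda>y. local_density A y - 1) x)
      = indicator (lists A) x * (chaos (Q rho) (indicator S) x * pl (\<lambda>y. h y - 1) x)"
      by (auto simp: indicator_def)
  qed
  finally show ?thesis .
qed

text \<open>For a partition event the local formula is taken along exhausting sets: probabilities
  converge on one side, dominated convergence applies on the other. Linearity gives complements, and
  L2 continuity gives disjoint unions.\<close>

lemma expansion_indicator:
  assumes S: "S \<in> sets (config_space X)"
  shows "measure (Q lam) S = expansion (indicator S)"
  \<comment> \<open>The induction is run with \<open>A = {}\<close>, so that it imposes no
    constraint on the partitions.\<close>
  using sets.empty_sets S
proof (induction rule: config_space_induct)
  case (basic P k)
  obtain A :: "nat \<Rightarrow> 'a set" where A: "\<And>k. A k \<in> sets X" "(\<Union>k. A k) = space X"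
    "\<And>k. emeasure rho (A k) < \<infinity>" "incseq A"
    using r.exhaustion by blast
  note [measurable] = A(1)
  have S: "partition_event X P k \<in> sets (config_space X)"
    using basic by (intro partition_event_sets) (auto simp: measurable_partition_def)
  note [measurable] = S
  let ?F = "\<lambda>x. chaos (Q rho) (indicator (partition_event X P k)) x * pl (\<lambda>y. h y - 1) x"
  have Fi: "integrable (LP rho) ?F"
    by (rule r.chaos_pl_integrable[OF L2_indicator[OF S] u_props])
  have [measurable]: "?F \<in> borel_measurable (LP rho)" using Fi by simp
  have "(\<lambda>i. \<integral>x. indicator (lists (A i)) x * ?F x \<partial>LP rho) \<longlonglongrightarrow> (\<integral>x. ?F x \<partial>LP rho)"
  proof (rule integral_dominated_convergence)
    show "integrable (LP rho) (\<lambda>x. \<bar>?F x\<bar>)" using Fi by (rule integrable_abs)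
    show "AE x in LP rho. norm (indicator (lists (A i)) x * ?F x) \<le> \<bar>?F x\<bar>" for i
      by (intro AE_I2) (auto simp: indicator_def)
    show "AE x in LP rho. (\<lambda>i. indicator (lists (A i)) x * ?F x) \<longlonglongrightarrow> ?F x"
    proof (rule AE_I2)
      fix x assume "x \<in> space (LP rho)"
      then have "x \<in> (\<Union>k. lists (A k))"
        unfolding lists_incseq_UN[OF A(4)] by (simp add: space_LP r.space_lam A(2))
      then obtain n where n: "x \<in> lists (A n)" by blast
      have "lists (A i) \<subseteq> lists (A j)" if "i \<le> j" for i j
        using A(4) that by (intro lists_mono) (auto simp: incseq_def)
      with n have "\<forall>\<^sub>F i in sequentially. indicator (lists (A i)) x * ?F x = ?F x"
        by (intro eventually_sequentiallyI[of n]) (auto simp: indicator_def)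
      then show "(\<lambda>i. indicator (lists (A i)) x * ?F x) \<longlonglongrightarrow> ?F x" by (rule tendsto_eventually)
    qed
  qed measurable
  then have "(\<lambda>i. measure (Q (local_lam (A i))) (partition_event X P k)) \<longlonglongrightarrow> (\<integral>x. ?F x \<partial>LP rho)"
    unfolding expansion_local[OF A(1,3) S] .
  moreover have "(\<lambda>i. measure (Q (local_lam (A i))) (partition_event X P k)) \<longlonglongrightarrow> measure (Q lam) (partition_event X P k)"
    by (rule measure_event_tendsto[OF A(1,2,4) basic])
  ultimately show ?case by (rule LIMSEQ_unique[rotated])
next
  case empty
  have "chaos (Q rho) (\<lambda>_. 0) x = 0" for x
    using list_diff_minus[of "\<lambda>_. 0" "\<lambda>_. 0" x] by (simp add: chaos_def shift_mean_def[abs_def])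
  moreover have "indicator {} = (\<lambda>_ :: 'a measure. 0 :: real)" by (simp add: fun_eq_iff)
  ultimately show ?case by simp
next
  case (compl S)
  have top: "config_set X \<in> sets (config_space X)"
    using sets.top[of "config_space X"] by (simp add: space_config_space)
  have sub: "S \<subseteq> config_set X" using sets.sets_into_space[OF compl(1)] by (simp add: space_config_space)
  have "indicator (config_set X - S) = (\<lambda>\<phi>. indicator (config_set X) \<phi> - indicator S \<phi> :: real)"
    using sub by (auto simp: fun_eq_iff indicator_def)
  then have "expansion (indicator (config_set X - S)) = expansion (indicator (config_set X)) - expansion (indicator S)"
    using chaos_minus_integral[OF L2_indicator[OF top] L2_indicator[OF compl(1)] u_props] by simp
  also have "\<dots> = measure (Q lam) (config_set X) - measure (Q lam) S" using compl by simp
  also have "\<dots> = measure (Q lam) (config_set X - S)"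
    by (rule l.Q.finite_measure_Diff[symmetric]) (use top sub compl(1) in auto)
  finally show ?case by simp
next
  case (union S)
  define U where "U m = (\<Union>i<m. S i)" for m
  have S: "S i \<in> sets (config_space X)" for i using union by auto
  have U: "U m \<in> sets (config_space X)" for m unfolding U_def using S by auto
  have UN: "(\<Union>m. U m) = (\<Union>i. S i)" unfolding U_def by auto
  have US: "(\<Union>i. S i) \<in> sets (config_space X)" using S by auto
  have inc: "incseq U" unfolding U_def by (auto simp: incseq_def) (meson lessThan_iff less_le_trans)
  have fin: "measure (Q lam) (U m) = expansion (indicator (U m))" for m
  proof (induction m)
    case 0
    have "chaos (Q rho) (\<lambda>_. 0) x = 0" for x
      using list_diff_minus[of "\<lambda>_. 0" "\<lambda>_. 0" x] by (simp add: chaos_def shift_mean_def[abs_def])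
    moreover have "indicator {} = (\<lambda>_ :: 'a measure. 0 :: real)" by (simp add: fun_eq_iff)
    ultimately show ?case by (simp add: U_def)
  next
    case (Suc m)
    have Su: "U (Suc m) = U m \<union> S m" by (auto simp: U_def lessThan_Suc)
    have "S i \<inter> S m = {}" if "i < m" for i
      using union(1) that unfolding disjoint_family_on_def by (metis UNIV_I less_irrefl)
    then have disj: "U m \<inter> S m = {}" unfolding U_def by blast
    \<comment> \<open>The expansion is known to respect differences, so \<open>S m\<close> is
      written as the difference of two consecutive partial unions.\<close>
    have "indicator (S m) = (\<lambda>\<phi>. indicator (U (Suc m)) \<phi> - indicator (U m) \<phi> :: real)"
      using disj by (auto simp: fun_eq_iff indicator_def Su)
    then have "expansion (indicator (S m)) = expansion (indicator (U (Suc m))) - expansion (indicator (U m))"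
      using chaos_minus_integral[OF L2_indicator[OF U] L2_indicator[OF U] u_props, of "Suc m" m] by simp
    moreover have "measure (Q lam) (U (Suc m)) = measure (Q lam) (U m) + measure (Q lam) (S m)"
      unfolding Su by (rule l.Q.finite_measure_Union) (use U S disj in auto)
    ultimately show ?case using Suc union(3)[of m] by simp
  qed
  have "(\<lambda>m. expansion (indicator (U m))) \<longlonglongrightarrow> expansion (indicator (\<Union>i. S i))"
  proof (rule r.chaos_pl_converges(2)[OF L2_indicator[OF U] L2_indicator[OF US] _ u_props])
    have "(\<lambda>m. \<integral>\<phi>. (indicator (U m) \<phi> - indicator (\<Union>i. S i) \<phi> :: real)\<^sup>2 \<partial>Q rho) \<longlonglongrightarrow> (\<integral>\<phi>. 0 \<partial>Q rho)"
    proof (rule integral_dominated_convergence)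
      show "integrable (Q rho) (\<lambda>_. 1 :: real)" by simp
      show "AE \<phi> in Q rho. norm ((indicator (U m) \<phi> - indicator (\<Union>i. S i) \<phi> :: real)\<^sup>2) \<le> 1" for m
        by (intro AE_I2) (auto simp: indicator_def)
      show "AE \<phi> in Q rho. (\<lambda>m. (indicator (U m) \<phi> - indicator (\<Union>i. S i) \<phi> :: real)\<^sup>2) \<longlonglongrightarrow> 0"
      proof (rule AE_I2)
        fix \<phi>
        have "(\<lambda>m. indicator (U m) \<phi> :: real) \<longlonglongrightarrow> indicator (\<Union>i. S i) \<phi>"
          using LIMSEQ_indicator_incseq[OF inc, of \<phi>] unfolding UN .
        then have "(\<lambda>m. (indicator (U m) \<phi> - indicator (\<Union>i. S i) \<phi> :: real)\<^sup>2) \<longlonglongrightarrow> (indicator (\<Union>i. S i) \<phi> - indicator (\<Union>i. S i) \<phi>)\<^sup>2"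
          by (intro tendsto_intros)
        then show "(\<lambda>m. (indicator (U m) \<phi> - indicator (\<Union>i. S i) \<phi> :: real)\<^sup>2) \<longlonglongrightarrow> 0" by simp
      qed
    qed (use U US in auto)
    then show "(\<lambda>m. \<integral>\<phi>. (indicator (U m) \<phi> - indicator (\<Union>i. S i) \<phi> :: real)\<^sup>2 \<partial>Q rho) \<longlonglongrightarrow> 0" by simp
  qed
  moreover have "(\<lambda>m. measure (Q lam) (U m)) \<longlonglongrightarrow> measure (Q lam) (\<Union>m. U m)"
    by (rule l.Q.finite_Lim_measure_incseq) (use U inc in auto)
  ultimately show ?case unfolding fin UN by (rule LIMSEQ_unique[rotated])
qed

lemma chaos_mult: "chaos (Q rho) (\<lambda>\<phi>. c * f \<phi>) x = c * chaos (Q rho) f x"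
  by (simp add: chaos_def shift_mean_def[abs_def] list_diff_mult)

text \<open>Increasing approximations converge in L2 under \<open>rho\<close> by domination, hence
  so do their expansions. Monotone convergence under \<open>lam\<close>, with this finite limit,
  yields integrability and the value at once.\<close>

lemma expansion_nonneg:
  assumes "f \<in> borel_measurable (config_space X)" "\<And>\<phi>. 0 \<le> f \<phi>" "r.L2 f"
  shows "integrable (Q lam) f \<and> (\<integral>\<phi>. f \<phi> \<partial>Q lam) = expansion f"
  using assms
proof (induction rule: borel_measurable_induct_real)
  case (set S)
  have "integrable (Q lam) (indicator S :: 'a measure \<Rightarrow> real)"
    by (rule l.Q.integrable_const_bound[of _ 1]) (use set(1) in \<open>auto simp: indicator_def\<close>)
  then show ?case using expansion_indicator[OF set(1)] set(1) by simp
next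
  case (mult f c)
  note [measurable] = mult.hyps(2)
  have e: "expansion (\<lambda>\<phi>. c * f \<phi>) = c * expansion f"
    by (simp add: chaos_mult mult.assoc)
  show ?case
  proof (cases "c = 0")
    case False
    have "integrable (Q rho) (\<lambda>\<phi>. (1 / c\<^sup>2) * (c * f \<phi>)\<^sup>2)"
      using mult.prems by (simp add: r.L2_def)
    then have "r.L2 f" using False mult.hyps(2) by (simp add: r.L2_def power_mult_distrib)
    then show ?thesis using mult.IH e by simp
  qed (use e in simp)
next
  case (add f g)
  note [measurable] = add.hyps(1,3)
  have f: "r.L2 f" by (rule r.L2_dominated[OF add.prems]) (use add.hyps(2,4) in \<open>auto intro: order.trans[OF _ abs_ge_self]\<close>)
  have g: "r.L2 g" by (rule r.L2_dominated[OF add.prems]) (use add.hyps(2,4) in \<open>auto intro: order.trans[OF _ abs_ge_self]\<close>)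
  have "expansion f = expansion (\<lambda>\<phi>. g \<phi> + f \<phi>) - expansion g"
    using chaos_minus_integral[OF add.prems g u_props] by simp
  then show ?case using add.IH(1)[OF f] add.IH(2)[OF g] by simp
next
  case (seq U)
  note [measurable] = seq.hyps(1)
  have le: "U i \<phi> \<le> f \<phi>" if "\<phi> \<in> config_set X" for i \<phi>
  proof (rule incseq_le)
    show "incseq (\<lambda>i. U i \<phi>)" using seq.hyps(3) by (auto simp: incseq_def le_fun_def)
    show "(\<lambda>i. U i \<phi>) \<longlonglongrightarrow> f \<phi>" using seq.hyps(4) that by (simp add: space_config_space)
  qed
  have UL: "r.L2 (U i)" for i
    by (rule r.L2_dominated[OF seq.prems]) (use le seq.hyps(2) in \<open>auto intro: order.trans[OF _ abs_ge_self]\<close>)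
  have fm [measurable]: "f \<in> borel_measurable (config_space X)" by (rule r.L2_measurable[OF seq.prems])
  have lim: "(\<lambda>i. expansion (U i)) \<longlonglongrightarrow> expansion f"
  proof (rule r.chaos_pl_converges(2)[OF UL seq.prems _ u_props])
    have "(\<lambda>i. \<integral>\<phi>. (U i \<phi> - f \<phi>)\<^sup>2 \<partial>Q rho) \<longlonglongrightarrow> (\<integral>\<phi>. 0 \<partial>Q rho)"
    proof (rule integral_dominated_convergence)
      show "integrable (Q rho) (\<lambda>\<phi>. (f \<phi>)\<^sup>2)" using seq.prems by (simp add: r.L2_def)
      show "AE \<phi> in Q rho. norm ((U i \<phi> - f \<phi>)\<^sup>2) \<le> (f \<phi>)\<^sup>2" for i
      proof (rule AE_I2)
        fix \<phi> assume "\<phi> \<in> space (Q rho)"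
        then have "U i \<phi> \<le> f \<phi>" "0 \<le> U i \<phi>" using le seq.hyps(2) by (auto simp: r.space_Q)
        then show "norm ((U i \<phi> - f \<phi>)\<^sup>2) \<le> (f \<phi>)\<^sup>2" by (simp add: abs_le_square_iff[symmetric])
      qed
      show "AE \<phi> in Q rho. (\<lambda>i. (U i \<phi> - f \<phi>)\<^sup>2) \<longlonglongrightarrow> 0"
      proof (rule AE_I2)
        fix \<phi> assume "\<phi> \<in> space (Q rho)"
        then have "(\<lambda>i. U i \<phi>) \<longlonglongrightarrow> f \<phi>" using seq.hyps(4) by (simp add: r.space_Q space_config_space)
        then have "(\<lambda>i. (U i \<phi> - f \<phi>)\<^sup>2) \<longlonglongrightarrow> (f \<phi> - f \<phi>)\<^sup>2" by (intro tendsto_intros)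
        then show "(\<lambda>i. (U i \<phi> - f \<phi>)\<^sup>2) \<longlonglongrightarrow> 0" by simp
      qed
    qed measurable
    then show "(\<lambda>i. \<integral>\<phi>. (U i \<phi> - f \<phi>)\<^sup>2 \<partial>Q rho) \<longlonglongrightarrow> 0" by simp
  qed
  have i: "integrable (Q lam) (U i)" and e: "(\<integral>\<phi>. U i \<phi> \<partial>Q lam) = expansion (U i)" for i
    using seq.IH[OF UL[of i]] by auto
  have m: "AE \<phi> in Q lam. mono (\<lambda>n. U n \<phi>)"
    using seq.hyps(3) by (auto simp: incseq_def mono_def le_fun_def)
  have c: "AE \<phi> in Q lam. (\<lambda>n. U n \<phi>) \<longlonglongrightarrow> f \<phi>"
    using seq.hyps(4) by (auto simp: l.space_Q space_config_space)
  have l: "(\<lambda>i. \<integral>\<phi>. U i \<phi> \<partial>Q lam) \<longlonglongrightarrow> expansion f" using lim by (simp only: e)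
  show ?case
    using integrable_monotone_convergence[OF i m c l] integral_monotone_convergence[OF i m c l] by simp
qed

lemma expansion_L2:
  assumes f: "r.L2 f"
  shows "integrable (Q lam) f" "(\<integral>\<phi>. f \<phi> \<partial>Q lam) = expansion f"
proof -
  note [measurable] = r.L2_measurable[OF f]
  let ?p = "\<lambda>\<phi>. max 0 (f \<phi>)" and ?m = "\<lambda>\<phi>. max 0 (- f \<phi>)"
  have p: "r.L2 ?p" and m: "r.L2 ?m" by (rule r.L2_dominated[OF f], simp, simp)+
  have F: "f = (\<lambda>\<phi>. ?p \<phi> - ?m \<phi>)" by (auto simp: fun_eq_iff)
  have ep: "integrable (Q lam) ?p" "(\<integral>\<phi>. ?p \<phi> \<partial>Q lam) = expansion ?p"
    using expansion_nonneg[OF r.L2_measurable[OF p] _ p] by auto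
  have em: "integrable (Q lam) ?m" "(\<integral>\<phi>. ?m \<phi> \<partial>Q lam) = expansion ?m"
    using expansion_nonneg[OF r.L2_measurable[OF m] _ m] by auto
  show "integrable (Q lam) f"
    by (subst F, rule Bochner_Integration.integrable_diff[OF ep(1) em(1)])
  have "(\<integral>\<phi>. f \<phi> \<partial>Q lam) = expansion ?p - expansion ?m"
    by (subst F, subst Bochner_Integration.integral_diff[OF ep(1) em(1)]) (simp add: ep em)
  also have "\<dots> = expansion f"
    using chaos_minus_integral[OF p m u_props] F by simp
  finally show "(\<integral>\<phi>. f \<phi> \<partial>Q lam) = expansion f" .
qed

text \<open>The expansion is applied to the difference of \<open>f\<close> at the points
  \<open>x\<close>, whose kernel at \<open>y\<close> is the kernel of \<open>f\<close> at
  \<open>y @ x\<close>. Boundedness of \<open>f\<close> makes this difference square integrable,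
  which square integrability of \<open>f\<close> alone would not provide.\<close>

lemma chaos_shift_bounded:
  assumes f [measurable]: "f \<in> borel_measurable (config_space X)" and K: "\<And>\<phi>. \<bar>f \<phi>\<bar> \<le> K"
    and x: "x \<in> lists (space X)"
  shows "chaos (Q lam) f x = (\<integral>y. chaos (Q rho) f (y @ x) * pl (\<lambda>y. h y - 1) y \<partial>LP rho)"
proof -
  define g where "g \<phi> = list_diff (\<lambda>p. f (addl \<phi> p)) x" for \<phi>
  have pm: "(\<lambda>\<phi>. f (addl \<phi> p)) \<in> borel_measurable (config_space X)" if "p \<in> lists (space X)" for p
    using l.const_list_X[OF that, of "config_space X"] by measurable
  have gm: "g \<in> borel_measurable (config_space X)"
  proof -
    have "(\<lambda>\<phi>. \<Sum>(p, q)\<leftarrow>L. (-1) ^ length q * f (addl \<phi> p)) \<in> borel_measurable (config_space X)"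
      if "\<And>p q. (p, q) \<in> set L \<Longrightarrow> p \<in> lists (space X)" for L :: "('a list \<times> 'a list) list"
      using that
    proof (induction L)
      case (Cons a L)
      obtain p q where a: "a = (p, q)" by (cases a)
      have [measurable]: "(\<lambda>\<phi>. f (addl \<phi> p)) \<in> borel_measurable (config_space X)"
        using Cons.prems[of p q] pm a by simp
      have [measurable]: "(\<lambda>\<phi>. \<Sum>(p, q)\<leftarrow>L. (-1) ^ length q * f (addl \<phi> p)) \<in> borel_measurable (config_space X)"
        by (rule Cons.IH) (use Cons.prems in auto)
      show ?case unfolding a by simp
    qed simp
    from this[of "splits x"] show ?thesis
      unfolding g_def list_diff_def using splits_in_lists[OF _ x] by blast
  qed
  have gb: "\<bar>g \<phi>\<bar> \<le> K * 2 ^ length x" for \<phi>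
    unfolding g_def by (rule abs_list_diff_le) (rule K)
  have mean: "(\<integral>\<phi>. g (addl \<phi> p) \<partial>N) = list_diff (\<lambda>r. shift_mean N f (p @ r)) x"
    if p: "p \<in> lists (space X)" and N: "prob_space N" "sets N = sets (config_space X)" for p N
  proof -
    interpret N: prob_space N by fact
    have i: "integrable N (\<lambda>\<phi>. f (addl \<phi> r))" if "r \<in> lists (space X)" for r
      by (rule N.integrable_const_bound[of _ K])
         (use K pm[OF that] measurable_cong_sets[OF N(2) refl] in auto)
    have "(\<integral>\<phi>. g (addl \<phi> p) \<partial>N) = (\<integral>\<phi>. sum_splits (\<lambda>r q. (-1) ^ length q * f (addl \<phi> (p @ r))) x \<partial>N)"
      by (simp add: g_def list_diff_def addl_append)
    also have "\<dots> = sum_splits (\<lambda>r q. \<integral>\<phi>. (-1) ^ length q * f (addl \<phi> (p @ r)) \<partial>N) x"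
      by (rule integral_sum_splits) (use i p splits_in_lists[OF _ x] in auto)
    finally show ?thesis by (simp add: list_diff_def shift_mean_def)
  qed
  have gL: "r.L2 g" by (rule r.L2_bounded[OF gm gb])
  have "chaos (Q lam) f x = (\<integral>\<phi>. g \<phi> \<partial>Q lam)"
    using mean[of "[]" "Q lam"] l.Q.prob_space_axioms by (simp add: chaos_def)
  also have "\<dots> = expansion g" by (rule expansion_L2(2)[OF gL])
  also have "\<dots> = (\<integral>y. chaos (Q rho) f (y @ x) * pl (\<lambda>y. h y - 1) y \<partial>LP rho)"
  proof (rule Bochner_Integration.integral_cong[OF refl])
    fix y assume "y \<in> space (LP rho)"
    then have y: "y \<in> lists (space X)" by (simp add: space_LP r.space_lam)
    have "chaos (Q rho) g y = list_diff (\<lambda>p. list_diff (\<lambda>r. shift_mean (Q rho) f (p @ r)) x) y"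
      unfolding chaos_def
    proof (rule list_diff_cong)
      fix p q assume "(p, q) \<in> set (splits y)"
      then have "p \<in> lists (space X)" using splits_in_lists[OF _ y] by blast
      from mean[OF this r.Q.prob_space_axioms]
      show "shift_mean (Q rho) g p = list_diff (\<lambda>r. shift_mean (Q rho) f (p @ r)) x"
        by (simp add: shift_mean_def)
    qed
    also have "\<dots> = chaos (Q rho) f (y @ x)"
      unfolding chaos_def by (rule list_diff_append[symmetric])
    finally show "chaos (Q rho) g y * pl (\<lambda>y. h y - 1) y = chaos (Q rho) f (y @ x) * pl (\<lambda>y. h y - 1) y"
      by simp
  qed
  finally show ?thesis .
qed

end

section \<open>Perturbing one intensity into another\<close>

lemma square_add_le: "(a + b)\<^sup>2 \<le> 2 * a\<^sup>2 + 2 * b\<^sup>2" for a b :: real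
  using zero_le_power2[of "a - b"] by (simp add: power2_sum power2_diff)

locale intensity_pair = l: intensity_change X Q rho hl + n: intensity_change X Q rho hn
  for X :: "'a measure" and Q and rho :: "'a measure" and hl hn :: "'a \<Rightarrow> real"
begin

definition u :: "'a \<Rightarrow> real" where "u y = hl y - 1"

definition w :: "'a \<Rightarrow> real" where "w y = hn y - hl y"

lemma u_measurable [measurable]: "u \<in> borel_measurable X"
  unfolding u_def[abs_def] by measurable

lemma w_measurable [measurable]: "w \<in> borel_measurable X"
  unfolding w_def[abs_def] by measurable

lemma pl_measurable_X [measurable]: "v \<in> borel_measurable X \<Longrightarrow> pl v \<in> borel_measurable (list_space X)"
  for v :: "'a \<Rightarrow> real"
  by (rule pl_measurable_real)

lemma w_square: "integrable rho (\<lambda>y. (w y)\<^sup>2)"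
proof (rule Bochner_Integration.integrable_bound)
  show "integrable rho (\<lambda>y. 2 * (hn y - 1)\<^sup>2 + 2 * (hl y - 1)\<^sup>2)"
    using l.h_square n.h_square by simp
  have "(w y)\<^sup>2 \<le> 2 * (hn y - 1)\<^sup>2 + 2 * (hl y - 1)\<^sup>2" for y
    using square_add_le[of "hn y - 1" "1 - hl y"] by (simp add: w_def power2_commute)
  then show "AE y in rho. norm ((w y)\<^sup>2) \<le> norm (2 * (hn y - 1)\<^sup>2 + 2 * (hl y - 1)\<^sup>2)"
    by simp
qed (use l.sets_rho in measurable)

definition uw :: "'a \<Rightarrow> real" where "uw y = \<bar>u y\<bar> + \<bar>w y\<bar>"

lemma uw_measurable [measurable]: "uw \<in> borel_measurable X"
  unfolding uw_def[abs_def] by measurable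

lemma uw_nonneg: "0 \<le> uw y"
  by (simp add: uw_def)

lemma uw_square: "integrable rho (\<lambda>y. (uw y)\<^sup>2)"
proof (rule Bochner_Integration.integrable_bound)
  show "integrable rho (\<lambda>y. 2 * (hl y - 1)\<^sup>2 + 2 * (w y)\<^sup>2)"
    using l.h_square w_square by simp
  show "AE y in rho. norm ((uw y)\<^sup>2) \<le> norm (2 * (hl y - 1)\<^sup>2 + 2 * (w y)\<^sup>2)"
    using square_add_le[of "\<bar>u y\<bar>" "\<bar>w y\<bar>" for y] by (intro AE_I2) (simp add: uw_def u_def)
qed (use l.sets_rho in measurable)

abbreviation P where "P \<equiv> LP rho"

abbreviation c :: "('a measure \<Rightarrow> real) \<Rightarrow> 'a list \<Rightarrow> real" where "c \<equiv> chaos (Q rho)"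

text \<open>Symmetry lets \<open>g\<close> depend on the merged list only, and the binomial formula
  then adds the weights of \<open>u\<close> and \<open>w\<close> to \<open>uw\<close>. Since
  \<open>uw\<close> is square integrable, this reduces joint integrability to the weighted kernel
  bound.\<close>

lemma nn_integral_shift_product:
  assumes g [measurable]: "g \<in> borel_measurable (list_space X)" and sym: "list_symmetric g"
  shows "(\<integral>\<^sup>+x. \<integral>\<^sup>+y. ennreal \<bar>g (y @ x) * pl u y * pl w x\<bar> \<partial>P \<partial>P) = (\<integral>\<^sup>+z. ennreal (\<bar>g z\<bar> * pl uw z) \<partial>P)"
proof -
  let ?H = "\<lambda>x y. ennreal \<bar>g (y @ x) * pl u y * pl w x\<bar>"
  have "(\<integral>\<^sup>+x. \<integral>\<^sup>+y. ?H x y \<partial>P \<partial>P) = (\<integral>\<^sup>+z. sum_splits ?H z \<partial>P)"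
    by (rule l.nn_integral_LP_sum_splits[symmetric]) (simp add: l.r.list_space_lam)
  also have "\<dots> = (\<integral>\<^sup>+z. ennreal (\<bar>g z\<bar> * pl uw z) \<partial>P)"
  proof (rule nn_integral_cong)
    fix z
    have g_split: "g (b @ a) = g z" if "(a, b) \<in> set (splits z)" for a b
      by (rule list_symmetricD[OF sym]) (simp add: mset_splits[OF that, symmetric])
    have "sum_splits ?H z = sum_splits (\<lambda>a b. ennreal \<bar>g z\<bar> * (pl (\<lambda>y. ennreal \<bar>w y\<bar>) a * pl (\<lambda>y. ennreal \<bar>u y\<bar>) b)) z"
      by (rule sum_splits_cong)
         (simp add: g_split abs_mult abs_pl ennreal_pl[symmetric] ennreal_mult'[symmetric] pl_nonneg ac_simps)
    also have "\<dots> = ennreal \<bar>g z\<bar> * pl (\<lambda>y. ennreal \<bar>w y\<bar> + ennreal \<bar>u y\<bar>) z"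
      unfolding sum_splits_mult sum_splits_pl ..
    also have "(\<lambda>y. ennreal \<bar>w y\<bar> + ennreal \<bar>u y\<bar>) = (\<lambda>y. ennreal (uw y))"
      by (simp add: uw_def ennreal_plus[symmetric] add.commute del: ennreal_plus)
    finally show "sum_splits ?H z = ennreal (\<bar>g z\<bar> * pl uw z)"
      by (simp add: ennreal_pl[symmetric] uw_nonneg ennreal_mult')
  qed
  finally show ?thesis .
qed

lemma chaos_uw_finite:
  assumes f: "l.r.L2 f"
  shows "(\<integral>\<^sup>+z. ennreal (\<bar>c f z\<bar> * pl uw z) \<partial>P) < \<infinity>"
proof -
  have "(\<lambda>y. \<bar>uw y\<bar>) = uw" using uw_nonneg by auto
  then show ?thesis
    using l.r.chaos_pl_bound[OF f uw_measurable uw_square] by (simp add: order.strict_trans1)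
qed

lemma integrable_shift_product:
  assumes f: "l.r.L2 f"
  shows "integrable (P \<Otimes>\<^sub>M P) (\<lambda>(x, y). c f (y @ x) * pl u y * pl w x)"
proof (rule integrableI_bounded)
  interpret L: sigma_finite_measure P by (rule l.sigma_finite_LP)
  note [measurable] = l.r.L2_measurable[OF f]
  show m [measurable]: "(\<lambda>(x, y). c f (y @ x) * pl u y * pl w x) \<in> borel_measurable (P \<Otimes>\<^sub>M P)" by measurable
  have "(\<integral>\<^sup>+p. norm (case p of (x, y) \<Rightarrow> c f (y @ x) * pl u y * pl w x) \<partial>(P \<Otimes>\<^sub>M P))
      = (\<integral>\<^sup>+x. \<integral>\<^sup>+y. ennreal \<bar>c f (y @ x) * pl u y * pl w x\<bar> \<partial>P \<partial>P)"
    by (subst L.nn_integral_fst[symmetric]) simp_all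
  also have "\<dots> < \<infinity>"
    unfolding nn_integral_shift_product[OF l.r.chaos_measurable[OF l.r.L2_measurable[OF f]] list_symmetric_chaos]
    by (rule chaos_uw_finite[OF f])
  finally show "(\<integral>\<^sup>+p. norm (case p of (x, y) \<Rightarrow> c f (y @ x) * pl u y * pl w x) \<partial>(P \<Otimes>\<^sub>M P)) < \<infinity>" .
qed

text \<open>The candidate for the kernel under \<open>l.lam\<close> times \<open>pl w x\<close>. The
  factor is kept inside, because joint integrability is established only with this weight.\<close>

definition shift_expansion :: "('a measure \<Rightarrow> real) \<Rightarrow> 'a list \<Rightarrow> real" where
  "shift_expansion f x = (\<integral>y. c f (y @ x) * pl u y * pl w x \<partial>P)"

lemma shift_expansion_measurable [measurable]:
  assumes [measurable]: "f \<in> borel_measurable (config_space X)"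
  shows "shift_expansion f \<in> borel_measurable (list_space X)"
proof -
  interpret L: sigma_finite_measure P by (rule l.sigma_finite_LP)
  show ?thesis unfolding shift_expansion_def[abs_def] by measurable
qed

lemma chaos_lam_bounded:
  assumes "f \<in> borel_measurable (config_space X)" "\<And>\<phi>. \<bar>f \<phi>\<bar> \<le> K" "x \<in> lists (space X)"
  shows "chaos (Q l.lam) f x * pl w x = shift_expansion f x"
  unfolding l.chaos_shift_bounded[OF assms] shift_expansion_def u_def[abs_def] by simp

text \<open>The bound sees \<open>f\<close> only through its L2 norm under \<open>rho\<close> and
  not through \<open>K\<close>; it is therefore uniform over the truncations of one
  functional.\<close>

lemma chaos_lam_nn_bound:
  assumes f: "f \<in> borel_measurable (config_space X)" "\<And>\<phi>. \<bar>f \<phi>\<bar> \<le> K"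
  shows "(\<integral>\<^sup>+x. ennreal \<bar>chaos (Q l.lam) f x * pl w x\<bar> \<partial>P)
    \<le> ennreal (sqrt ((\<integral>\<phi>. (f \<phi>)\<^sup>2 \<partial>Q rho) * exp (\<integral>y. (uw y)\<^sup>2 \<partial>rho)))"
proof -
  note [measurable] = f(1)
  have L: "l.r.L2 f" by (rule l.r.L2_bounded[OF f])
  have "(\<integral>\<^sup>+x. ennreal \<bar>chaos (Q l.lam) f x * pl w x\<bar> \<partial>P) \<le> (\<integral>\<^sup>+x. \<integral>\<^sup>+y. ennreal \<bar>c f (y @ x) * pl u y * pl w x\<bar> \<partial>P \<partial>P)"
  proof (rule nn_integral_mono)
    fix x assume "x \<in> space P"
    then have x: "x \<in> lists (space X)" by (simp add: space_LP l.r.space_lam)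
    show "ennreal \<bar>chaos (Q l.lam) f x * pl w x\<bar> \<le> (\<integral>\<^sup>+y. ennreal \<bar>c f (y @ x) * pl u y * pl w x\<bar> \<partial>P)"
      unfolding chaos_lam_bounded[OF f x]
    proof (cases "integrable P (\<lambda>y. c f (y @ x) * pl u y * pl w x)")
      case True
      from integral_norm_bound_ennreal[OF True]
      show "ennreal \<bar>shift_expansion f x\<bar> \<le> (\<integral>\<^sup>+y. ennreal \<bar>c f (y @ x) * pl u y * pl w x\<bar> \<partial>P)"
        by (simp add: shift_expansion_def)
    qed (simp add: shift_expansion_def not_integrable_integral_eq)
  qed
  also have "\<dots> = (\<integral>\<^sup>+z. ennreal (\<bar>c f z\<bar> * pl uw z) \<partial>P)"
    by (rule nn_integral_shift_product[OF l.r.chaos_measurable[OF f(1)] list_symmetric_chaos])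
  also have "\<dots> \<le> ennreal (sqrt ((\<integral>\<phi>. (f \<phi>)\<^sup>2 \<partial>Q rho) * exp (\<integral>y. (uw y)\<^sup>2 \<partial>rho)))"
  proof -
    have "(\<lambda>y. \<bar>uw y\<bar>) = uw" using uw_nonneg by auto
    then show ?thesis using l.r.chaos_pl_bound[OF L uw_measurable uw_square] by simp
  qed
  finally show ?thesis .
qed

text \<open>
  Functionals in \<open>L2\<close> of \<open>\<Pi>\<^sub>\<rho>\<close> need not be shifted into \<open>L2\<close>; integrability of the shifts under
  \<open>\<Pi>\<^sub>\<lambda>\<close> comes from inverting the alternating sums of the truncated functionals.
\<close>

lemma AE_integrable_shift_lam:
  assumes f: "l.r.L2 f"
  shows "AE x in P. pl w x \<noteq> 0 \<longrightarrow> (\<forall>(p, q)\<in>set (splits x). integrable (Q l.lam) (\<lambda>\<phi>. f (addl \<phi> p)))"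
proof -
  note [measurable] = l.r.L2_measurable[OF f]
  obtain A :: "nat \<Rightarrow> 'a set" where A: "\<And>k. A k \<in> sets X" "(\<Union>k. A k) = space X"
    "\<And>k. emeasure rho (A k) < \<infinity>" "incseq A"
    using l.r.exhaustion by blast
  let ?g = "\<lambda>m. clip m (\<lambda>\<phi>. \<bar>f \<phi>\<bar>)"
  let ?B = "ennreal (sqrt ((\<integral>\<phi>. (f \<phi>)\<^sup>2 \<partial>Q rho) * exp (\<integral>y. (uw y)\<^sup>2 \<partial>rho)))"
  have gm [measurable]: "?g m \<in> borel_measurable (config_space X)" for m
    by measurable
  have g0: "0 \<le> ?g m \<phi>" for m \<phi> by (simp add: clip_def)
  have "AE x in LP (l.r.restr (A k)). pl w x \<noteq> 0 \<longrightarrow> integrable (Q l.lam) (\<lambda>\<phi>. f (addl \<phi> x))" for k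
  proof -
    let ?R = "l.r.restr (A k)"
    interpret mu: finite_measure ?R
      unfolding l.r.restr_def by (rule l.r.finite_measure_restriction[OF A(1,3)])
    interpret L: sigma_finite_measure "LP ?R" by (rule mu.sigma_finite_LP)
    have spl: "space (LP ?R) = lists (space X)"
      by (simp add: space_LP sets_eq_imp_space_eq[OF l.r.sets_restr])
    \<comment> \<open>\<open>w\<close> is only square integrable over the whole space. On a set of
      finite intensity it is integrable, so \<open>pl w\<close> has the finite Lebesgue-Poisson
      integral \<open>W\<close>.\<close>
    have wint: "integrable ?R w"
    proof (rule integrable_square_bound[OF mu.finite_measure_axioms])
      have "?R = density rho (\<lambda>x. ennreal (indicator (A k) x))"
        unfolding l.r.restr_def by (simp add: ennreal_indicator)
      moreover have "integrable rho (\<lambda>x. indicator (A k) x *\<^sub>R (w x)\<^sup>2)"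
        by (rule integrable_mult_indicator[OF _ w_square]) (use A(1) l.sets_rho in simp)
      ultimately show "integrable ?R (\<lambda>x. (w x)\<^sup>2)"
        using A(1) by (simp add: integrable_density l.sets_rho)
    qed measurable
    define W where "W = (\<integral>\<^sup>+q. ennreal \<bar>pl w q\<bar> \<partial>LP ?R)"
    have Wfin: "W < \<infinity>"
      using mu.integrable_pl[OF wint] by (simp add: W_def integrable_iff_bounded)
    have bound: "(\<integral>\<^sup>+x. ennreal (\<bar>pl w x\<bar> * shift_mean (Q l.lam) (?g m) x) \<partial>LP ?R) \<le> ?B * W" for m
    proof -
      let ?c = "chaos (Q l.lam) (?g m)"
      let ?H = "\<lambda>p q. ennreal \<bar>?c p * pl w p\<bar> * ennreal \<bar>pl w q\<bar>"
      have "(\<integral>\<^sup>+x. ennreal (\<bar>pl w x\<bar> * shift_mean (Q l.lam) (?g m) x) \<partial>LP ?R) \<le> (\<integral>\<^sup>+x. sum_splits ?H x \<partial>LP ?R)"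
      proof (rule nn_integral_mono)
        fix x
        \<comment> \<open>Moebius inversion expresses the shifted mean as the sum of kernels over
          all sublists \<open>p\<close>. The part \<open>pl w p\<close> of the weight goes with the
          kernel, and the remaining \<open>pl w q\<close> is integrated to \<open>W\<close>.\<close>
        have "\<bar>pl w x\<bar> * shift_mean (Q l.lam) (?g m) x = sum_splits (\<lambda>p q. \<bar>pl w x\<bar> * ?c p) x"
          unfolding sum_splits_mult chaos_def sum_splits_list_diff ..
        also have "\<dots> \<le> sum_splits (\<lambda>p q. \<bar>?c p * pl w p\<bar> * \<bar>pl w q\<bar>) x"
        proof (rule sum_splits_mono)
          fix p q assume "(p, q) \<in> set (splits x)"
          then have "pl w x = pl w p * pl w q"
            using list_symmetric_splits(2)[OF list_symmetric_pl, of p q x w] by (simp only: pl_append)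
          then have "\<bar>pl w x\<bar> * ?c p = (\<bar>pl w p\<bar> * \<bar>pl w q\<bar>) * ?c p" by (simp add: abs_mult)
          also have "\<dots> \<le> (\<bar>pl w p\<bar> * \<bar>pl w q\<bar>) * \<bar>?c p\<bar>" by (rule mult_left_mono) simp_all
          finally show "\<bar>pl w x\<bar> * ?c p \<le> \<bar>?c p * pl w p\<bar> * \<bar>pl w q\<bar>" by (simp add: abs_mult ac_simps)
        qed
        finally have "ennreal (\<bar>pl w x\<bar> * shift_mean (Q l.lam) (?g m) x) \<le> ennreal (sum_splits (\<lambda>p q. \<bar>?c p * pl w p\<bar> * \<bar>pl w q\<bar>) x)"
          by (rule ennreal_leI)
        also have "\<dots> = sum_splits ?H x"
        proof -
          have "ennreal (sum_splits K x) = sum_splits (\<lambda>a b. ennreal (K a b)) x \<and> 0 \<le> sum_splits K x"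
            if "\<And>a b. 0 \<le> K a b" for K :: "'a list \<Rightarrow> 'a list \<Rightarrow> real" and x
            using that by (induction x arbitrary: K) (simp_all add: ennreal_plus)
          from this[of "\<lambda>p q. \<bar>?c p * pl w p\<bar> * \<bar>pl w q\<bar>" x] show ?thesis
            by (simp add: ennreal_mult')
        qed
        finally show "ennreal (\<bar>pl w x\<bar> * shift_mean (Q l.lam) (?g m) x) \<le> sum_splits ?H x" .
      qed
      also have "\<dots> = (\<integral>\<^sup>+p. \<integral>\<^sup>+q. ?H p q \<partial>LP ?R \<partial>LP ?R)"
        by (rule mu.nn_integral_LP_sum_splits)
           (use l.l.chaos_measurable[OF gm] in \<open>simp add: l.r.list_space_restr split_def\<close>)
      also have "\<dots> = (\<integral>\<^sup>+p. ennreal \<bar>?c p * pl w p\<bar> \<partial>LP ?R) * W"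
        unfolding W_def using l.l.chaos_measurable[OF gm]
        by (simp add: nn_integral_cmult nn_integral_multc)
      also have "\<dots> \<le> ?B * W"
      proof (rule mult_right_mono)
        have "(\<integral>\<^sup>+p. ennreal \<bar>?c p * pl w p\<bar> \<partial>LP ?R) \<le> (\<integral>\<^sup>+p. ennreal \<bar>?c p * pl w p\<bar> \<partial>P)"
          using l.l.chaos_measurable[OF gm]
          by (subst l.r.nn_integral_LP_restr[OF A(1,3)]) (auto intro!: nn_integral_mono simp: indicator_def)
        also have "\<dots> \<le> ennreal (sqrt ((\<integral>\<phi>. (?g m \<phi>)\<^sup>2 \<partial>Q rho) * exp (\<integral>y. (uw y)\<^sup>2 \<partial>rho)))"
          by (rule chaos_lam_nn_bound[OF gm clip_bound])
        also have "\<dots> \<le> ?B"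
        proof (intro ennreal_leI real_sqrt_le_mono mult_right_mono integral_mono)
          show "integrable (Q rho) (\<lambda>\<phi>. (f \<phi>)\<^sup>2)" using f by (simp add: l.r.L2_def)
          have "l.r.L2 (?g m)" by (rule l.r.L2_bounded[OF gm clip_bound])
          then show "integrable (Q rho) (\<lambda>\<phi>. (?g m \<phi>)\<^sup>2)" by (simp add: l.r.L2_def)
          show "(?g m \<phi>)\<^sup>2 \<le> (f \<phi>)\<^sup>2" for \<phi>
            using abs_clip_le[of m "\<lambda>\<phi>. \<bar>f \<phi>\<bar>" \<phi>] by (simp add: abs_le_square_iff[symmetric])
        qed simp
        finally show "(\<integral>\<^sup>+p. ennreal \<bar>?c p * pl w p\<bar> \<partial>LP ?R) \<le> ?B" .
      qed simp
      finally show ?thesis .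
    qed
    let ?G = "\<lambda>m x. \<integral>\<^sup>+\<phi>. ennreal (\<bar>pl w x\<bar> * ?g m (addl \<phi> x)) \<partial>Q l.lam"
    have "(\<integral>\<^sup>+x. \<integral>\<^sup>+\<phi>. ennreal (\<bar>pl w x\<bar> * \<bar>f (addl \<phi> x)\<bar>) \<partial>Q l.lam \<partial>LP ?R) \<le> (\<integral>\<^sup>+x. liminf (\<lambda>m. ?G m x) \<partial>LP ?R)"
    proof (rule nn_integral_mono)
      fix x assume "x \<in> space (LP ?R)"
      then have x: "x \<in> lists (space X)" using spl by simp
      note [measurable] = l.r.const_list_X[OF x]
      have "(\<integral>\<^sup>+\<phi>. ennreal (\<bar>pl w x\<bar> * \<bar>f (addl \<phi> x)\<bar>) \<partial>Q l.lam)
          = (\<integral>\<^sup>+\<phi>. liminf (\<lambda>m. ennreal (\<bar>pl w x\<bar> * ?g m (addl \<phi> x))) \<partial>Q l.lam)"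
      proof (rule nn_integral_cong)
        fix \<phi> :: "'a measure"
        have "(\<lambda>m. ennreal (\<bar>pl w x\<bar> * ?g m (addl \<phi> x))) \<longlonglongrightarrow> ennreal (\<bar>pl w x\<bar> * \<bar>f (addl \<phi> x)\<bar>)"
          by (intro tendsto_intros clip_tendsto[of "\<lambda>\<phi>. \<bar>f \<phi>\<bar>"])
        then show "ennreal (\<bar>pl w x\<bar> * \<bar>f (addl \<phi> x)\<bar>) = liminf (\<lambda>m. ennreal (\<bar>pl w x\<bar> * ?g m (addl \<phi> x)))"
          by (intro lim_imp_Liminf[symmetric]) simp_all
      qed
      also have "\<dots> \<le> liminf (\<lambda>m. ?G m x)"
        by (rule nn_integral_liminf) measurable
      finally show "(\<integral>\<^sup>+\<phi>. ennreal (\<bar>pl w x\<bar> * \<bar>f (addl \<phi> x)\<bar>) \<partial>Q l.lam) \<le> liminf (\<lambda>m. ?G m x)" .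
    qed
    also have "\<dots> \<le> liminf (\<lambda>m. \<integral>\<^sup>+x. ?G m x \<partial>LP ?R)"
      by (rule nn_integral_liminf) measurable
    also have "\<dots> \<le> liminf (\<lambda>m. ?B * W)"
    proof (rule Liminf_mono, rule always_eventually, rule allI)
      fix m
      have "(\<integral>\<^sup>+x. ?G m x \<partial>LP ?R) = (\<integral>\<^sup>+x. ennreal (\<bar>pl w x\<bar> * shift_mean (Q l.lam) (?g m) x) \<partial>LP ?R)"
      proof (rule nn_integral_cong)
        fix x assume "x \<in> space (LP ?R)"
        then have x: "x \<in> lists (space X)" using spl by simp
        note [measurable] = l.r.const_list_X[OF x]
        have "integrable (Q l.lam) (\<lambda>\<phi>. ?g m (addl \<phi> x))"
          by (rule l.l.Q.integrable_const_bound[of _ "real m"]) (simp add: clip_bound, measurable)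
        then show "?G m x = ennreal (\<bar>pl w x\<bar> * shift_mean (Q l.lam) (?g m) x)"
          using g0 by (subst nn_integral_eq_integral) (auto simp: shift_mean_def)
      qed
      also note bound
      finally show "(\<integral>\<^sup>+x. ?G m x \<partial>LP ?R) \<le> ?B * W" .
    qed
    also have "\<dots> = ?B * W" by (simp add: Liminf_const)
    also have "\<dots> < \<infinity>" using Wfin by (simp add: ennreal_mult_less_top)
    finally have "(\<integral>\<^sup>+x. \<integral>\<^sup>+\<phi>. ennreal (\<bar>pl w x\<bar> * \<bar>f (addl \<phi> x)\<bar>) \<partial>Q l.lam \<partial>LP ?R) \<noteq> \<infinity>" by simp
    then have "AE x in LP ?R. (\<integral>\<^sup>+\<phi>. ennreal (\<bar>pl w x\<bar> * \<bar>f (addl \<phi> x)\<bar>) \<partial>Q l.lam) \<noteq> \<infinity>"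
      by (intro nn_integral_PInf_AE) measurable
    then show ?thesis
      using AE_space
    proof eventually_elim
      case (elim x)
      then have x: "x \<in> lists (space X)" using spl by simp
      note [measurable] = l.r.const_list_X[OF x]
      show ?case
      proof
        assume nz: "pl w x \<noteq> 0"
        have "integrable (Q l.lam) (\<lambda>\<phi>. pl w x * f (addl \<phi> x))"
          using elim(1) by (intro integrableI_bounded) (simp_all add: less_top abs_mult)
        then show "integrable (Q l.lam) (\<lambda>\<phi>. f (addl \<phi> x))" using nz by simp
      qed
    qed
  qed
  then have "AE x in P. pl w x \<noteq> 0 \<longrightarrow> integrable (Q l.lam) (\<lambda>\<phi>. f (addl \<phi> x))"
    by (rule l.r.AE_LP_exhaust[OF A])
  from l.AE_LP_splits[OF this] show ?thesis
  proof eventually_elim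
    case (elim x)
    show ?case
    proof (intro impI ballI, clarify)
      fix p q assume nz: "pl w x \<noteq> 0" and pq: "(p, q) \<in> set (splits x)"
      have "pl w x = pl w p * pl w q"
        using list_symmetric_splits(2)[OF list_symmetric_pl pq, of w] by (simp only: pl_append)
      then have "pl w p \<noteq> 0" using nz by auto
      then show "integrable (Q l.lam) (\<lambda>\<phi>. f (addl \<phi> p))" using elim pq by auto
    qed
  qed
qed

text \<open>For truncations the identity is exact. Fatou's lemma bounds the integrated defect by the
  limit of the weighted kernel differences between \<open>clip m f\<close> and \<open>f\<close>, and
  this limit is zero by L2 continuity.\<close>

lemma chaos_lam_L2:
  assumes f: "l.r.L2 f"
  shows "AE x in P. chaos (Q l.lam) f x * pl w x = shift_expansion f x"
proof -
  interpret L: sigma_finite_measure P by (rule l.sigma_finite_LP)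
  interpret PS: pair_sigma_finite P P by (rule l.pair_sigma_finite_LP)
  note [measurable] = l.r.L2_measurable[OF f]
  have lm [measurable]: "chaos (Q l.lam) g \<in> borel_measurable (list_space X)"
    if "g \<in> borel_measurable (config_space X)" for g
    by (rule l.l.chaos_measurable[OF that])
  have cm [measurable]: "clip m f \<in> borel_measurable (config_space X)" for m by measurable
  have cL: "l.r.L2 (clip m f)" for m by (rule l.r.L2_bounded[OF cm clip_bound])
  let ?D = "\<lambda>x. chaos (Q l.lam) f x * pl w x - shift_expansion f x"
  let ?S = "\<lambda>m x. shift_expansion (clip m f) x - shift_expansion f x"
  have 1: "AE x in P. \<forall>m. chaos (Q l.lam) (clip m f) x * pl w x = shift_expansion (clip m f) x"
    by (rule AE_I2) (use chaos_lam_bounded[OF cm clip_bound] in \<open>simp add: space_LP l.r.space_lam\<close>)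
  have "(\<integral>\<^sup>+x. ennreal \<bar>?D x\<bar> \<partial>P) = (\<integral>\<^sup>+x. liminf (\<lambda>m. ennreal \<bar>?S m x\<bar>) \<partial>P)"
  proof (rule nn_integral_cong_AE)
    show "AE x in P. ennreal \<bar>?D x\<bar> = liminf (\<lambda>m. ennreal \<bar>?S m x\<bar>)"
      using AE_integrable_shift_lam[OF f] 1
    proof eventually_elim
      case (elim x)
      have "(\<lambda>m. chaos (Q l.lam) (clip m f) x * pl w x) \<longlonglongrightarrow> chaos (Q l.lam) f x * pl w x"
      \<comment> \<open>Where the weight vanishes nothing is known about integrability of the
        shifts, but there the product is constantly zero.\<close>
      proof (cases "pl w x = 0")
        case False
        then have "\<forall>(p, q)\<in>set (splits x). integrable (Q l.lam) (\<lambda>\<phi>. f (addl \<phi> p))" using elim by blast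
        then show ?thesis by (intro tendsto_intros l.l.chaos_clip_tendsto)
      qed simp
      then have "(\<lambda>m. shift_expansion (clip m f) x) \<longlonglongrightarrow> chaos (Q l.lam) f x * pl w x"
        using elim(2) by simp
      then have "(\<lambda>m. ennreal \<bar>?S m x\<bar>) \<longlonglongrightarrow> ennreal \<bar>?D x\<bar>"
        by (intro tendsto_intros)
      then show ?case by (intro lim_imp_Liminf[symmetric]) simp
    qed
  qed
  also have "\<dots> \<le> liminf (\<lambda>m. \<integral>\<^sup>+x. ennreal \<bar>?S m x\<bar> \<partial>P)"
    by (rule nn_integral_liminf) measurable
  also have "\<dots> \<le> liminf (\<lambda>m. \<integral>\<^sup>+z. ennreal (\<bar>c (clip m f) z - c f z\<bar> * pl uw z) \<partial>P)"
  proof (rule Liminf_mono, rule always_eventually, rule allI)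
    fix m
    let ?d = "\<lambda>z. c (clip m f) z - c f z"
    have "(\<integral>\<^sup>+x. ennreal \<bar>?S m x\<bar> \<partial>P) \<le> (\<integral>\<^sup>+x. \<integral>\<^sup>+y. ennreal \<bar>?d (y @ x) * pl u y * pl w x\<bar> \<partial>P \<partial>P)"
    proof (rule nn_integral_mono_AE)
      have i: "AE x in P. integrable P (\<lambda>y. c g (y @ x) * pl u y * pl w x)" if "l.r.L2 g" for g
        using PS.AE_integrable_fst'[OF integrable_shift_product[OF that]] by simp
      show "AE x in P. ennreal \<bar>?S m x\<bar> \<le> (\<integral>\<^sup>+y. ennreal \<bar>?d (y @ x) * pl u y * pl w x\<bar> \<partial>P)"
        using i[OF cL[of m]] i[OF f]
      proof eventually_elim
        case (elim x)
        have "?S m x = (\<integral>y. c (clip m f) (y @ x) * pl u y * pl w x - c f (y @ x) * pl u y * pl w x \<partial>P)"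
          unfolding shift_expansion_def by (rule Bochner_Integration.integral_diff[OF elim, symmetric])
        then have "ennreal \<bar>?S m x\<bar> \<le> (\<integral>\<^sup>+y. norm (c (clip m f) (y @ x) * pl u y * pl w x - c f (y @ x) * pl u y * pl w x) \<partial>P)"
          using integral_norm_bound_ennreal[OF Bochner_Integration.integrable_diff[OF elim]] by simp
        then show ?case by (simp add: left_diff_distrib)
      qed
    qed
    also have "\<dots> = (\<integral>\<^sup>+z. ennreal (\<bar>?d z\<bar> * pl uw z) \<partial>P)"
    proof (rule nn_integral_shift_product)
      show "list_symmetric ?d"
        using list_symmetric_chaos[of "Q rho" f] list_symmetric_chaos[of "Q rho" "clip m f"]
        unfolding list_symmetric_def by metis
    qed measurable
    finally show "(\<integral>\<^sup>+x. ennreal \<bar>?S m x\<bar> \<partial>P) \<le> (\<integral>\<^sup>+z. ennreal (\<bar>?d z\<bar> * pl uw z) \<partial>P)" .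
  qed
  also have "\<dots> = 0"
  proof -
    have "(\<lambda>m. \<integral>\<phi>. (clip m f \<phi> - f \<phi>)\<^sup>2 \<partial>Q rho) \<longlonglongrightarrow> (\<integral>\<phi>. 0 \<partial>Q rho)"
    proof (rule integral_dominated_convergence)
      show "integrable (Q rho) (\<lambda>\<phi>. (f \<phi>)\<^sup>2)" using f by (simp add: l.r.L2_def)
      have "\<bar>clip m f \<phi> - f \<phi>\<bar> \<le> \<bar>f \<phi>\<bar>" for m \<phi> by (auto simp: clip_def)
      then show "AE \<phi> in Q rho. norm ((clip m f \<phi> - f \<phi>)\<^sup>2) \<le> (f \<phi>)\<^sup>2" for m
        by (intro AE_I2) (simp add: abs_le_square_iff[symmetric])
      show "AE \<phi> in Q rho. (\<lambda>m. (clip m f \<phi> - f \<phi>)\<^sup>2) \<longlonglongrightarrow> 0"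
      proof (rule AE_I2)
        fix \<phi>
        have "(\<lambda>m. (clip m f \<phi> - f \<phi>)\<^sup>2) \<longlonglongrightarrow> (f \<phi> - f \<phi>)\<^sup>2" by (intro tendsto_intros clip_tendsto)
        then show "(\<lambda>m. (clip m f \<phi> - f \<phi>)\<^sup>2) \<longlonglongrightarrow> 0" by simp
      qed
    qed measurable
    then have "(\<lambda>m. \<integral>\<phi>. (clip m f \<phi> - f \<phi>)\<^sup>2 \<partial>Q rho) \<longlonglongrightarrow> 0" by simp
    from l.r.chaos_pl_converges(1)[OF cL f this uw_measurable uw_square]
    show ?thesis using uw_nonneg by (intro lim_imp_Liminf) simp_all
  qed
  finally have "(\<integral>\<^sup>+x. ennreal \<bar>?D x\<bar> \<partial>P) = 0" by simp
  then have "AE x in P. ennreal \<bar>?D x\<bar> = 0"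
    by (subst (asm) nn_integral_0_iff_AE) measurable
  then show ?thesis by eventually_elim simp
qed

lemma chaos_lam_integrable:
  assumes f: "l.r.L2 f"
  shows "integrable P (\<lambda>x. chaos (Q l.lam) f x * pl w x)"
    and "(\<integral>x. chaos (Q l.lam) f x * pl w x \<partial>P) = (\<integral>\<phi>. f \<phi> \<partial>Q n.lam)"
proof -
  interpret PS: pair_sigma_finite P P by (rule l.pair_sigma_finite_LP)
  note [measurable] = l.r.L2_measurable[OF f] l.l.chaos_measurable[OF l.r.L2_measurable[OF f]]
  note H = integrable_shift_product[OF f]
  have "integrable P (shift_expansion f)"
    using PS.integrable_fst'[OF H] by (simp add: shift_expansion_def[abs_def])
  then show "integrable P (\<lambda>x. chaos (Q l.lam) f x * pl w x)"
    by (subst integrable_cong_AE[OF _ _ chaos_lam_L2[OF f]]) simp_all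
  have "(\<integral>x. chaos (Q l.lam) f x * pl w x \<partial>P) = (\<integral>x. shift_expansion f x \<partial>P)"
    by (rule integral_cong_AE[OF _ _ chaos_lam_L2[OF f]]) simp_all
  also have "\<dots> = (\<integral>x. \<integral>y. c f (y @ x) * pl u y * pl w x \<partial>P \<partial>P)"
    by (simp add: shift_expansion_def)
  also have "\<dots> = (\<integral>z. sum_splits (\<lambda>x y. c f (y @ x) * pl u y * pl w x) z \<partial>P)"
    by (rule l.integral_LP_sum_splits[symmetric]) (use H in simp)
  also have "\<dots> = (\<integral>z. c f z * pl (\<lambda>y. hn y - 1) z \<partial>P)"
  proof (rule Bochner_Integration.integral_cong[OF refl])
    fix z
    have "c f (b @ a) = c f z" if "(a, b) \<in> set (splits z)" for a b
      by (rule list_symmetricD[OF list_symmetric_chaos]) (simp add: mset_splits[OF that, symmetric])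
    then have "sum_splits (\<lambda>x y. c f (y @ x) * pl u y * pl w x) z = sum_splits (\<lambda>x y. c f z * (pl w x * pl u y)) z"
      by (intro sum_splits_cong) simp
    also have "\<dots> = c f z * pl (\<lambda>y. w y + u y) z" unfolding sum_splits_mult sum_splits_pl ..
    also have "(\<lambda>y. w y + u y) = (\<lambda>y. hn y - 1)" by (simp add: u_def w_def fun_eq_iff)
    finally show "sum_splits (\<lambda>x y. c f (y @ x) * pl u y * pl w x) z = c f z * pl (\<lambda>y. hn y - 1) z" .
  qed
  also have "\<dots> = (\<integral>\<phi>. f \<phi> \<partial>Q n.lam)"
    by (rule n.expansion_L2(2)[OF f, symmetric])
  finally show "(\<integral>x. chaos (Q l.lam) f x * pl w x \<partial>P) = (\<integral>\<phi>. f \<phi> \<partial>Q n.lam)" .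
qed

end

section \<open>Transfer to tuples and conclusion\<close>

text \<open>The left components of the splittings of \<open>tup n x\<close>, indexed by sets of
  positions. The largest position comes first, in accordance with \<open>tup\<close>.\<close>

primrec select :: "nat \<Rightarrow> (nat \<Rightarrow> 'a) \<Rightarrow> nat set \<Rightarrow> 'a list" where
  "select 0 x J = []"
| "select (Suc n) x J = (if Suc n \<in> J then [x (Suc n)] else []) @ select n x J"

lemma select_insert [simp]: "n < i \<Longrightarrow> select n x (insert i J) = select n x J"
  by (induction n) auto

text \<open>The last coordinate heads the list, so both sums branch in the same way on whether it
  belongs to the left part. This links sums over subsets of \<open>{1..n}\<close> with sums over
  splittings.\<close>

lemma sum_splits_tup:
  fixes H :: "'a list \<Rightarrow> 'a list \<Rightarrow> 'b::comm_monoid_add"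
  shows "sum_splits H (tup n x) = (\<Sum>J\<in>Pow {1..n}. H (select n x J) (select n x ({1..n} - J)))"
proof (induction n arbitrary: H)
  case (Suc n)
  have ins: "{1..Suc n} = insert (Suc n) {1..n}" by auto
  have inj: "inj_on (insert (Suc n)) (Pow {1..n})"
  proof (rule inj_onI)
    fix I J assume IJ: "I \<in> Pow {1..n}" "J \<in> Pow {1..n}" "insert (Suc n) I = insert (Suc n) J"
    then have "Suc n \<notin> I" "Suc n \<notin> J" by auto
    with IJ(3) show "I = J" using insert_ident[of "Suc n" I J] by blast
  qed
  have disj: "Pow {1..n} \<inter> insert (Suc n) ` Pow {1..n} = {}" by auto
  have a: "select (Suc n) x J = select n x J"
      "select (Suc n) x ({1..Suc n} - J) = x (Suc n) # select n x ({1..n} - J)"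
      "select (Suc n) x (insert (Suc n) J) = x (Suc n) # select n x J"
      "select (Suc n) x ({1..Suc n} - insert (Suc n) J) = select n x ({1..n} - J)"
    if J: "J \<subseteq> {1..n}" for J
  proof -
    have "Suc n \<notin> J" using J by auto
    then have "{1..Suc n} - J = insert (Suc n) ({1..n} - J)" "{1..Suc n} - insert (Suc n) J = {1..n} - J"
      using J unfolding ins by auto
    then show "select (Suc n) x J = select n x J"
      "select (Suc n) x ({1..Suc n} - J) = x (Suc n) # select n x ({1..n} - J)"
      "select (Suc n) x (insert (Suc n) J) = x (Suc n) # select n x J"
      "select (Suc n) x ({1..Suc n} - insert (Suc n) J) = select n x ({1..n} - J)"
      using \<open>Suc n \<notin> J\<close> by (simp_all del: atLeastAtMost_iff) auto
  qed
  have "(\<Sum>J\<in>Pow {1..Suc n}. H (select (Suc n) x J) (select (Suc n) x ({1..Suc n} - J)))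
      = (\<Sum>J\<in>Pow {1..n}. H (select (Suc n) x J) (select (Suc n) x ({1..Suc n} - J)))
      + (\<Sum>J\<in>Pow {1..n}. H (select (Suc n) x (insert (Suc n) J)) (select (Suc n) x ({1..Suc n} - insert (Suc n) J)))"
    unfolding ins Pow_insert
    by (subst sum.union_disjoint) (use disj inj in \<open>simp_all add: sum.reindex\<close>)
  also have "\<dots> = (\<Sum>J\<in>Pow {1..n}. H (select n x J) (x (Suc n) # select n x ({1..n} - J)))
      + (\<Sum>J\<in>Pow {1..n}. H (x (Suc n) # select n x J) (select n x ({1..n} - J)))"
    by (intro arg_cong2[where f = plus] sum.cong refl) (simp_all only: a Pow_iff)
  finally show ?case
    using Suc.IH[of "\<lambda>a. H (x (Suc n) # a)"] Suc.IH[of "\<lambda>a b. H a (x (Suc n) # b)"]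
    by (simp only: tup.simps sum_splits_Cons add.commute)
qed simp

lemma sum_list_select:
  fixes v :: "'a \<Rightarrow> 'b::comm_monoid_add"
  shows "sum_list (map v (select n x J)) = (\<Sum>j\<in>J \<inter> {1..n}. v (x j))"
proof (induction n)
  case (Suc n)
  have "J \<inter> {1..Suc n} = (if Suc n \<in> J then insert (Suc n) (J \<inter> {1..n}) else J \<inter> {1..n})"
    by (auto simp: atLeastAtMostSuc_conv)
  then show ?case using Suc by simp
qed simp

lemma length_select: "length (select n x J) = card (J \<inter> {1..n})"
  using sum_list_select[of "\<lambda>_. 1 :: nat" n x J] by (simp add: sum_list_triv)

lemma addl_select:
  assumes "J \<subseteq> {1..n}"
  shows "addl \<phi> (select n x J) = add_points \<phi> J x"
proof (rule measure_eqI)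
  fix B assume "B \<in> sets (addl \<phi> (select n x J))"
  moreover have "J \<inter> {1..n} = J" using assms by auto
  ultimately show "emeasure (addl \<phi> (select n x J)) B = emeasure (add_points \<phi> J x) B"
    by (simp only: sets_addl emeasure_addl emeasure_add_points sum_list_select)
qed simp

lemma diff_op_tup: "diff_op n x f \<phi> = list_diff (\<lambda>p. f (addl \<phi> p)) (tup n x)"
  unfolding diff_op_def list_diff_def sum_splits_tup
proof (rule sum.cong[OF refl])
  fix J assume "J \<in> Pow {1..n}"
  then have J: "J \<subseteq> {1..n}" by simp
  then have "({1..n} - J) \<inter> {1..n} = {1..n} - J" "card ({1..n} - J) = n - card J"
    by (auto simp: card_Diff_subset finite_subset)
  then show "(-1) ^ (n - card J) * f (add_points \<phi> J x)
      = (-1) ^ length (select n x ({1..n} - J)) * f (addl \<phi> (select n x J))"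
    by (simp only: length_select addl_select[OF J])
qed

lemma measurable_select:
  "{1..n} \<subseteq> I \<Longrightarrow> (\<lambda>x. select n x J) \<in> measurable (PiM I (\<lambda>_. M)) (list_space M)"
proof (induction n)
  case (Suc n)
  have "{1..n} \<subseteq> I" and [simp]: "Suc n \<in> I" using Suc.prems by auto
  then have [measurable]: "(\<lambda>x. select n x J) \<in> measurable (PiM I (\<lambda>_. M)) (list_space M)"
    using Suc.IH by blast
  show ?case by (cases "Suc n \<in> J") simp_all
qed (simp add: measurable_const)

lemma diff_op_measurable:
  assumes [measurable]: "f \<in> borel_measurable (config_space M)" "\<Phi> \<in> measurable N (config_space M)"
  shows "(\<lambda>(x, \<omega>). diff_op n x f (\<Phi> \<omega>)) \<in> borel_measurable (PiM {1..n} (\<lambda>_. M) \<Otimes>\<^sub>M N)"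
proof -
  have [measurable]: "(\<lambda>x. select n x J) \<in> measurable (PiM {1..n} (\<lambda>_. M)) (list_space M)" for J
    by (rule measurable_select) simp
  have [measurable]: "(\<lambda>x. select n x J) \<in> measurable (PiM {Suc 0..n} (\<lambda>_. M)) (list_space M)" for J
    by (rule measurable_select) simp
  have "(\<lambda>(x, \<omega>). \<Sum>J\<in>Pow {1..n}. (-1) ^ (n - card J) * f (addl (\<Phi> \<omega>) (select n x J)))
      \<in> borel_measurable (PiM {1..n} (\<lambda>_. M) \<Otimes>\<^sub>M N)"
    by measurable
  also have "(\<lambda>(x, \<omega>). \<Sum>J\<in>Pow {1..n}. (-1) ^ (n - card J) * f (addl (\<Phi> \<omega>) (select n x J)))
      = (\<lambda>(x, \<omega>). diff_op n x f (\<Phi> \<omega>))"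
    unfolding diff_op_def by (intro ext, clarify) (intro sum.cong refl, simp add: addl_select)
  finally show ?thesis .
qed

lemma tensor_power_tup: "tensor_power n v x = pl v (tup n x)"
  by (simp add: tensor_power_def pl_tup)

text \<open>Length \<open>n\<close> enters \<open>LP M\<close> with the positive weight
  \<open>1 / fact n\<close>, so a null set of \<open>LP M\<close> is null in every layer.\<close>

lemma AE_LP_imp_AE_measure_power:
  assumes sf: "sigma_finite_measure M" and "AE x in LP M. G x"
  shows "AE x in measure_power M n. G (tup n x)"
proof -
  obtain N where N: "{x \<in> space (LP M). \<not> G x} \<subseteq> N" "emeasure (LP M) N = 0" and NS: "N \<in> sets (list_space M)"
    using assms(2) by (auto elim!: AE_E)
  have "(\<Sum>n. ennreal (1 / fact n) * emeasure (list_power M n) N) = 0"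
    using N(2) by (simp only: emeasure_LP[OF NS])
  then have "ennreal (1 / fact n) * emeasure (list_power M n) N = 0"
    by (subst (asm) suminf_eq_zero_iff) (auto intro: summableI)
  moreover have "ennreal (1 / fact n) \<noteq> 0"
    using fact_gt_zero[of n, where 'a = real] by (simp only: ennreal_eq_0_iff not_le) simp
  ultimately have "emeasure (list_power M n) N = 0" by simp
  moreover have "{x \<in> space (list_power M n). \<not> G x} \<subseteq> N"
    using N(1) sets_eq_imp_space_eq[of "list_power M n" "LP M"] by simp
  ultimately have "AE x in list_power M n. G x"
    by (intro AE_I[of _ _ N]) (use NS in simp_all)
  then show ?thesis
    unfolding list_power_def measure_power_def by (rule AE_distrD[rotated]) measurable
qed

theorem theorem4p1:
  fixes X lam nu rho :: "'a measure"
    and W :: "'w measure"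
    and \<Phi> :: "'w \<Rightarrow> 'a measure"
    and Pr :: "'a measure \<Rightarrow> 'w measure"
    and f :: "'a measure \<Rightarrow> real"
  assumes "\<Phi> \<in> measurable W (config_space X)"
    and "\<And>mu. sigma_finite_measure mu \<Longrightarrow> sets mu = sets X \<Longrightarrow>
           prob_space (Pr mu) \<and> sets (Pr mu) = sets W \<and>
           is_poisson_law X mu (distr (Pr mu) (config_space X) \<Phi>)"
    and "sigma_finite_measure lam" "sets lam = sets X"
    and "sigma_finite_measure nu" "sets nu = sets X"
    and "sigma_finite_measure rho" "sets rho = sets X"
    and "absolutely_continuous rho (add_measure lam nu)"
    and "(\<integral>\<^sup>+y. ennreal ((1 - rn_density rho lam y)\<^sup>2) \<partial>rho)
         + (\<integral>\<^sup>+y. ennreal ((1 - rn_density rho nu y)\<^sup>2) \<partial>rho) < \<infinity>"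
    and "f \<in> borel_measurable (config_space X)"
    and "integrable (Pr rho) (\<lambda>\<omega>. (f (\<Phi> \<omega>))\<^sup>2)"
  shows
    "(integrable (Pr nu) (\<lambda>\<omega>. f (\<Phi> \<omega>)) \<and>
      integrable (Pr lam) (\<lambda>\<omega>. f (\<Phi> \<omega>)) \<and>
      (\<forall>n. AE x in density (measure_power rho n)
                     (\<lambda>x. ennreal (tensor_power n (\<lambda>y. \<bar>rn_density rho nu y - rn_density rho lam y\<bar>) x)).
            integrable (Pr lam) (\<lambda>\<omega>. diff_op n x f (\<Phi> \<omega>)))) \<and>
     (\<Sum>n. ennreal (1 / fact n) *
        (\<integral>\<^sup>+x. ennreal (\<bar>\<integral>\<omega>. diff_op n x f (\<Phi> \<omega>) \<partial>Pr lam\<bar> *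
                 tensor_power n (\<lambda>y. \<bar>rn_density rho nu y - rn_density rho lam y\<bar>) x)
           \<partial>measure_power rho n)) < \<infinity> \<and>
     (summable (\<lambda>n. 1 / fact (Suc n) *
        signed_power_integral rho nu lam (Suc n)
          (\<lambda>x. \<integral>\<omega>. diff_op (Suc n) x f (\<Phi> \<omega>) \<partial>Pr lam)) \<and>
      (\<integral>\<omega>. f (\<Phi> \<omega>) \<partial>Pr nu) = (\<integral>\<omega>. f (\<Phi> \<omega>) \<partial>Pr lam) +
        (\<Sum>n. 1 / fact (Suc n) *
          signed_power_integral rho nu lam (Suc n)
            (\<lambda>x. \<integral>\<omega>. diff_op (Suc n) x f (\<Phi> \<omega>) \<partial>Pr lam)))"
proof -
  note \<Phi> = assms(1) and Pr = assms(2) and lam = assms(3,4) and nu = assms(5,6) and rho = assms(7,8)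
    and ac = assms(9) and fin = assms(10) and f [measurable] = assms(11) and f2 = assms(12)
  interpret rho: sigma_finite_measure rho by fact
  define Q where "Q mu = distr (Pr mu) (config_space X) \<Phi>" for mu
  have fam: "poisson_family X Q"
    unfolding Q_def using Pr by (simp add: poisson_family_def)
  have acX: "absolutely_continuous rho mu" if "mu \<in> {lam, nu}" for mu
    unfolding absolutely_continuous_def
  proof
    fix N assume N: "N \<in> null_sets rho"
    then have "N \<in> null_sets (add_measure lam nu)" using ac by (auto simp: absolutely_continuous_def)
    moreover have NX: "N \<in> sets X" using N rho(2) by auto
    ultimately have "emeasure lam N + emeasure nu N = 0"
      using lam(2) nu(2) by (simp add: null_sets_def emeasure_add_measure)
    then show "N \<in> null_sets mu" using that NX lam(2) nu(2) by (auto simp: null_sets_def)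
  qed
  \<comment> \<open>The real-valued density still reproduces \<open>mu\<close>: for sigma-finite
    \<open>mu\<close> the derivative is finite almost everywhere.\<close>
  have dens: "density rho (\<lambda>x. ennreal (rn_density rho mu x)) = mu" if mu: "mu \<in> {lam, nu}" for mu
  proof -
    have s: "sigma_finite_measure mu" "sets mu = sets rho" using mu lam nu rho by auto
    have "density rho (\<lambda>x. ennreal (rn_density rho mu x)) = density rho (RN_deriv rho mu)"
    proof (rule density_cong)
      show "AE x in rho. ennreal (rn_density rho mu x) = RN_deriv rho mu x"
        using rho.RN_deriv_finite[OF s(1) acX[OF mu] s(2)]
        by eventually_elim (simp add: rn_density_def less_top)
    qed (simp_all add: rn_density_def)
    also have "\<dots> = mu" by (rule rho.density_RN_deriv[OF acX[OF mu] s(2)])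
    finally show ?thesis .
  qed
  have ch: "intensity_change X Q rho (rn_density rho mu)"
    if fin': "(\<integral>\<^sup>+y. ennreal ((1 - rn_density rho mu y)\<^sup>2) \<partial>rho) < \<infinity>" for mu
  proof -
    have m [measurable]: "rn_density rho mu \<in> borel_measurable rho"
      unfolding rn_density_def[abs_def] by measurable
    have "integrable rho (\<lambda>y. (rn_density rho mu y - 1)\<^sup>2)"
      using fin' by (intro integrableI_bounded) (simp_all add: power2_commute)
    moreover have "rn_density rho mu \<in> borel_measurable X"
      using m measurable_cong_sets[OF rho(2) refl] by blast
    ultimately show ?thesis
      using fam rho by (simp add: intensity_change_def intensity_change_axioms_def rn_density_def)
  qed
  have fins: "(\<integral>\<^sup>+y. ennreal ((1 - rn_density rho lam y)\<^sup>2) \<partial>rho) < \<infinity>"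
    "(\<integral>\<^sup>+y. ennreal ((1 - rn_density rho nu y)\<^sup>2) \<partial>rho) < \<infinity>"
    using fin by (auto simp: ennreal_add_less_top)
  interpret p: intensity_pair X Q rho "rn_density rho lam" "rn_density rho nu"
    using ch[OF fins(1)] ch[OF fins(2)] by (simp add: intensity_pair_def)
  have plam: "p.l.lam = lam" unfolding p.l.lam_def by (rule dens) simp
  have pnu: "p.n.lam = nu" unfolding p.n.lam_def by (rule dens) simp
  have \<Phi>m: "\<Phi> \<in> measurable (Pr mu) (config_space X)" if "mu \<in> {lam, nu, rho}" for mu
    using \<Phi> Pr[of mu] that lam nu rho measurable_cong_sets[of "Pr mu" W, OF _ refl] by auto
  have tr: "integrable (Q mu) g \<longleftrightarrow> integrable (Pr mu) (\<lambda>\<omega>. g (\<Phi> \<omega>))"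
    "(\<integral>\<phi>. g \<phi> \<partial>Q mu) = (\<integral>\<omega>. g (\<Phi> \<omega>) \<partial>Pr mu)"
    if "mu \<in> {lam, nu, rho}" "g \<in> borel_measurable (config_space X)" for mu and g :: "'a measure \<Rightarrow> real"
    unfolding Q_def using that \<Phi>m[OF that(1)] by (auto simp: integrable_distr_eq integral_distr)
  have L2: "p.l.r.L2 f"
    unfolding p.l.r.L2_def using f2 f by (simp add: tr)
  note [measurable] = p.l.l.chaos_measurable[OF f, unfolded plam]
  let ?E = "\<lambda>n x. \<integral>\<omega>. diff_op n x f (\<Phi> \<omega>) \<partial>Pr lam"
  let ?F = "\<lambda>x. chaos (Q lam) f x * pl p.w x"
  have w_eq: "p.w = (\<lambda>y. rn_density rho nu y - rn_density rho lam y)"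
    by (simp add: p.w_def fun_eq_iff)
  have tens: "tensor_power n (\<lambda>y. rn_density rho nu y - rn_density rho lam y) x = pl p.w (tup n x)"
    "tensor_power n (\<lambda>y. \<bar>rn_density rho nu y - rn_density rho lam y\<bar>) x = \<bar>pl p.w (tup n x)\<bar>" for n x
    by (simp_all add: tensor_power_tup w_eq abs_pl)
  \<comment> \<open>At tuples all of whose sublists give integrable shifts, the expectation of the
    alternating sum is the alternating sum of the expectations, that is, the kernel.\<close>
  have diff: "integrable (Pr lam) (\<lambda>\<omega>. diff_op n x f (\<Phi> \<omega>))" "?E n x = chaos (Q lam) f (tup n x)"
    if good: "\<forall>(p, q)\<in>set (splits (tup n x)). integrable (Q lam) (\<lambda>\<phi>. f (addl \<phi> p))"
      and x: "x \<in> space (measure_power rho n)" for n x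
  proof -
    have tx: "tup n x \<in> lists (space X)"
      using x rho(2)[THEN sets_eq_imp_space_eq] by (auto simp: measure_power_def space_PiM set_tup in_lists_conv_set)
    have i: "integrable (Pr lam) (\<lambda>\<omega>. f (addl (\<Phi> \<omega>) p))"
      and e: "(\<integral>\<omega>. f (addl (\<Phi> \<omega>) p) \<partial>Pr lam) = shift_mean (Q lam) f p"
      if "(p, q) \<in> set (splits (tup n x))" for p q
    proof -
      note [measurable] = p.l.r.const_list_X[OF conjunct1[OF splits_in_lists[OF that tx]]]
      have "(\<lambda>\<phi>. f (addl \<phi> p)) \<in> borel_measurable (config_space X)" by measurable
      then show "integrable (Pr lam) (\<lambda>\<omega>. f (addl (\<Phi> \<omega>) p))"
        "(\<integral>\<omega>. f (addl (\<Phi> \<omega>) p) \<partial>Pr lam) = shift_mean (Q lam) f p"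
        using good that tr[of lam "\<lambda>\<phi>. f (addl \<phi> p)"] by (auto simp: shift_mean_def)
    qed
    show "integrable (Pr lam) (\<lambda>\<omega>. diff_op n x f (\<Phi> \<omega>))"
      unfolding diff_op_tup list_diff_def by (rule integral_sum_splits(1)) (use i in auto)
    have "?E n x = sum_splits (\<lambda>p q. \<integral>\<omega>. (-1) ^ length q * f (addl (\<Phi> \<omega>) p) \<partial>Pr lam) (tup n x)"
      unfolding diff_op_tup list_diff_def by (rule integral_sum_splits(2)) (use i in auto)
    also have "\<dots> = chaos (Q lam) f (tup n x)"
      unfolding chaos_def list_diff_def by (rule sum_splits_cong) (simp add: e)
    finally show "?E n x = chaos (Q lam) f (tup n x)" .
  qed
  have good: "AE x in measure_power rho n. pl p.w (tup n x) \<noteq> 0 \<longrightarrow>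
      (\<forall>(p, q)\<in>set (splits (tup n x)). integrable (Q lam) (\<lambda>\<phi>. f (addl \<phi> p)))" for n
    using AE_LP_imp_AE_measure_power[OF rho(1) p.AE_integrable_shift_lam[OF L2]] unfolding plam .
  have EF: "AE x in measure_power rho n. ?E n x * pl p.w (tup n x) = ?F (tup n x)" for n
    using good[of n] AE_space by eventually_elim (use diff(2) in fastforce)
  have tm [measurable]: "tup n \<in> measurable (measure_power rho n) (list_space rho)" for n
    unfolding measure_power_def by measurable
  have ls: "list_space rho = list_space X" by (rule p.l.r.list_space_lam)
  have [measurable]: "tup n \<in> measurable (measure_power rho n) (list_space X)" for n
    using tm unfolding ls .
  \<comment> \<open>\<open>?E n\<close> is identified with the kernel only almost everywhere where
    the weight is nonzero, so its measurability is taken from joint measurability of the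
    difference.\<close>
  have Em [measurable]: "?E n \<in> borel_measurable (measure_power rho n)" for n
  proof -
    interpret pl: prob_space "Pr lam" using Pr[OF lam] by simp
    have \<Phi>': "\<Phi> \<in> measurable (Pr lam) (config_space rho)"
      using \<Phi>m[of lam] rho(2) by (simp add: config_space_def config_set_def)
    have f': "f \<in> borel_measurable (config_space rho)"
      using f rho(2) by (simp add: config_space_def config_set_def)
    show ?thesis
      unfolding measure_power_def
      by (rule pl.borel_measurable_lebesgue_integral) (rule diff_op_measurable[OF f' \<Phi>'])
  qed
  have Fint: "integrable (LP rho) ?F" and FI: "(\<integral>x. ?F x \<partial>LP rho) = (\<integral>\<phi>. f \<phi> \<partial>Q nu)"
    using p.chaos_lam_integrable[OF L2] unfolding plam pnu by auto
  have Fm [measurable]: "?F \<in> borel_measurable (list_space X)" by measurable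
  have c1: "integrable (Pr nu) (\<lambda>\<omega>. f (\<Phi> \<omega>))" "integrable (Pr lam) (\<lambda>\<omega>. f (\<Phi> \<omega>))"
    using p.n.expansion_L2(1)[OF L2] p.l.expansion_L2(1)[OF L2] f unfolding plam pnu by (simp_all add: tr)
  have c2: "AE x in density (measure_power rho n)
      (\<lambda>x. ennreal (tensor_power n (\<lambda>y. \<bar>rn_density rho nu y - rn_density rho lam y\<bar>) x)).
      integrable (Pr lam) (\<lambda>\<omega>. diff_op n x f (\<Phi> \<omega>))" for n
    unfolding tens
  proof (subst AE_density)
    show "(\<lambda>x. ennreal \<bar>pl p.w (tup n x)\<bar>) \<in> borel_measurable (measure_power rho n)" by measurable
    show "AE x in measure_power rho n. 0 < ennreal \<bar>pl p.w (tup n x)\<bar> \<longrightarrow>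
        integrable (Pr lam) (\<lambda>\<omega>. diff_op n x f (\<Phi> \<omega>))"
      using good[of n] AE_space by eventually_elim (use diff(1) in fastforce)
  qed
  have "(\<Sum>n. ennreal (1 / fact n) * (\<integral>\<^sup>+x. ennreal (\<bar>?E n x\<bar> *
      tensor_power n (\<lambda>y. \<bar>rn_density rho nu y - rn_density rho lam y\<bar>) x) \<partial>measure_power rho n))
      = (\<Sum>n. ennreal (1 / fact n) * (\<integral>\<^sup>+x. ennreal \<bar>?F x\<bar> \<partial>list_power rho n))"
  proof (intro suminf_cong arg_cong[where f = "\<lambda>y. _ * y"])
    fix n
    have "(\<integral>\<^sup>+x. ennreal \<bar>?F x\<bar> \<partial>list_power rho n) = (\<integral>\<^sup>+x. ennreal \<bar>?F (tup n x)\<bar> \<partial>measure_power rho n)"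
      unfolding list_power_def measure_power_def[symmetric] by (rule nn_integral_distr) (simp_all add: ls)
    also have "\<dots> = (\<integral>\<^sup>+x. ennreal (\<bar>?E n x\<bar> *
        tensor_power n (\<lambda>y. \<bar>rn_density rho nu y - rn_density rho lam y\<bar>) x) \<partial>measure_power rho n)"
      unfolding tens abs_mult[symmetric]
    proof (rule nn_integral_cong_AE)
      show "AE x in measure_power rho n. ennreal \<bar>?F (tup n x)\<bar> = ennreal \<bar>?E n x * pl p.w (tup n x)\<bar>"
        using EF[of n] by eventually_elim (simp only:)
    qed
    finally show "(\<integral>\<^sup>+x. ennreal (\<bar>?E n x\<bar> *
        tensor_power n (\<lambda>y. \<bar>rn_density rho nu y - rn_density rho lam y\<bar>) x) \<partial>measure_power rho n)
        = (\<integral>\<^sup>+x. ennreal \<bar>?F x\<bar> \<partial>list_power rho n)" ..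
  qed
  also have "\<dots> = (\<integral>\<^sup>+x. ennreal \<bar>?F x\<bar> \<partial>LP rho)"
    by (rule nn_integral_LP[symmetric]) (simp add: ls)
  also have "\<dots> < \<infinity>" using Fint by (simp add: integrable_iff_bounded)
  finally have c3: "(\<Sum>n. ennreal (1 / fact n) * (\<integral>\<^sup>+x. ennreal (\<bar>?E n x\<bar> *
      tensor_power n (\<lambda>y. \<bar>rn_density rho nu y - rn_density rho lam y\<bar>) x) \<partial>measure_power rho n)) < \<infinity>" .
  have sp: "signed_power_integral rho nu lam n (?E n) = (\<integral>x. ?F x \<partial>list_power rho n)" for n
  proof -
    have "signed_power_integral rho nu lam n (?E n) = (\<integral>x. ?E n x * pl p.w (tup n x) \<partial>measure_power rho n)"
      unfolding signed_power_integral_def tens ..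
    also have "\<dots> = (\<integral>x. ?F (tup n x) \<partial>measure_power rho n)"
      by (rule integral_cong_AE[OF _ _ EF]) measurable
    also have "\<dots> = (\<integral>x. ?F x \<partial>list_power rho n)"
      unfolding list_power_def measure_power_def[symmetric]
      by (rule integral_distr[symmetric]) (simp_all add: ls)
    finally show ?thesis .
  qed
  have sums: "(\<lambda>n. 1 / fact n * (\<integral>x. ?F x \<partial>list_power rho n)) sums (\<integral>x. ?F x \<partial>LP rho)"
    by (rule rho.LP_sums(2)[OF Fint])
  \<comment> \<open>At the empty list the product is 1 and the difference is the functional itself.
    Splitting this term off leaves the series from \<open>n = 1\<close>, written with
    \<open>Suc n\<close>.\<close>
  have zero: "1 / fact 0 * (\<integral>x. ?F x \<partial>list_power rho 0) = (\<integral>\<omega>. f (\<Phi> \<omega>) \<partial>Pr lam)"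
  proof -
    have "(\<integral>x. ?F x \<partial>list_power rho 0) = (\<integral>x. ?F (tup 0 x) \<partial>measure_power rho 0)"
      unfolding list_power_def measure_power_def[symmetric] by (rule integral_distr) (simp_all add: ls)
    also have "\<dots> = ?F []"
      by (simp add: measure_power_def PiM_empty lebesgue_integral_count_space_finite)
    also have "\<dots> = (\<integral>\<omega>. f (\<Phi> \<omega>) \<partial>Pr lam)"
      using tr(2)[of lam f] f by (simp add: chaos_def list_diff_def shift_mean_def)
    finally show ?thesis by simp
  qed
  have "(\<lambda>n. 1 / fact (Suc n) * (\<integral>x. ?F x \<partial>list_power rho (Suc n))) sums
      ((\<integral>x. ?F x \<partial>LP rho) - (\<integral>\<omega>. f (\<Phi> \<omega>) \<partial>Pr lam))"
    using sums unfolding zero[symmetric] by (subst sums_Suc_iff) simp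
  then have c4: "(\<lambda>n. 1 / fact (Suc n) * signed_power_integral rho nu lam (Suc n) (?E (Suc n))) sums
      ((\<integral>\<omega>. f (\<Phi> \<omega>) \<partial>Pr nu) - (\<integral>\<omega>. f (\<Phi> \<omega>) \<partial>Pr lam))"
    unfolding sp FI using tr(2)[of nu f] f by simp
  show ?thesis
    using c1 c2 c3 sums_summable[OF c4] sums_unique[OF c4] by simp
qed

end
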